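(* Let $k\ge2$ and let $j_1,\dots,j_{k-1}$ be nonzero integers (not necessarily distinct) with $\max_i|j_i|\ll R^{1/k}$. Then there is an absolute constant $c_1>0$ such that: (i) for $N^{\epsilon}\le R\le N^{1/k}$, $$\mathcal{S}_R(N,\mathbf{j})=NW_R(\mathbf{j})+O(R^k)+O_k\Big(N(\log N)^{4^{k-1}+k-2}\,e^{-c_1\sqrt{\log(R/\max_i|j_i|^{k-1})}}\Big);$$ (ii) if $0<\vartheta\le1$ is such that for every $\epsilon>0$ and $\mathcal{A}>0$, $\sum_{1\le q\le x^{\vartheta-\epsilon}}\max_{(a,q)=1}|E(x;q,a)|\ll x/\log^{\mathcal{A}}x$ for large $x$, then for $N^{\epsilon}\le R\le N^{\frac{\vartheta}{k-1}-\epsilon}$, $$\mathcal{S}_N(N,\mathbf{j})=NW_R(\mathbf{j})+O_k\Big(\frac{N}{(\log N)^{\frac{\mathcal{A}}2-4^{k-3/2}+2^{k-1}-1}}\Big).$$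
   Context: For $P\ge1$, $\Lambda_P(n)=\sum_{d\mid n,\,d\le P}\mu(d)\log(P/d)$ for $n\ge1$ and $\Lambda_P(n)=0$ for $n\le0$ (so $\Lambda_N(n)=\Lambda(n)$, the von Mangoldt function, for $1<n\le N$). With $\mathbf{j}=(j_1,\dots,j_{k-1})$ and $R\le P\le N$ define $$\mathcal{S}_P(N,\mathbf{j})=\sum_{n=1}^N\Lambda_R(n+j_1)\cdots\Lambda_R(n+j_{k-1})\Lambda_P(n),$$ $$W_R(\mathbf{j})=\sum_{\substack{d_1,\dots,d_{k-1}\le R\\ (d_i,j_i)=1,\ 1\le i\le k-1\\ (d_r,d_s)\mid j_s-j_r,\ 1\le r<s\le k-1}}\frac{1}{\phi([d_1,\dots,d_{k-1}])}\prod_{i=1}^{k-1}\mu(d_i)\log\frac{R}{d_i}.$$ $\psi(x;q,a)=\sum_{n\le x,\,n\equiv a\,(q)}\Lambda(n)$, $E(x;q,a)=\psi(x;q,a)-E_{a,q}x/\phi(q)$, $E_{a,q}=1$ if $(a,q)=1$, else $0$. $\epsilon>0$ small fixed, $N$ large. *)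

theory Defs
  imports Complex_Main "HOL-Library.FuncSet" "HOL-Computational_Algebra.Squarefree"
    "HOL-Number_Theory.Number_Theory" "HOL-Number_Theory.Prime_Powers"
begin

definition moebius :: "nat \<Rightarrow> real" where
  "moebius n = (if squarefree n then (- 1) ^ card (prime_factors n) else 0)"

definition LambdaT :: "real \<Rightarrow> int \<Rightarrow> real" where
  "LambdaT P n = (if n \<le> 0 then 0
     else (\<Sum>d | d dvd nat n \<and> real d \<le> P. moebius d * ln (P / real d)))"

text \<open>A tuple \<open>(j\<^sub>1, \<dots>, j\<^sub>k\<^sub>-\<^sub>1)\<close> is a function of which only the values
  on \<open>{1..k-1}\<close> matter.\<close>

definition max_abs :: "nat \<Rightarrow> (nat \<Rightarrow> int) \<Rightarrow> int" where
  "max_abs k j = Max ((\<lambda>i. \<bar>j i\<bar>) ` {1..k-1})"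

definition mixed_corr :: "nat \<Rightarrow> real \<Rightarrow> real \<Rightarrow> nat \<Rightarrow> (nat \<Rightarrow> int) \<Rightarrow> real" where
  "mixed_corr k R P N j =
     (\<Sum>n=1..N. (\<Prod>i=1..k-1. LambdaT R (int n + j i)) * LambdaT P (int n))"

definition W_index :: "nat \<Rightarrow> real \<Rightarrow> (nat \<Rightarrow> int) \<Rightarrow> (nat \<Rightarrow> nat) set" where
  "W_index k R j =
     {d \<in> {1..k-1} \<rightarrow>\<^sub>E {m. 1 \<le> m \<and> real m \<le> R}.
        (\<forall>i\<in>{1..k-1}. coprime (int (d i)) (j i)) \<and>
        (\<forall>r\<in>{1..k-1}. \<forall>s\<in>{1..k-1}. r < s \<longrightarrow> int (gcd (d r) (d s)) dvd j s - j r)}"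

definition W :: "nat \<Rightarrow> real \<Rightarrow> (nat \<Rightarrow> int) \<Rightarrow> real" where
  "W k R j = (\<Sum>d\<in>W_index k R j.
     1 / real (totient (Lcm (d ` {1..k-1}))) *
     (\<Prod>i=1..k-1. moebius (d i) * ln (R / real (d i))))"

definition psi_ap :: "real \<Rightarrow> nat \<Rightarrow> nat \<Rightarrow> real" where
  "psi_ap x q a = (\<Sum>n | 1 \<le> n \<and> real n \<le> x \<and> [n = a] (mod q). mangoldt n)"

definition E_ap :: "real \<Rightarrow> nat \<Rightarrow> nat \<Rightarrow> real" where
  "E_ap x q a = psi_ap x q a - (if coprime a q then 1 else 0) * x / real (totient q)"

text \<open>\<open>psi_ap x q a\<close> depends only on \<open>a\<close> modulo \<open>q\<close>, so the maximum over all \<open>a\<close>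
  coprime to \<open>q\<close> is a maximum over the finite set \<open>totatives q\<close>. The implied constant
  and the threshold for \<open>x\<close> may depend on \<open>\<epsilon>\<close> and \<open>A\<close>.\<close>

definition distribution_level :: "real \<Rightarrow> bool" where
  "distribution_level \<theta> \<longleftrightarrow>
     (\<forall>\<epsilon>>0. \<forall>A>0. \<exists>K x0. \<forall>x\<ge>x0.
        (\<Sum>q | 1 \<le> q \<and> real q \<le> x powr (\<theta> - \<epsilon>). Max ((\<lambda>a. \<bar>E_ap x q a\<bar>) ` totatives q))
          \<le> K * (x / ln x powr A))"

end

(*
The sum over n is opened by writing each Lambda_R as a divisor sum.  For a tuple
(d_1, ..., d_{k-1}) the conditions d_i | n + j_i are solvable iff the gcds divide the
differences of the shifts, and then they describe one residue class modulo the lcm D.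

In (i) the last factor Lambda_R(n) leaves the sum of mu(e) log(R/e) gcd(D,e)/e over the
e <= R with gcd(d_i,e) | j_i.  Peeling off one prime of D at a time reduces it to
h(x) = sum_{d <= x} mu(d)/d log(x/d), evaluated at x >= R / max|j|^{k-1} since the primes
of D allowed to divide e all divide the product of the j_i.  So everything rests on
h(x) = 1 + O(exp(-c sqrt(log x))), the prime number theorem with the classical error term.

That estimate is proved by Newman's contour method, made quantitative: with the weight
x^s (1 + s^2/rho^2) / s^2 on the circle |s| = rho, the partial sums of 1/zeta(1+s) contribute
O(log x / rho) on the left half, and the right half is moved into the classical zero-free
region, where rho = exp(kappa sqrt(log x)) balances the errors.  The zero-free region and the
lower bound for zeta in it come out together: dividing out all zeros rho near
s_0 = 1 + eta + it, each factor loses at most 1 - u Re 1/(s_0 - rho) when s_0 moves left by u,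
and 3 + 4 cos + cos 2 >= 0 bounds the sum of the Re 1/(s_0 - rho) by (3/4 + o(1))/eta.

In (ii) the residue classes are summed by the hypothesis on the level of distribution; the
multiplicity tau(q)^{k-1} of a modulus is removed by comparing it with a power of log N.  Since
the hypothesis holds for every power of log, so does the conclusion.
*)

theory Submission
  imports "HOL-Complex_Analysis.Complex_Analysis" "HOL-Real_Asymp.Real_Asymp" Defs
begin

section \<open>Zeros and growth of a holomorphic function\<close>

text \<open>The truncated sum is 0 at arguments n <= 0, while the formal divisor sum is not, so the
  expansion is made only for n > J = max |j_i|. The range n <= J is estimated trivially, and max
  |j_i| << R^(1/k) makes its contribution smaller than N by a fixed power. The same hypothesis gives
  R / J^(k-1) >> R^(1/k) >= N^(epsilon/k). The exponential factor is therefore at most exp(-b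
  sqrt(log N)) with some b > 0 independent of N, and half of it pays for every power of log N and
  every constant. This is what permits crude divisor bounds throughout, and implied constants equal
  to 1 once N is large. The delicate point is that the error term for h must survive the removal of
  an unbounded number of primes of D. Each prime may cost a constant factor, since 4^omega(D) and
  8^omega(D) are absorbed by powers of tau(D), but the recursion x -> x/p must not lose more than
  that. It closes only if the decay rate is small; hence the requirement c <= 1/5.\<close>

text \<open>The logarithm q of \<open>g / g z\<close> takes values in the half-plane Re q < M, which
  q / (2 M - q) maps into the unit disc with 0 fixed. Schwarz's lemma then bounds the logarithmic
  derivative at the centre and, away from it, the logarithm itself.\<close>

lemma Borel_Caratheodory_nonzero:
  fixes g :: "complex \<Rightarrow> complex"
  assumes hol: "g holomorphic_on ball z R" and R: "R > 0" and M: "M > 0"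
    and nz: "\<And>s. s \<in> ball z R \<Longrightarrow> g s \<noteq> 0"
    and bd: "\<And>s. s \<in> ball z R \<Longrightarrow> norm (g s) < exp M * norm (g z)"
  shows "norm (deriv g z / g z) \<le> 2 * M / R"
    and "s \<in> ball z R \<Longrightarrow>
      norm (g s) \<ge> norm (g z) * exp (- (2 * M * norm (s - z) / (R - norm (s - z))))"
proof -
  have z: "z \<in> ball z R" using R by simp
  obtain L where L: "L holomorphic_on ball z R" "\<And>x. x \<in> ball z R \<Longrightarrow> exp (L x) = g x"
    using holomorphic_logarithm_exists[OF _ _ hol nz z] by auto
  define q where "q s = L s - L z" for s
  have eq: "exp (q s) = g s / g z" if "s \<in> ball z R" for s
    unfolding q_def exp_diff using L(2) that z by simp
  have q_hol: "q holomorphic_on ball z R"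
    unfolding q_def by (intro holomorphic_intros L)
  have Re_q: "Re (q s) < M" if "s \<in> ball z R" for s
  proof -
    have "exp (Re (q s)) = norm (g s) / norm (g z)"
      using eq[OF that] by (metis norm_divide norm_exp_eq_Re)
    also have "\<dots> < exp M" using bd[OF that] nz[OF z] by (simp add: field_simps)
    finally show ?thesis by simp
  qed
  define w where "w u = q (z + of_real R * u) / (2 * of_real M - q (z + of_real R * u))" for u
  have inb: "z + of_real R * u \<in> ball z R" if "norm u < 1" for u
    using that R by (simp add: dist_norm norm_mult)
  have dn: "2 * of_real M - q (z + of_real R * u) \<noteq> 0" if "norm u < 1" for u
  proof
    assume "2 * of_real M - q (z + of_real R * u) = 0"
    then have "Re (q (z + of_real R * u)) = 2 * M" 
      by (metis Re_complex_of_real eq_iff_diff_eq_0 of_real_mult of_real_numeral)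
    with Re_q[OF inb[OF that]] M show False by simp
  qed
  have q_hol': "(\<lambda>u. q (z + of_real R * u)) holomorphic_on ball 0 1"
    by (rule holomorphic_on_compose_gen[OF _ q_hol, unfolded o_def])
       (auto intro!: holomorphic_intros simp: inb simp del: mem_ball)
  have w_hol: "w holomorphic_on ball 0 1"
    unfolding w_def using dn by (intro holomorphic_intros q_hol') auto
  have w0: "w 0 = 0" by (simp add: w_def q_def)
  have w1: "norm (w u) < 1" if "norm u < 1" for u
  proof -
    let ?q = "q (z + of_real R * u)"
    have "(norm ?q)^2 < (norm (2 * of_real M - ?q))^2"
    proof -
      \<comment> \<open>Four times this quantity is the difference of the two squared norms.\<close>
      have "0 < M * (M - Re ?q)" using Re_q[OF inb[OF that]] M by simp
      then show ?thesis unfolding cmod_power2 by (simp add: power2_eq_square algebra_simps)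
    qed
    then have "norm ?q < norm (2 * of_real M - ?q)"
      using norm_ge_zero power_less_imp_less_base by blast
    then show ?thesis unfolding w_def by (simp add: norm_divide divide_simps)
  qed
  note sw = Schwarz_Lemma[OF w_hol w0 w1]
  show "norm (deriv g z / g z) \<le> 2 * M / R"
  proof -
    have dq: "(q has_field_derivative deriv g z / g z) (at z)"
    proof -
      have dq: "(q has_field_derivative deriv q z) (at z)"
        by (rule holomorphic_derivI[OF q_hol open_ball z])
      have "((\<lambda>s. exp (q s)) has_field_derivative exp (q z) * deriv q z) (at z)"
        using dq by (auto intro!: derivative_eq_intros)
      then have "((\<lambda>s. g s / g z) has_field_derivative exp (q z) * deriv q z) (at z)"
        by (rule has_field_derivative_transform_within_open[OF _ open_ball z]) (use eq in auto)
      moreover have "((\<lambda>s. g s / g z) has_field_derivative deriv g z / g z) (at z)"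
        using DERIV_cdivide[OF holomorphic_derivI[OF hol open_ball z]] .
      ultimately have "exp (q z) * deriv q z = deriv g z / g z" by (rule DERIV_unique)
      moreover have "exp (q z) = 1" by (simp add: q_def)
      ultimately show ?thesis using dq by simp
    qed
    have "(w has_field_derivative (of_real R * (deriv g z / g z)) / (2 * of_real M)) (at 0)"
    proof -
      have "((\<lambda>u. q (z + of_real R * u)) has_field_derivative deriv g z / g z * of_real R) (at 0)"
        by (rule DERIV_chain2[where f=q and g="\<lambda>u. z + of_real R * u"]) 
           (use dq in \<open>auto intro!: derivative_eq_intros\<close>)
      moreover have "2 * of_real M - q (z + of_real R * 0) \<noteq> 0" using dn[of 0] by simp
      ultimately have "(w has_field_derivative (deriv g z / g z * of_real R * (2 * of_real M - q (z + of_real R * 0))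
           - q (z + of_real R * 0) * (0 - deriv g z / g z * of_real R)) /
          ((2 * of_real M - q (z + of_real R * 0)) * (2 * of_real M - q (z + of_real R * 0)))) (at 0)"
        unfolding w_def by (intro DERIV_divide DERIV_diff DERIV_const)
      then show ?thesis using M by (simp add: q_def field_simps)
    qed
    then have "deriv w 0 = (of_real R * (deriv g z / g z)) / (2 * of_real M)"
      by (rule DERIV_imp_deriv)
    then have "norm (of_real R * (deriv g z / g z) / (2 * of_real M)) \<le> 1"
      using sw(2)[of 0] by simp
    then have "R * norm (deriv g z / g z) / (2 * M) \<le> 1"
      using R M by (simp add: norm_mult norm_divide)
    then have "R * norm (deriv g z / g z) \<le> 2 * M" using M by (simp add: pos_divide_le_eq)
    then show ?thesis using R by (simp add: pos_le_divide_eq mult.commute)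
  qed
  show "norm (g s) \<ge> norm (g z) * exp (- (2 * M * norm (s - z) / (R - norm (s - z))))"
    if s: "s \<in> ball z R"
  proof -
    define u where "u = (s - z) / of_real R"
    define v where "v = norm u"
    have v: "v = norm (s - z) / R" using R by (simp add: v_def u_def norm_divide)
    have v1: "v < 1" using s R by (simp add: v dist_norm norm_minus_commute)
    have su: "z + of_real R * u = s" using R by (simp add: u_def)
    have wv: "norm (w u) \<le> v" using sw(1)[of u] v1 by (simp add: v_def)
    \<comment> \<open>The map from q to w solved for q, so that the Schwarz bound on w becomes a
      bound on q.\<close>
    have qw: "q s * (1 + w u) = 2 * of_real M * w u"
      using dn[of u] v1 unfolding w_def su v_def by (simp add: field_simps)
    have "norm (q s) * (1 - v) \<le> norm (q s) * norm (1 + w u)"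
    proof -
      have "1 - v \<le> norm (1 + w u)" using norm_triangle_ineq4[of "1 + w u" "w u"] wv by simp
      then show ?thesis by (intro mult_left_mono) auto
    qed
    also have "\<dots> = 2 * M * norm (w u)"
      using arg_cong[OF qw, of norm] M by (simp add: norm_mult)
    also have "\<dots> \<le> 2 * M * v" using wv M by simp
    finally have "norm (q s) \<le> 2 * M * v / (1 - v)" using v1 by (simp add: field_simps)
    also have "\<dots> = 2 * M * norm (s - z) / (R - norm (s - z))"
      using R v1 unfolding v by (simp add: field_simps)
    finally have n: "norm (q s) \<le> 2 * M * norm (s - z) / (R - norm (s - z))" .
    have "norm (g s) = norm (g z) * exp (Re (q s))"
      using arg_cong[OF eq[OF s], of norm] nz[OF z] by (simp add: norm_divide field_simps)
    moreover have "Re (q s) \<ge> - norm (q s)" using abs_Re_le_cmod[of "q s"] by linarith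
    ultimately show ?thesis using n by (simp add: mult_left_mono)
  qed
qed

text \<open>Zeros in the inner third of the disc are divided out until none is left. The process
  stops because such a zero is at least twice as far from every point of the circle |t - z| = r as
  from z: each division gains a factor 2 in the maximum principle, so \<open>2 ^ n \<le> B\<close>.
  The same gain preserves the bound B for the quotient.\<close>

lemma zero_factorization:
  fixes f :: "complex \<Rightarrow> complex"
  assumes S: "open S" and hol: "f holomorphic_on S" and sub: "cball z r \<subseteq> S" and r: "r > 0"
    and nz: "f z \<noteq> 0" and bd: "\<And>s. s \<in> cball z r \<Longrightarrow> norm (f s) \<le> B * norm (f z)"
  shows "\<exists>g \<rho> (n :: nat). g holomorphic_on S \<and> (\<forall>s\<in>S. f s = g s * (\<Prod>i<n. s - \<rho> i)) \<and>
    (\<forall>i<n. \<rho> i \<in> cball z (r/3)) \<and> (\<forall>s\<in>cball z (r/3). g s \<noteq> 0) \<and>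
    (\<forall>s\<in>cball z r. norm (g s) \<le> B * norm (g z))"
proof -
  define P where "P n \<longleftrightarrow> (\<exists>\<rho> g. g holomorphic_on S \<and> (\<forall>s\<in>S. f s = g s * (\<Prod>i<n. s - \<rho> i)) \<and>
      (\<forall>i<n. \<rho> i \<in> cball z (r/3)))" for n :: nat
  have zS: "z \<in> S" using sub r by auto
  have B0: "B \<ge> 1" using bd[of z] nz r by simp
  have key: "norm (g s) * 2 ^ n \<le> B * norm (g z)"
    if g: "g holomorphic_on S" "\<And>s. s \<in> S \<Longrightarrow> f s = g s * (\<Prod>i<n. s - \<rho> i)"
      "\<And>i. i < n \<Longrightarrow> \<rho> i \<in> cball z (r/3)" and s: "s \<in> cball z r" for n :: nat and \<rho> g s
  proof -
    have pos: "(\<Prod>i<n. norm (z - \<rho> i)) > 0"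
    proof -
      have "(\<Prod>i<n. z - \<rho> i) \<noteq> 0" using g(2)[OF zS] nz by auto
      then have "norm (\<Prod>i<n. z - \<rho> i) > 0" by simp
      then show ?thesis by (simp add: prod_norm)
    qed
    have "norm (g s) \<le> B * norm (g z) / 2 ^ n"
    proof (rule maximum_modulus_frontier[of g "cball z r"])
      show "g holomorphic_on interior (cball z r)"
        using g(1) sub by (meson holomorphic_on_subset interior_subset order_trans)
      show "continuous_on (closure (cball z r)) g"
        using continuous_on_subset[OF holomorphic_on_imp_continuous_on[OF g(1)] sub] by simp
      fix t assume "t \<in> frontier (cball z r)"
      then have t: "norm (t - z) = r" using r by (simp add: dist_norm norm_minus_commute)
      then have tc: "t \<in> cball z r" by (simp add: dist_norm norm_minus_commute)
      have "norm (g t) * (2 ^ n * (\<Prod>i<n. norm (z - \<rho> i))) = norm (g t) * (\<Prod>i<n. 2 * norm (z - \<rho> i))"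
        by (simp add: prod.distrib)
      also have "\<dots> \<le> norm (g t) * (\<Prod>i<n. norm (t - \<rho> i))"
      proof (intro mult_left_mono prod_mono conjI)
        fix i assume "i \<in> {..<n}"
        then have "norm (z - \<rho> i) \<le> r/3" using g(3)[of i] by (simp add: dist_norm)
        moreover have "norm (t - z) \<le> norm (t - \<rho> i) + norm (z - \<rho> i)"
          using norm_triangle_ineq4[of "t - \<rho> i" "z - \<rho> i"] by simp
        ultimately show "2 * norm (z - \<rho> i) \<le> norm (t - \<rho> i)" using t by linarith
      qed auto
      also have "\<dots> = norm (f t)" using g(2)[of t] tc sub by (simp add: norm_mult prod_norm subset_iff)
      also have "\<dots> \<le> B * norm (f z)" using bd[OF tc] .
      also have "\<dots> = B * norm (g z) * (\<Prod>i<n. norm (z - \<rho> i))"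
        using g(2)[OF zS] by (simp add: norm_mult prod_norm)
      finally have "norm (g t) * 2 ^ n * (\<Prod>i<n. norm (z - \<rho> i)) \<le> B * norm (g z) * (\<Prod>i<n. norm (z - \<rho> i))"
        by (simp add: mult_ac)
      then have "norm (g t) * 2 ^ n \<le> B * norm (g z)" using pos by (rule mult_right_le_imp_le)
      then show "norm (g t) \<le> B * norm (g z) / 2 ^ n" by (simp add: field_simps)
    qed (use s in auto)
    then show ?thesis by (simp add: field_simps)
  qed
  have "P 0" unfolding P_def using hol by auto
  have bnd: "2 ^ n \<le> B" if Pn: "P n" for n
  proof -
    obtain \<rho> g where g: "g holomorphic_on S" "\<And>s. s \<in> S \<Longrightarrow> f s = g s * (\<Prod>i<n. s - \<rho> i)"
      "\<And>i. i < n \<Longrightarrow> \<rho> i \<in> cball z (r/3)" using Pn unfolding P_def by blast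
    have "g z \<noteq> 0" using g(2)[OF zS] nz by auto
    then show ?thesis using key[OF g, of z] r by simp
  qed
  have "\<exists>n. P n \<and> (\<forall>m. P m \<longrightarrow> m \<le> n)"
  proof (rule Nat.ex_has_greatest_nat[of P 0 "nat \<lceil>B\<rceil>"])
    show "\<forall>y. P y \<longrightarrow> y \<le> nat \<lceil>B\<rceil>"
    proof (intro allI impI)
      fix y assume "P y"
      have "real y \<le> 2 ^ y" using of_nat_less_two_power[of y, where 'a=real] by linarith
      also have "\<dots> \<le> B" using bnd[OF \<open>P y\<close>] by simp
      finally show "y \<le> nat \<lceil>B\<rceil>" by linarith
    qed
  qed fact
  then obtain n where n: "P n" "\<And>m. P m \<Longrightarrow> m \<le> n" by blast
  obtain \<rho> g where g: "g holomorphic_on S" "\<And>s. s \<in> S \<Longrightarrow> f s = g s * (\<Prod>i<n. s - \<rho> i)"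
      "\<And>i. i < n \<Longrightarrow> \<rho> i \<in> cball z (r/3)" using n(1) unfolding P_def by blast
  show ?thesis
  proof (intro exI conjI ballI allI impI)
    show "g holomorphic_on S" by (rule g(1))
  next
    fix s assume "s \<in> S" then show "f s = g s * (\<Prod>i<n. s - \<rho> i)" by (rule g(2))
  next
    fix i assume "i < n" then show "\<rho> i \<in> cball z (r/3)" by (rule g(3))
  next
    fix s assume s: "s \<in> cball z (r/3)"
    show "g s \<noteq> 0"
    proof
      assume g0: "g s = 0"
      \<comment> \<open>A further zero s could be divided out as well, against the maximality of n;
        h is the quotient by t - s with its removable singularity filled in.\<close>
      define h where "h t = (if t = s then deriv g s else (g t - g s) / (t - s))" for t
      define \<rho>' where "\<rho>' = \<rho>(n := s)"
      have "h holomorphic_on S" unfolding h_def by (rule pole_lemma_open[OF g(1) S])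
      moreover have "f t = h t * (\<Prod>i<Suc n. t - \<rho>' i)" if "t \<in> S" for t
      proof -
        have "(\<Prod>i<n. t - \<rho>' i) = (\<Prod>i<n. t - \<rho> i)" by (intro prod.cong) (auto simp: \<rho>'_def)
        moreover have "g t = h t * (t - s)" using g0 by (simp add: h_def)
        ultimately show ?thesis using g(2)[OF that] by (simp add: \<rho>'_def)
      qed
      moreover have "\<rho>' i \<in> cball z (r/3)" if "i < Suc n" for i
        using that g(3)[of i] s by (auto simp: \<rho>'_def less_Suc_eq)
      ultimately have "P (Suc n)" unfolding P_def by blast
      then show False using n(2) by fastforce
    qed
  next
    fix s assume s: "s \<in> cball z r"
    have "norm (g s) \<le> norm (g s) * 2 ^ n" by (simp add: mult_left_le_one_le mult_le_cancel_left1)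
    then show "norm (g s) \<le> B * norm (g z)" using key[OF g s] by linarith
  qed
qed

lemma prod_one_minus_ge_one_minus_sum:
  fixes x :: "'a \<Rightarrow> real"
  assumes "finite A" "\<And>i. i \<in> A \<Longrightarrow> 0 \<le> x i" "sum x A \<le> 1"
  shows "(\<Prod>i\<in>A. 1 - x i) \<ge> 1 - sum x A"
  using assms
proof (induction A rule: finite_induct)
  case (insert a A)
  have "sum x A \<ge> 0" "x a \<ge> 0" using insert by (auto intro: sum_nonneg)
  with insert have IH: "(\<Prod>i\<in>A. 1 - x i) \<ge> 1 - sum x A" "x a \<le> 1"
    using insert.IH insert.prems insert.hyps \<open>sum x A \<ge> 0\<close> \<open>x a \<ge> 0\<close> by (auto simp: sum.insert)
  have "(1 - x a) * (\<Prod>i\<in>A. 1 - x i) \<ge> (1 - x a) * (1 - sum x A)"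
    using IH by (intro mult_left_mono) auto
  moreover have "(1 - x a) * (1 - sum x A) \<ge> 1 - x a - sum x A"
    using \<open>sum x A \<ge> 0\<close> \<open>x a \<ge> 0\<close> by (simp add: algebra_simps)
  ultimately show ?case using insert by simp
qed simp

text \<open>All zeros lie to the left of z, so every Re 1/(z - rho) is positive, and their sum
  equals Re f'/f at z up to the zero-free factor, which contributes at most 6 M / r. Hence an upper
  bound for Re f'/f at the single point z bounds |f| from below on a segment to its left, without
  any zero being located.\<close>

lemma Landau_local:
  fixes f :: "complex \<Rightarrow> complex"
  assumes S: "open S" and hol: "f holomorphic_on S" and sub: "cball z r \<subseteq> S" and r: "r > 0"
    and nz: "\<And>s. s \<in> S \<Longrightarrow> Re s \<ge> Re z \<Longrightarrow> f s \<noteq> 0"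
    and bd: "\<And>s. s \<in> cball z r \<Longrightarrow> norm (f s) \<le> B * norm (f z)" and B: "B < exp M" and M: "M > 0"
  shows "Re (deriv f z / f z) \<ge> - (6 * M / r)"
    and "0 \<le> u \<Longrightarrow> u \<le> r / 6 \<Longrightarrow> norm (f (z - of_real u)) \<ge>
       norm (f z) * exp (- (12 * M * u / r)) * (1 - u * (Re (deriv f z / f z) + 6 * M / r))"
proof -
  have zS: "z \<in> S" using sub r by auto
  have fz: "f z \<noteq> 0" using nz[OF zS] by simp
  have "\<exists>g \<rho> (n :: nat). g holomorphic_on S \<and> (\<forall>s\<in>S. f s = g s * (\<Prod>i<n. s - \<rho> i)) \<and> (\<forall>i<n. \<rho> i \<in> cball z (r/3)) \<and> (\<forall>s\<in>cball z (r/3). g s \<noteq> 0) \<and> (\<forall>s\<in>cball z r. norm (g s) \<le> B * norm (g z))"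
    by (rule zero_factorization[OF S hol sub r fz bd])
  then obtain g \<rho> and n :: nat where g0: "g holomorphic_on S" "\<forall>s\<in>S. f s = g s * (\<Prod>i<n. s - \<rho> i)"
    "\<forall>i<n. \<rho> i \<in> cball z (r/3)" "\<forall>s\<in>cball z (r/3). g s \<noteq> 0"
    "\<forall>s\<in>cball z r. norm (g s) \<le> B * norm (g z)"
    by (elim exE conjE)
  note g = g0(1) g0(2-5)[rule_format]
  have Re_rho: "Re (\<rho> i) < Re z" if "i < n" for i
  proof -
    have "\<rho> i \<in> S" using g(3)[OF that] sub r by (auto simp: subset_iff)
    moreover have "(\<Prod>ia<n. \<rho> i - \<rho> ia) = 0" by (rule prod_zero) (use that in auto)
    then have "f (\<rho> i) = 0" using g(2)[OF \<open>\<rho> i \<in> S\<close>] by simp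
    ultimately show ?thesis using nz not_le by blast
  qed
  have gz: "g z \<noteq> 0" using g(4)[of z] r by simp
  have sub': "ball z (r/3) \<subseteq> S" using sub r by (auto simp: subset_iff)
  have ghol: "g holomorphic_on ball z (r/3)" by (rule holomorphic_on_subset[OF g(1) sub'])
  have gb: "norm (g s) < exp M * norm (g z)" if "s \<in> ball z (r/3)" for s
  proof -
    have "norm (g s) \<le> B * norm (g z)" using g(5)[of s] that r by auto
    also have "\<dots> < exp M * norm (g z)" using B gz by simp
    finally show ?thesis .
  qed
  have g4: "g s \<noteq> 0" if "s \<in> ball z (r/3)" for s using g(4) that by auto
  have r3: "r/3 > 0" using r by simp
  note BC = Borel_Caratheodory_nonzero[OF ghol r3 M g4 gb, simplified]
  have bc1: "norm (deriv g z / g z) \<le> 6 * M / r" using BC(1) by (simp add: mult_ac norm_divide)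
  have logd: "deriv f z / f z = deriv g z / g z + (\<Sum>i<n. 1 / (z - \<rho> i))"
  proof -
    have zr: "z - \<rho> i \<noteq> 0" if "i < n" for i using Re_rho[OF that] by auto
    have D1: "((\<lambda>s. \<Prod>i<m. s - \<rho> i) has_field_derivative (\<Prod>i<m. z - \<rho> i) * (\<Sum>i<m. 1 / (z - \<rho> i))) (at z)"
      if "m \<le> n" for m
      using that
    proof (induction m)
      case (Suc m)
      have "((\<lambda>s. (\<Prod>i<m. s - \<rho> i) * (s - \<rho> m)) has_field_derivative
         (\<Prod>i<Suc m. z - \<rho> i) * (\<Sum>i<Suc m. 1 / (z - \<rho> i))) (at z)"
      proof -
        have IH: "((\<lambda>s. \<Prod>i<m. s - \<rho> i) has_field_derivative (\<Prod>i<m. z - \<rho> i) * (\<Sum>i<m. 1 / (z - \<rho> i))) (at z)"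
          using Suc by simp
        have "((\<lambda>s. s - \<rho> m) has_field_derivative 1) (at z)" by (auto intro!: derivative_eq_intros)
        note D = DERIV_mult[OF IH this]
        have "z - \<rho> m \<noteq> 0" using zr[of m] Suc.prems by simp
        then have "(\<Prod>i<m. z - \<rho> i) * (\<Sum>i<m. 1 / (z - \<rho> i)) * (z - \<rho> m) + 1 * (\<Prod>i<m. z - \<rho> i)
          = (\<Prod>i<Suc m. z - \<rho> i) * (\<Sum>i<Suc m. 1 / (z - \<rho> i))"
          unfolding prod.lessThan_Suc sum.lessThan_Suc by (simp add: distrib_left)
        from DERIV_cong[OF D this] show ?thesis .
      qed
      then show ?case by simp
    qed simp
    have "((\<lambda>s. g s * (\<Prod>i<n. s - \<rho> i)) has_field_derivative
         deriv g z * (\<Prod>i<n. z - \<rho> i) + (\<Prod>i<n. z - \<rho> i) * (\<Sum>i<n. 1 / (z - \<rho> i)) * g z) (at z)"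
      by (rule DERIV_mult[OF holomorphic_derivI[OF g(1) S zS] D1[OF order_refl]])
    then have "(f has_field_derivative
         deriv g z * (\<Prod>i<n. z - \<rho> i) + (\<Prod>i<n. z - \<rho> i) * (\<Sum>i<n. 1 / (z - \<rho> i)) * g z) (at z)"
      by (rule has_field_derivative_transform_within_open[OF _ S zS]) (simp add: g(2))
    then have "deriv f z = deriv g z * (\<Prod>i<n. z - \<rho> i) + (\<Prod>i<n. z - \<rho> i) * (\<Sum>i<n. 1 / (z - \<rho> i)) * g z"
      by (rule DERIV_imp_deriv)
    moreover have "(\<Prod>i<n. z - \<rho> i) \<noteq> 0" using zr by (auto simp: prod_zero_iff)
    ultimately show ?thesis using gz unfolding g(2)[OF zS] by (simp add: field_simps)
  qed
  define y where "y i = Re (1 / (z - \<rho> i))" for i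
  have y0: "y i \<ge> 0" if "i < n" for i
    using Re_rho[OF that] unfolding y_def by (simp add: Re_divide)
  have ysum: "Re (deriv f z / f z) = Re (deriv g z / g z) + (\<Sum>i<n. y i)"
    unfolding logd y_def by (simp add: Re_sum)
  have reg: "\<bar>Re (deriv g z / g z)\<bar> \<le> 6 * M / r"
    using abs_Re_le_cmod[of "deriv g z / g z"] bc1 by linarith
  show "Re (deriv f z / f z) \<ge> - (6 * M / r)"
    using ysum reg sum_nonneg[of "{..<n}" y] y0 by simp
  show "norm (f (z - of_real u)) \<ge>
       norm (f z) * exp (- (12 * M * u / r)) * (1 - u * (Re (deriv f z / f z) + 6 * M / r))"
    if u: "0 \<le> u" "u \<le> r / 6"
  proof (cases "1 - u * (Re (deriv f z / f z) + 6 * M / r) \<ge> 0")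
    case False
    then have "norm (f z) * exp (- (12 * M * u / r)) * (1 - u * (Re (deriv f z / f z) + 6 * M / r)) \<le> 0"
      by (intro mult_nonneg_nonpos) auto
    then show ?thesis using norm_ge_zero order_trans by blast
  next
    case True
    define s where "s = z - of_real u"
    have sb: "s \<in> ball z (r/3)" using u r by (simp add: s_def dist_norm)
    then have sS: "s \<in> S" using sub' by auto
    have ns: "norm (s - z) = u" using u by (simp add: s_def)
    have yle: "(\<Sum>i<n. y i) \<le> Re (deriv f z / f z) + 6 * M / r" using ysum reg by linarith
    have usum: "(\<Sum>i<n. u * y i) \<le> u * (Re (deriv f z / f z) + 6 * M / r)"
      unfolding sum_distrib_left[symmetric] using yle u by (intro mult_left_mono) auto
    have "1 - (\<Sum>i<n. u * y i) \<le> (\<Prod>i<n. 1 - u * y i)"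
      by (rule prod_one_minus_ge_one_minus_sum) (use y0 u usum True in auto)
    also have "\<dots> * (\<Prod>i<n. norm (z - \<rho> i)) = (\<Prod>i<n. (1 - u * y i) * norm (z - \<rho> i))"
      by (simp add: prod.distrib)
    finally have p1: "(1 - (\<Sum>i<n. u * y i)) * (\<Prod>i<n. norm (z - \<rho> i)) \<le> (\<Prod>i<n. (1 - u * y i) * norm (z - \<rho> i))"
      by (simp add: mult_right_mono prod_nonneg)
    have uy: "u * y i \<le> 1" if "i < n" for i
    proof -
      have "u * y i \<le> (\<Sum>i<n. u * y i)"
        by (rule member_le_sum) (use that y0 u in auto)
      then show ?thesis using usum True by linarith
    qed
    have p2: "(\<Prod>i<n. (1 - u * y i) * norm (z - \<rho> i)) \<le> (\<Prod>i<n. norm (s - \<rho> i))"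
    proof (intro prod_mono conjI)
      fix i assume "i \<in> {..<n}" then have i: "i < n" by simp
      have zr: "z - \<rho> i \<noteq> 0" using Re_rho[OF i] by auto
      show "0 \<le> (1 - u * y i) * norm (z - \<rho> i)" using uy[OF i] by simp
      have "1 - u * y i = Re (1 - of_real u / (z - \<rho> i))"
        unfolding y_def by (simp add: Re_divide)
      also have "\<dots> \<le> norm (1 - of_real u / (z - \<rho> i))" by (rule complex_Re_le_cmod)
      also have "1 - of_real u / (z - \<rho> i) = (s - \<rho> i) / (z - \<rho> i)"
        using zr by (simp add: s_def field_simps)
      finally show "(1 - u * y i) * norm (z - \<rho> i) \<le> norm (s - \<rho> i)"
        using zr by (simp add: norm_divide field_simps)
    qed
    have p3: "(1 - u * (Re (deriv f z / f z) + 6 * M / r)) * (\<Prod>i<n. norm (z - \<rho> i)) \<le> (\<Prod>i<n. norm (s - \<rho> i))"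
    proof -
      have "(1 - u * (Re (deriv f z / f z) + 6 * M / r)) * (\<Prod>i<n. norm (z - \<rho> i))
         \<le> (1 - (\<Sum>i<n. u * y i)) * (\<Prod>i<n. norm (z - \<rho> i))"
        using usum by (intro mult_right_mono prod_nonneg) auto
      then show ?thesis using p1 p2 by linarith
    qed
    have "norm (g s) \<ge> norm (g z) * exp (- (2 * M * u / (r/3 - u)))"
      using BC(2)[of s] sb by (simp add: ns)
    moreover have "2 * M * u / (r/3 - u) \<le> 12 * M * u / r"
    proof -
      \<comment> \<open>A shift of at most r/6 stays at distance at least r/6 from the boundary of
        the zero-free disc of radius r/3.\<close>
      have "2 * M * u / (r/3 - u) \<le> 2 * M * u / (r/6)"
        using u r M by (intro divide_left_mono) auto
      then show ?thesis by simp
    qed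
    moreover have "norm (g z) * exp (- (12 * M * u / r)) \<le> norm (g z) * exp (- (2 * M * u / (r/3 - u)))"
      using calculation(2) by (intro mult_left_mono) auto
    ultimately have g1: "norm (g z) * exp (- (12 * M * u / r)) \<le> norm (g s)" by linarith
    have "norm (f z) * exp (- (12 * M * u / r)) * (1 - u * (Re (deriv f z / f z) + 6 * M / r))
      = (norm (g z) * exp (- (12 * M * u / r))) * ((1 - u * (Re (deriv f z / f z) + 6 * M / r)) * (\<Prod>i<n. norm (z - \<rho> i)))"
      using arg_cong[OF g(2)[OF zS], of norm] by (simp add: norm_mult prod_norm)
    also have "\<dots> \<le> norm (g s) * (\<Prod>i<n. norm (s - \<rho> i))"
      using g1 p3 True by (intro mult_mono) (auto intro!: mult_nonneg_nonneg prod_nonneg)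
    also have "\<dots> = norm (f s)" using g(2)[OF sS] by (simp add: norm_mult prod_norm)
    finally show ?thesis by (simp add: s_def)
  qed
qed

section \<open>The zeta function to the right of the imaginary axis\<close>

text \<open>The Dirichlet term n^(-s) for positive n, written as an exponential so that it is entire
  in s.\<close>

definition npow :: "nat \<Rightarrow> complex \<Rightarrow> complex" where
  "npow n s = exp (- s * of_real (ln (real n)))"

lemma norm_npow: "n > 0 \<Longrightarrow> norm (npow n s) = real n powr (- Re s)"
  by (simp add: npow_def norm_exp_eq_Re powr_def)

lemma npow_mult: "m > 0 \<Longrightarrow> n > 0 \<Longrightarrow> npow (m * n) s = npow m s * npow n s"
  by (simp add: npow_def ln_mult exp_add [symmetric] algebra_simps)

lemma npow_1 [simp]: "npow 1 s = 1" "npow (Suc 0) s = 1"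
  by (simp_all add: npow_def)

lemma npow_has_field_derivative:
  "(npow n has_field_derivative - of_real (ln (real n)) * npow n s) (at s)"
  unfolding npow_def by (auto intro!: derivative_eq_intros)

lemma npow_holomorphic: "npow n holomorphic_on S"
  unfolding npow_def by (intro holomorphic_intros)

text \<open>The terms of the series \<open>(s - 1) \<zeta>(s) - 1\<close>, telescoped against \<open>n\<^bsup>1-s\<^esup>\<close> so that it
  converges for \<open>Re s > 0\<close>.\<close>

definition zterm :: "nat \<Rightarrow> complex \<Rightarrow> complex" where
  "zterm n s = (s - 1) * npow n s + npow (Suc n) (s - 1) - npow n (s - 1)"

text \<open>This is (s - 1) zeta(s). With the pole removed it is holomorphic on every disc needed
  near Re s = 1, and 1 / zeta(1 + s) becomes s / \<open>zetaF (1 + s)\<close>.\<close>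

definition zetaF :: "complex \<Rightarrow> complex" where
  "zetaF s = 1 + (\<Sum>n. zterm (Suc n) s)"

lemma zterm_holomorphic: "zterm n holomorphic_on S"
  unfolding zterm_def by (intro holomorphic_intros npow_holomorphic holomorphic_on_compose_gen[OF _ npow_holomorphic, unfolded o_def]) auto

text \<open>The telescoped term is the increment over [n, n + 1] of a function with derivative (s -
  1)(n^(-s) - w^(-s)). One mean value bound for that bracket and one for the increment gain a full
  power of n over the Dirichlet term.\<close>

lemma norm_zterm_le:
  assumes n: "n > 0" and s: "Re s > 0"
  shows "norm (zterm n s) \<le> norm (s - 1) * norm s * real n powr (- Re s - 1)"
proof -
  define P where "P w = w powr (- s)" for w :: complex
  define S where "S = closed_segment (of_nat n :: complex) (of_nat n + 1)"
  have S_re: "Im w = 0 \<and> real n \<le> Re w \<and> Re w \<le> real n + 1" if "w \<in> S" for w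
  proof -
    from that obtain u where u: "0 \<le> u" "u \<le> 1" "w = (1 - u) *\<^sub>R (of_nat n :: complex) + u *\<^sub>R (of_nat n + 1)"
      unfolding S_def in_segment by (elim exE conjE)
    have "w = of_real (real n + u)" by (simp add: u(3) scaleR_conv_of_real algebra_simps)
    then show ?thesis using u by simp
  qed
  have S_pos: "w \<notin> \<real>\<^sub>\<le>\<^sub>0" "w \<noteq> 0" if "w \<in> S" for w
    using S_re[OF that] n by (auto simp: complex_nonpos_Reals_iff)
  have S_norm: "norm w = Re w" if "w \<in> S" for w
    using S_re[OF that] by (simp add: cmod_def)
  have nP: "norm (w powr z) = Re w powr (Re z)" if "w \<in> S" for w z
  proof -
    have "w \<in> \<real>" "Re w \<ge> 0" using S_re[OF that] by (auto simp: complex_is_Real_iff)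
    then show ?thesis by (simp add: norm_powr_real_powr)
  qed
  have cv: "convex S" unfolding S_def by simp
  have nS: "of_nat n \<in> S" "of_nat n + 1 \<in> S" by (auto simp: S_def)
  have npw: "npow n z = of_nat n powr (- z)" "npow (Suc n) z = (of_nat n + 1) powr (- z)" for z
  proof -
    have A: "npow m z = of_nat m powr (- z)" if "m > 0" for m
      using that unfolding npow_def powr_def by (simp add: Ln_of_nat)
    show "npow n z = of_nat n powr (- z)" "npow (Suc n) z = (of_nat n + 1) powr (- z)"
      using A[of n] A[of "Suc n"] n by (simp_all add: add.commute)
  qed
  have P1: "norm (P w - P (of_nat n)) \<le> norm s * real n powr (- Re s - 1)" if w: "w \<in> S" for w
  proof -
    have "norm (P w - P (of_nat n)) \<le> norm s * real n powr (- Re s - 1) * norm (w - of_nat n)"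
    proof (rule field_differentiable_bound[OF cv _ _ w nS(1)])
      fix z assume z: "z \<in> S"
      show "(P has_field_derivative (- s) * z powr (- s - 1)) (at z within S)"
        unfolding P_def by (rule has_field_derivative_at_within[OF has_field_derivative_powr[OF S_pos(1)[OF z]]])
      have "Re z powr (- Re s - 1) \<le> real n powr (- Re s - 1)"
        using S_re[OF z] n s by (intro powr_mono2') auto
      then show "norm ((- s) * z powr (- s - 1)) \<le> norm s * real n powr (- Re s - 1)"
        by (simp add: norm_mult nP[OF z] mult_left_mono)
    qed
    also have "\<dots> \<le> norm s * real n powr (- Re s - 1) * 1"
    proof (rule mult_left_mono)
      have "w - of_nat n = of_real (Re w - real n)" using S_re[OF w] by (simp add: complex_eq_iff)
      then have "norm (w - of_nat n) = \<bar>Re w - real n\<bar>" by (metis norm_of_real)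
      then show "norm (w - of_nat n) \<le> 1" using S_re[OF w] by simp
    qed simp
    finally show ?thesis by simp
  qed
  define Q where "Q w = (s - 1) * P (of_nat n) * w + w powr (1 - s)" for w
  have "norm (Q (of_nat n + 1) - Q (of_nat n)) \<le> norm (s - 1) * (norm s * real n powr (- Re s - 1)) * norm ((of_nat n + 1) - of_nat n :: complex)"
  proof (rule field_differentiable_bound[OF cv _ _ nS(2) nS(1)])
    fix z assume z: "z \<in> S"
    have "((\<lambda>w. w powr (1 - s)) has_field_derivative (1 - s) * z powr (1 - s - 1)) (at z within S)"
      by (rule has_field_derivative_at_within[OF has_field_derivative_powr[OF S_pos(1)[OF z]]])
    then have D: "((\<lambda>w. w powr (1 - s)) has_field_derivative (1 - s) * P z) (at z within S)"
      by (simp add: P_def)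
    show "(Q has_field_derivative (s - 1) * (P (of_nat n) - P z)) (at z within S)"
      unfolding Q_def by (rule derivative_eq_intros D refl)+ (simp add: algebra_simps)
    have "norm (P (of_nat n) - P z) \<le> norm s * real n powr (- Re s - 1)"
      using P1[OF z] by (simp add: norm_minus_commute)
    then show "norm ((s - 1) * (P (of_nat n) - P z)) \<le> norm (s - 1) * (norm s * real n powr (- Re s - 1))"
      by (simp add: norm_mult mult_left_mono)
  qed
  moreover have "Q (of_nat n + 1) - Q (of_nat n) = zterm n s"
    by (simp add: Q_def zterm_def npw P_def algebra_simps)
  ultimately show ?thesis by (simp add: mult.assoc)
qed

lemma summable_powr_neg: "a > 1 \<Longrightarrow> summable (\<lambda>n. real (Suc n) powr (- a))"
  using summable_real_powr_iff[of "- a"] summable_Suc_iff[of "\<lambda>n. real n powr (-a)"] by simp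

lemma zetaF_holomorphic: "zetaF holomorphic_on {s. Re s > 0}"
proof -
  have op: "open {s::complex. Re s > 0}" by (simp add: open_halfspace_Re_gt)
  have "\<exists>g g'. \<forall>x \<in> {s. Re s > 0}. ((\<lambda>n. zterm (Suc n) x) sums g x) \<and> ((\<lambda>n. deriv (zterm (Suc n)) x) sums g' x) \<and> (g has_field_derivative g' x) (at x)"
  proof (rule series_and_derivative_comparison_local[OF op])
    show "(zterm (Suc n) has_field_derivative deriv (zterm (Suc n)) x) (at x)" for n x
      by (rule holomorphic_derivI[OF zterm_holomorphic open_UNIV UNIV_I])
    fix x :: complex assume "x \<in> {s. Re s > 0}"
    then have x: "Re x > 0" by simp
    define d where "d = Re x / 2"
    define B where "B = norm x + d"
    have "norm (zterm (Suc n) y) \<le> (B + 1) * B * real (Suc n) powr (- (d + 1))" if "y \<in> ball x d" for n y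
    proof -
      have yx: "norm (x - y) < d" using that by (simp add: dist_norm)
      then have "\<bar>Re (x - y)\<bar> < d" using abs_Re_le_cmod[of "x-y"] by linarith
      then have r: "Re y \<ge> d" "Re y > 0" using x unfolding d_def minus_complex.sel by linarith+
      have b: "norm y \<le> B" using yx norm_triangle_ineq4[of x "x-y"] by (simp add: B_def)
      have b1: "norm (y - 1) \<le> B + 1" using b norm_triangle_ineq4[of y 1] by simp
      have B0: "B \<ge> 0" using b norm_ge_zero[of y] by linarith
      have "norm (zterm (Suc n) y) \<le> norm (y - 1) * norm y * real (Suc n) powr (- Re y - 1)"
        by (rule norm_zterm_le) (use r in auto)
      also have "\<dots> \<le> (B + 1) * B * real (Suc n) powr (- (d + 1))"
        using b b1 r B0 by (intro mult_mono powr_mono mult_nonneg_nonneg) auto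
      finally show ?thesis .
    qed
    moreover have "summable (\<lambda>n. (B + 1) * B * real (Suc n) powr (- (d + 1)))"
      using x by (intro summable_mult summable_powr_neg) (auto simp: d_def)
    ultimately show "\<exists>d h. 0 < d \<and> summable h \<and> (\<forall>\<^sub>F n in sequentially. \<forall>y\<in>ball x d \<inter> {s. Re s > 0}. norm (zterm (Suc n) y) \<le> h n)"
      using x by (intro exI[of _ d] exI[of _ "\<lambda>n. (B + 1) * B * real (Suc n) powr (- (d + 1))"]) (auto simp: d_def)
  qed
  then obtain g g' where g: "\<And>x. Re x > 0 \<Longrightarrow> (\<lambda>n. zterm (Suc n) x) sums g x"
      "\<And>x. Re x > 0 \<Longrightarrow> (g has_field_derivative g' x) (at x)" by auto
  have "g holomorphic_on {s. Re s > 0}"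
    using g(2) by (auto simp: holomorphic_on_open[OF op])
  then have "(\<lambda>s. 1 + g s) holomorphic_on {s. Re s > 0}" by (intro holomorphic_intros)
  then show ?thesis
    by (rule holomorphic_transform) (use g(1) in \<open>auto simp: zetaF_def sums_iff\<close>)
qed

lemma zetaF_1 [simp]: "zetaF 1 = 1"
proof -
  have "zterm n 1 = 0" for n by (simp add: zterm_def npow_def)
  then show ?thesis by (simp add: zetaF_def)
qed

text \<open>Polynomial growth is enough, because only the logarithm of this bound enters the
  zero-free region.\<close>

lemma norm_zetaF_le:
  "\<exists>C\<ge>1. \<forall>s. Re s \<ge> 1/2 \<longrightarrow> norm (zetaF s) \<le> C * (norm s + 1) ^ 2"
proof -
  define Z where "Z = (\<Sum>n. real (Suc n) powr (- (1/2 + 1)))"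
  have sm: "summable (\<lambda>n. real (Suc n) powr (- (1/2 + 1)))" by (rule summable_powr_neg) simp
  have Z0: "Z \<ge> 0" unfolding Z_def by (rule suminf_nonneg[OF sm]) simp
  have "norm (zetaF s) \<le> (Z + 1) * (norm s + 1) ^ 2" if s: "Re s \<ge> 1/2" for s
  proof -
    have b: "norm (zterm (Suc n) s) \<le> (norm s + 1) ^ 2 * real (Suc n) powr (- (1/2 + 1))" for n
    proof -
      have "norm (zterm (Suc n) s) \<le> norm (s - 1) * norm s * real (Suc n) powr (- Re s - 1)"
        by (rule norm_zterm_le) (use s in auto)
      also have "\<dots> \<le> (norm s + 1) * (norm s + 1) * real (Suc n) powr (- (1/2 + 1))"
        using norm_triangle_ineq4[of s 1] s by (intro mult_mono powr_mono) auto
      finally show ?thesis by (simp add: power2_eq_square)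
    qed
    have sn: "summable (\<lambda>n. norm (zterm (Suc n) s))"
      by (rule summable_comparison_test'[OF summable_mult[OF sm, of "(norm s + 1)^2"]]) (use b in auto)
    have "norm (zetaF s) \<le> 1 + norm (\<Sum>n. zterm (Suc n) s)"
      unfolding zetaF_def using norm_triangle_ineq[of 1 "\<Sum>n. zterm (Suc n) s"] by (simp only: norm_one)
    also have "norm (\<Sum>n. zterm (Suc n) s) \<le> (\<Sum>n. norm (zterm (Suc n) s))"
      by (rule summable_norm[OF sn])
    also have "\<dots> \<le> (\<Sum>n. (norm s + 1) ^ 2 * real (Suc n) powr (- (1/2 + 1)))"
      by (rule suminf_le[OF b sn summable_mult[OF sm]])
    also have "\<dots> = (norm s + 1) ^ 2 * Z" unfolding Z_def by (rule suminf_mult[OF sm])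
    finally have "norm (zetaF s) \<le> 1 + (norm s + 1) ^ 2 * Z" by simp
    moreover have "1 \<le> (norm s + 1) ^ 2" by (rule one_le_power) simp
    ultimately show ?thesis unfolding distrib_right by (simp only: mult.commute[of Z])
  qed
  then show ?thesis using Z0 by (intro exI[of _ "Z + 1"]) auto
qed

definition zetaS :: "complex \<Rightarrow> complex" where
  "zetaS s = (\<Sum>n. npow (Suc n) s)"

lemma npow_summable:
  assumes "Re s > 1"
  shows "summable (\<lambda>n. norm (npow (Suc n) s))"
  using summable_powr_neg[OF assms] by (simp add: norm_npow del: of_nat_Suc)

text \<open>For Re s > 1 the telescoping differences add up to -1, which cancels the leading 1 of
  \<open>zetaF\<close>.\<close>

lemma zetaF_eq:
  assumes s: "Re s > 1"
  shows "zetaF s = (s - 1) * zetaS s"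
proof -
  have lim: "(\<lambda>n. npow (Suc n) (s - 1)) \<longlonglongrightarrow> 0"
  proof (rule tendsto_norm_zero_cancel)
    have "(\<lambda>n. real (Suc n) powr (- Re (s - 1))) \<longlonglongrightarrow> 0"
      by (rule tendsto_neg_powr) (use s in \<open>auto intro: filterlim_compose[OF filterlim_real_sequentially filterlim_Suc] simp del: of_nat_Suc\<close>)
    then show "(\<lambda>n. norm (npow (Suc n) (s - 1))) \<longlonglongrightarrow> 0"
      by (simp add: norm_npow del: of_nat_Suc)
  qed
  have 1: "(\<lambda>n. npow (Suc (Suc n)) (s - 1) - npow (Suc n) (s - 1)) sums (0 - npow (Suc 0) (s - 1))"
    by (rule telescope_sums[OF lim])
  have 2: "(\<lambda>n. (s - 1) * npow (Suc n) s) sums ((s - 1) * zetaS s)"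
    unfolding zetaS_def by (intro sums_mult summable_sums summable_norm_cancel[OF npow_summable[OF s]])
  have "(\<lambda>n. zterm (Suc n) s) sums ((s - 1) * zetaS s + (0 - 1))"
    using sums_add[OF 2 1] unfolding zterm_def by (simp add: add_diff_eq)
  then show ?thesis by (simp add: zetaF_def sums_iff)
qed

section \<open>Dirichlet series for \<open>Re s > 1\<close>\<close>

lemma moebius_mult_prime:
  assumes p: "prime p" and nd: "\<not> p dvd d"
  shows "moebius (p * d) = - moebius d"
proof -
  have d0: "d \<noteq> 0" using nd by (metis dvd_0_right)
  have c: "coprime p d" using p nd by (simp add: prime_imp_coprime)
  have "squarefree (p * d) \<longleftrightarrow> squarefree d"
    using squarefree_mult_coprime[OF c squarefree_prime[OF p]] squarefree_multD(2)[of p d] by blast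
  moreover have "prime_factors (p * d) = insert p (prime_factors d)"
    using p d0 by (simp add: prime_factorization_mult prime_factorization_prime)
  moreover have "p \<notin> prime_factors d" using nd by auto
  ultimately show ?thesis by (simp add: moebius_def)
qed

lemma moebius_mult_prime_dvd:
  assumes "prime p" "p dvd d"
  shows "moebius (p * d) = 0"
proof -
  have "p ^ 2 dvd p * d" using assms by (auto simp: power2_eq_square)
  then have "\<not> squarefree (p * d)" using assms(1) squarefreeD not_prime_unit by blast
  then show ?thesis by (simp add: moebius_def)
qed

lemma moebius_1 [simp]: "moebius 1 = 1" "moebius (Suc 0) = 1"
  by (simp_all add: moebius_def)

lemma moebius_0 [simp]: "moebius 0 = 0"
  by (simp add: moebius_def)

lemma abs_moebius_le: "\<bar>moebius n\<bar> \<le> 1"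
  by (simp add: moebius_def power_abs)

lemma moebius_squarefreeD: "moebius n \<noteq> 0 \<Longrightarrow> squarefree n"
  by (auto simp: moebius_def split: if_splits)

text \<open>A prime p dividing n pairs each squarefree divisor d not divisible by p with p d, and
  the two signs in a pair are opposite.\<close>

lemma sum_moebius_divisors:
  assumes n: "n > 0"
  shows "(\<Sum>d | d dvd n. moebius d) = (if n = 1 then 1 else 0)"
proof (cases "n = 1")
  case False
  then obtain p where p: "prime p" "p dvd n" using prime_factor_nat by blast
  define A where "A = {d. d dvd n \<and> squarefree d \<and> \<not> p dvd d}"
  have fin: "finite {d. d dvd n}" using n by simp
  have pd: "p * d dvd n \<and> squarefree (p * d)" if "d \<in> A" for d
  proof -
    have "coprime p d" using p that by (auto simp: A_def prime_imp_coprime)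
    moreover have "d dvd n" "squarefree d" using that by (simp_all add: A_def)
    ultimately show ?thesis using p squarefree_mult_coprime[of p d] squarefree_prime[OF p(1)]
      by (simp add: divides_mult)
  qed
  have eq: "{d. d dvd n \<and> squarefree d} = A \<union> (*) p ` A"
  proof (intro equalityI subsetI)
    fix d assume d: "d \<in> {d. d dvd n \<and> squarefree d}"
    show "d \<in> A \<union> (*) p ` A"
    proof (cases "p dvd d")
      case True
      then obtain e where e: "d = p * e" by blast
      have "\<not> p dvd e"
      proof
        assume "p dvd e" then have "p ^ 2 dvd d" by (auto simp: e power2_eq_square)
        then show False using d p(1) squarefreeD not_prime_unit by blast
      qed
      then have "e \<in> A" using d squarefree_multD(2)[of p e] dvd_trans[of e d n] by (simp add: A_def e)
      then show ?thesis using e by auto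
    qed (use d in \<open>auto simp: A_def\<close>)
  qed (use pd in \<open>auto simp: A_def\<close>)
  have "(\<Sum>d | d dvd n. moebius d) = (\<Sum>d | d dvd n \<and> squarefree d. moebius d)"
    using fin by (intro sum.mono_neutral_right) (auto simp: moebius_def)
  also have "\<dots> = sum moebius A + sum moebius ((*) p ` A)"
    unfolding eq using finite_subset[OF _ fin, of A] by (intro sum.union_disjoint) (auto simp: A_def)
  also have "sum moebius ((*) p ` A) = (\<Sum>d\<in>A. moebius (p * d))"
    using p by (subst sum.reindex) (auto simp: inj_on_def)
  also have "\<dots> = (\<Sum>d\<in>A. - moebius d)"
    using moebius_mult_prime[OF p(1)] by (intro sum.cong) (auto simp: A_def)
  finally show ?thesis using False by (simp add: sum_negf)
qed simp

lemma dvd_div_ge_1: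
  fixes n d :: nat
  assumes "n \<ge> 1" "d dvd n"
  shows "n div d \<ge> 1" "d \<ge> 1" "d * (n div d) = n"
  using assms by (auto elim!: dvdE simp: Suc_le_eq)

text \<open>Absolute convergence makes the family over all pairs (d, e) summable, so it may be
  regrouped by the product n = d e.\<close>

lemma dirichlet_product_has_sum:
  fixes f g :: "nat \<Rightarrow> complex"
  assumes f: "(f has_sum F) {1..}" "(\<lambda>n. norm (f n)) summable_on {1..}"
    and g: "(g has_sum G) {1..}" "(\<lambda>n. norm (g n)) summable_on {1..}"
  shows "((\<lambda>n. \<Sum>d | d dvd n. f d * g (n div d)) has_sum F * G) {1..}"
proof -
  have "(\<lambda>x. norm (f (fst x) * g (snd x))) summable_on Sigma {1..} (\<lambda>_. {1..})"
  proof (rule summable_on_SigmaI)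
    show "((\<lambda>y. norm (f (fst (x, y)) * g (snd (x, y)))) has_sum (norm (f x) * infsum (\<lambda>y. norm (g y)) {1..})) {1..}" for x
      using g(2) by (simp add: norm_mult has_sum_cmult_right)
    show "(\<lambda>x. norm (f x) * infsum (\<lambda>y. norm (g y)) {1..}) summable_on {1..}"
      using f(2) by (rule summable_on_cmult_left)
  qed auto
  then have s: "(\<lambda>x. f (fst x) * g (snd x)) summable_on Sigma {1..} (\<lambda>_. {1..})"
    by (rule abs_summable_summable)
  have "((\<lambda>x. f (fst x) * g (snd x)) has_sum F * G) (Sigma {1..} (\<lambda>_. {1..}))"
  proof (rule has_sum_SigmaI[OF _ _ s])
    show "((\<lambda>y. f (fst (x, y)) * g (snd (x, y))) has_sum f x * G) {1..}" for x
      using g(1) by (simp add: has_sum_cmult_right)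
    show "((\<lambda>x. f x * G) has_sum F * G) {1..}"
      by (rule has_sum_cmult_left[OF f(1)])
  qed
  also have "?this \<longleftrightarrow> ((\<lambda>x. f (snd x) * g (fst x div snd x)) has_sum F * G) (Sigma {1..} (\<lambda>n. {d. d dvd n}))"
  proof (rule has_sum_reindex_bij_witness[where i="\<lambda>(n,d). (d, n div d)" and j="\<lambda>(d,e). (d * e, d)"], goal_cases)
    case (1 a) then show ?case by (cases a) auto
  next
    case (2 a) then show ?case by (cases a) (auto simp: Suc_le_eq)
  next
    case (3 b)
    obtain n d where "b = (n, d)" by (cases b)
    with 3 dvd_div_ge_1[of n d] show ?case by simp
  next
    case (4 b)
    obtain n d where "b = (n, d)" by (cases b)
    with 4 dvd_div_ge_1[of n d] show ?case by simp
  next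
    case (5 a) then show ?case by (cases a) auto
  qed simp
  finally have h: "((\<lambda>x. f (snd x) * g (fst x div snd x)) has_sum F * G) (Sigma {1..} (\<lambda>n. {d. d dvd n}))" .
  show ?thesis
  proof (rule has_sum_SigmaD[OF h])
    fix n :: nat assume "n \<in> {1..}"
    then have "finite {d. d dvd n}" by simp
    from has_sum_finite[OF this, of "\<lambda>d. f d * g (n div d)"]
    show "((\<lambda>y. f (snd (n, y)) * g (fst (n, y) div snd (n, y))) has_sum (\<Sum>d | d dvd n. f d * g (n div d))) {d. d dvd n}"
      by simp
  qed
qed

lemma has_sum_from_1:
  fixes f :: "nat \<Rightarrow> complex"
  assumes "summable (\<lambda>n. norm (f (Suc n)))"
  shows "(f has_sum (\<Sum>n. f (Suc n))) {1..}" "(\<lambda>n. norm (f n)) summable_on {1..}"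
proof -
  have bij: "bij_betw Suc UNIV {1..}"
    by (rule bij_betwI[of _ _ _ "\<lambda>n. n - 1"]) auto
  have "((\<lambda>n. f (Suc n)) has_sum (\<Sum>n. f (Suc n))) UNIV"
    by (rule norm_summable_imp_has_sum[OF assms summable_sums[OF summable_norm_cancel[OF assms]]])
  then show "(f has_sum (\<Sum>n. f (Suc n))) {1..}"
    using has_sum_reindex_bij_betw[OF bij, of f] by simp
  have "(\<lambda>n. norm (f (Suc n))) summable_on UNIV"
    using norm_summable_imp_summable_on[of "\<lambda>n. norm (f (Suc n))"] assms by simp
  then show "(\<lambda>n. norm (f n)) summable_on {1..}"
    using summable_on_reindex_bij_betw[OF bij, of "\<lambda>n. norm (f n)"] by simp
qed

lemma moebius_npow_summable:
  assumes s: "Re s > 1"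
  shows "summable (\<lambda>n. norm (of_real (moebius (Suc n)) * npow (Suc n) s))"
  by (rule summable_comparison_test'[OF npow_summable[OF s]])
     (auto simp: norm_mult intro!: mult_left_le_one_le abs_moebius_le)

lemma moebius_npow_sum:
  assumes s: "Re s > 1"
  shows "(\<Sum>n. of_real (moebius (Suc n)) * npow (Suc n) s) * zetaS s = 1"
proof -
  have "((\<lambda>n. \<Sum>d | d dvd n. of_real (moebius d) * npow d s * npow (n div d) s) has_sum
     (\<Sum>n. of_real (moebius (Suc n)) * npow (Suc n) s) * zetaS s) {1..}"
    unfolding zetaS_def
    by (rule dirichlet_product_has_sum has_sum_from_1 moebius_npow_summable npow_summable s)+
  also have "?this \<longleftrightarrow> ((\<lambda>n::nat. if n = 1 then 1 else 0) has_sum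
     (\<Sum>n. of_real (moebius (Suc n)) * npow (Suc n) s) * zetaS s) {1..}"
  proof (rule has_sum_cong)
    fix n :: nat assume n: "n \<in> {1..}"
    have "(\<Sum>d | d dvd n. of_real (moebius d) * npow d s * npow (n div d) s) = (\<Sum>d | d dvd n. of_real (moebius d) * npow n s)"
    proof (rule sum.cong)
      fix d assume d: "d \<in> {d. d dvd n}"
      then have "npow d s * npow (n div d) s = npow n s"
        using npow_mult[of d "n div d" s] dvd_div_ge_1[of n d] n by simp
      then show "of_real (moebius d) * npow d s * npow (n div d) s = of_real (moebius d) * npow n s" by simp
    qed simp
    also have "\<dots> = of_real (\<Sum>d | d dvd n. moebius d) * npow n s" by (simp add: sum_distrib_right)
    also have "\<dots> = (if n = 1 then 1 else 0)" using sum_moebius_divisors[of n] n by simp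
    finally show "(\<Sum>d | d dvd n. of_real (moebius d) * npow d s * npow (n div d) s) = (if n = 1 then 1 else 0)" .
  qed
  finally have "((\<lambda>n::nat. if n = 1 then 1 else 0) has_sum
     (\<Sum>n. of_real (moebius (Suc n)) * npow (Suc n) s) * zetaS s) {1..}" .
  moreover have "((\<lambda>n::nat. if n = 1 then 1 else 0 :: complex) has_sum 1) {1..}"
    by (rule has_sum_finite_neutralI[of "{1}"]) auto
  ultimately show ?thesis by (rule has_sum_unique)
qed

lemma powr_neg_telescope:
  fixes a u :: real
  assumes "a > 0" "u > 0"
  shows "a * (u + 1) powr (-1 - a) \<le> u powr (- a) - (u + 1) powr (- a)"
proof -
  have "\<exists>z>u. z < u + 1 \<and> (u + 1) powr (- a) - u powr (- a) = (u + 1 - u) * (- a * z powr (- a - 1))"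
  proof (rule MVT2[of u "u + 1" "\<lambda>x. x powr (- a)" "\<lambda>x. - a * x powr (- a - 1)"])
    fix x assume "u \<le> x" "x \<le> u + 1"
    then have "x > 0" using assms by simp
    then show "((\<lambda>x. x powr (- a)) has_real_derivative - a * x powr (- a - 1)) (at x)"
      by (rule has_real_derivative_powr)
  qed simp
  then obtain z where z: "z > u" "z < u + 1" "(u + 1) powr (- a) - u powr (- a) = - a * z powr (- a - 1)" by auto
  have "(u + 1) powr (-1 - a) \<le> z powr (-1 - a)" using z assms by (intro powr_mono2') auto
  then have "a * (u + 1) powr (-1 - a) \<le> a * z powr (-1 - a)" using assms by simp
  moreover have "- a - 1 = -1 - a" by simp
  then have "(u + 1) powr (- a) - u powr (- a) = - a * z powr (-1 - a)" using z(3) by metis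
  ultimately show ?thesis by linarith
qed

text \<open>Comparison with the integral of t^(-1-a) from N on, in telescoped form; the first term
  of the series is kept apart.\<close>

lemma powr_tail_le:
  fixes a :: real
  assumes a: "a > 0" and N: "N > 0"
  shows "summable (\<lambda>n. real (n + N) powr (-1 - a))"
    and "(\<Sum>n. real (n + N) powr (-1 - a)) \<le> real N powr (-1 - a) + real N powr (- a) / a"
proof -
  have s: "summable (\<lambda>n. real n powr (-1 - a))"
    using summable_real_powr_iff[of "-1-a"] a by simp
  then show s1: "summable (\<lambda>n. real (n + N) powr (-1 - a))" by (rule summable_ignore_initial_segment)
  have p: "(\<Sum>i<Suc n. real (i + N) powr (-1 - a)) \<le> real N powr (-1 - a) + (real N powr (- a) - real (n + N) powr (- a)) / a" for n
  proof (induction n)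
    case (Suc n)
    have "a * (real (n + N) + 1) powr (-1 - a) \<le> real (n + N) powr (- a) - (real (n + N) + 1) powr (- a)"
      by (rule powr_neg_telescope) (use a N in auto)
    then have "(real (n + N) + 1) powr (-1 - a) \<le> (real (n + N) powr (- a) - (real (n + N) + 1) powr (- a)) / a"
      using a by (simp add: field_simps)
    moreover have "real (n + N) + 1 = real (Suc n + N)" by simp
    ultimately have "real (Suc n + N) powr (-1 - a) \<le> (real (n + N) powr (- a) - real (Suc n + N) powr (- a)) / a"
      by metis
    then show ?case using Suc by (subst sum.lessThan_Suc) (simp add: diff_divide_distrib)
  qed simp
  show "(\<Sum>n. real (n + N) powr (-1 - a)) \<le> real N powr (-1 - a) + real N powr (- a) / a"
  proof (rule suminf_le_const[OF s1])
    fix n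
    have "(\<Sum>i<n. real (i + N) powr (-1 - a)) \<le> (\<Sum>i<Suc n. real (i + N) powr (-1 - a))" by simp
    also note p[of n]
    also have "real N powr (-1 - a) + (real N powr (- a) - real (n + N) powr (- a)) / a \<le> real N powr (-1 - a) + real N powr (- a) / a"
      using a by (simp add: divide_right_mono)
    finally show "(\<Sum>i<n. real (i + N) powr (-1 - a)) \<le> real N powr (-1 - a) + real N powr (- a) / a" .
  qed
qed

text \<open>The inverse is the Moebius series, of modulus at most 1 + 1/(Re s - 1). The bound is
  uniform in Im s, as the base points 1 + eta + it require.\<close>

lemma zetaS_lower:
  assumes s: "Re s > 1"
  shows "norm (zetaS s) \<ge> (Re s - 1) / Re s" "zetaS s \<noteq> 0"
proof -
  define M where "M = (\<Sum>n. of_real (moebius (Suc n)) * npow (Suc n) s)"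
  define a where "a = Re s - 1"
  have a: "a > 0" using s by (simp add: a_def)
  have "norm M \<le> (\<Sum>n. norm (of_real (moebius (Suc n)) * npow (Suc n) s))"
    unfolding M_def by (rule summable_norm[OF moebius_npow_summable[OF s]])
  also have "\<dots> \<le> (\<Sum>n. real (n + 1) powr (-1 - a))"
  proof (rule suminf_le[OF _ moebius_npow_summable[OF s]])
    fix n
    have "norm (of_real (moebius (Suc n)) * npow (Suc n) s) \<le> 1 * norm (npow (Suc n) s)"
      unfolding norm_mult by (intro mult_right_mono) (auto intro: abs_moebius_le)
    then show "norm (of_real (moebius (Suc n)) * npow (Suc n) s) \<le> real (n + 1) powr (-1 - a)"
      by (simp add: norm_npow a_def del: of_nat_Suc)
  qed (rule powr_tail_le[OF a], simp)
  also have "\<dots> \<le> 1 + 1 / a" using powr_tail_le(2)[OF a, of 1] by simp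
  finally have M: "norm M \<le> Re s / (Re s - 1)" using a by (simp add: a_def field_simps)
  have e: "norm M * norm (zetaS s) = 1" using moebius_npow_sum[OF s] by (metis M_def norm_mult norm_one)
  have "1 \<le> Re s / (Re s - 1) * norm (zetaS s)"
    using mult_right_mono[OF M norm_ge_zero[of "zetaS s"]] e by simp
  then show "norm (zetaS s) \<ge> (Re s - 1) / Re s" using s by (simp add: field_simps)
  show "zetaS s \<noteq> 0" using e by auto
qed

lemma ln_npow_summable:
  assumes s: "Re s > 1"
  shows "summable (\<lambda>n. norm (of_real (ln (real (Suc n))) * npow (Suc n) s))"
proof -
  define a where "a = (Re s - 1) / 2"
  have a: "a > 0" using s by (simp add: a_def)
  have "summable (\<lambda>n. real (Suc n) powr (- (1 + a)) / a)"
    by (intro summable_divide summable_powr_neg) (use a in auto)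
  then show ?thesis
  proof (rule summable_comparison_test')
    fix n
    have "ln (real (Suc n)) \<le> real (Suc n) powr a / a" using a by (intro ln_powr_bound) auto
    then have "ln (real (Suc n)) * real (Suc n) powr (- Re s) \<le> real (Suc n) powr a / a * real (Suc n) powr (- Re s)"
      by (intro mult_right_mono) auto
    also have "\<dots> = real (Suc n) powr (a + (- Re s)) / a"
      unfolding powr_add by simp
    also have "a + (- Re s) = - (1 + a)" by (simp add: a_def field_simps)
    finally show "norm (norm (of_real (ln (real (Suc n))) * npow (Suc n) s)) \<le> real (Suc n) powr (- (1 + a)) / a"
      by (simp add: norm_mult norm_npow del: of_nat_Suc)
  qed
qed

lemma zetaS_has_field_derivative:
  assumes s: "Re s > 1"
  shows "(zetaS has_field_derivative - (\<Sum>n. of_real (ln (real (Suc n))) * npow (Suc n) s)) (at s)"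
proof -
  have op: "open {s::complex. Re s > 1}" by (simp add: open_halfspace_Re_gt)
  have "\<exists>g g'. \<forall>x \<in> {s. Re s > 1}. ((\<lambda>n. npow (Suc n) x) sums g x) \<and> ((\<lambda>n. - of_real (ln (real (Suc n))) * npow (Suc n) x) sums g' x) \<and> (g has_field_derivative g' x) (at x)"
  proof (rule series_and_derivative_comparison_local[OF op npow_has_field_derivative])
    fix x :: complex assume "x \<in> {s. Re s > 1}"
    then have x: "Re x > 1" by simp
    define d where "d = (Re x - 1) / 2"
    have "norm (npow (Suc n) y) \<le> real (Suc n) powr (- (1 + d))" if "y \<in> ball x d" for n y
    proof -
      have "norm (x - y) < d" using that by (simp add: dist_norm)
      then have "\<bar>Re (x - y)\<bar> < d" using abs_Re_le_cmod[of "x-y"] by linarith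
      then have r: "Re y \<ge> 1 + d" unfolding d_def minus_complex.sel by (simp add: abs_if field_simps split: if_splits)
      then show ?thesis by (simp add: norm_npow powr_mono del: of_nat_Suc)
    qed
    moreover have "summable (\<lambda>n. real (Suc n) powr (- (1 + d)))"
      using x by (intro summable_powr_neg) (auto simp: d_def)
    ultimately show "\<exists>d h. 0 < d \<and> summable h \<and> (\<forall>\<^sub>F n in sequentially. \<forall>y\<in>ball x d \<inter> {s. Re s > 1}. norm (npow (Suc n) y) \<le> h n)"
      using x by (intro exI[of _ d] exI[of _ "\<lambda>n. real (Suc n) powr (- (1 + d))"]) (auto simp: d_def)
  qed
  then obtain g g' where g: "\<And>x. Re x > 1 \<Longrightarrow> (\<lambda>n. npow (Suc n) x) sums g x"
      "\<And>x. Re x > 1 \<Longrightarrow> (\<lambda>n. - of_real (ln (real (Suc n))) * npow (Suc n) x) sums g' x"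
      "\<And>x. Re x > 1 \<Longrightarrow> (g has_field_derivative g' x) (at x)" by (auto simp del: of_nat_Suc)
  have "(zetaS has_field_derivative g' s) (at s)"
    by (rule has_field_derivative_transform_within_open[OF g(3)[OF s] op])
       (use s g(1) in \<open>auto simp: zetaS_def sums_iff\<close>)
  moreover have "g' s = - (\<Sum>n. of_real (ln (real (Suc n))) * npow (Suc n) s)"
  proof -
    have "(\<lambda>n. - (of_real (ln (real (Suc n))) * npow (Suc n) s)) sums (- (\<Sum>n. of_real (ln (real (Suc n))) * npow (Suc n) s))"
      by (intro sums_minus summable_sums summable_norm_cancel[OF ln_npow_summable[OF s]])
    then show ?thesis using g(2)[OF s] by (simp add: sums_iff del: of_nat_Suc)
  qed
  ultimately show ?thesis by simp
qed

lemma mangoldt_le_ln: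
  assumes "n > 0"
  shows "mangoldt n \<le> ln (real n)"
proof -
  have "mangoldt n \<le> (\<Sum>d | d dvd n. mangoldt d :: real)"
    by (rule member_le_sum) (use assms in \<open>auto simp: mangoldt_nonneg\<close>)
  then show ?thesis using mangoldt_sum[of n, where 'a=real] assms by simp
qed

text \<open>The von Mangoldt function convolved with the constant 1 is log, so this series times
  zeta equals -zeta'.\<close>

lemma zeta_log_deriv_has_sum:
  assumes s: "Re s > 1"
  shows "((\<lambda>n. mangoldt n * npow n s) has_sum (- (deriv zetaS s / zetaS s))) {1..}"
proof -
  have sm: "summable (\<lambda>n. norm (mangoldt (Suc n) * npow (Suc n) s))"
  proof (rule summable_comparison_test'[OF ln_npow_summable[OF s]])
    fix n
    have "mangoldt (Suc n) \<le> \<bar>ln (real (Suc n))\<bar>" using mangoldt_le_ln[of "Suc n"] by linarith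
    then have "mangoldt (Suc n) * norm (npow (Suc n) s) \<le> \<bar>ln (real (Suc n))\<bar> * norm (npow (Suc n) s)"
      by (rule mult_right_mono) simp
    then show "norm (norm (mangoldt (Suc n) * npow (Suc n) s)) \<le> norm (of_real (ln (real (Suc n))) * npow (Suc n) s)"
      by (simp add: norm_mult mangoldt_nonneg del: of_nat_Suc)
  qed
  define L where "L = (\<Sum>n. mangoldt (Suc n) * npow (Suc n) s)"
  have "((\<lambda>n. \<Sum>d | d dvd n. mangoldt d * npow d s * npow (n div d) s) has_sum L * zetaS s) {1..}"
    unfolding zetaS_def L_def
    by (rule dirichlet_product_has_sum has_sum_from_1 sm npow_summable s)+
  also have "?this \<longleftrightarrow> ((\<lambda>n. of_real (ln (real n)) * npow n s) has_sum L * zetaS s) {1..}"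
  proof (rule has_sum_cong)
    fix n :: nat assume n: "n \<in> {1..}"
    have "(\<Sum>d | d dvd n. mangoldt d * npow d s * npow (n div d) s) = (\<Sum>d | d dvd n. mangoldt d * npow n s)"
    proof (rule sum.cong)
      fix d assume d: "d \<in> {d. d dvd n}"
      then have "npow d s * npow (n div d) s = npow n s"
        using npow_mult[of d "n div d" s] dvd_div_ge_1[of n d] n by simp
      then show "mangoldt d * npow d s * npow (n div d) s = mangoldt d * npow n s" by simp
    qed simp
    also have "\<dots> = (\<Sum>d | d dvd n. mangoldt d) * npow n s" by (simp add: sum_distrib_right)
    finally show "(\<Sum>d | d dvd n. mangoldt d * npow d s * npow (n div d) s) = of_real (ln (real n)) * npow n s"
      using mangoldt_sum[of n, where 'a=complex] n by simp
  qed
  finally have "((\<lambda>n. of_real (ln (real n)) * npow n s) has_sum L * zetaS s) {1..}" .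
  moreover have "((\<lambda>n. of_real (ln (real n)) * npow n s) has_sum (\<Sum>n. of_real (ln (real (Suc n))) * npow (Suc n) s)) {1..}"
    by (rule has_sum_from_1[OF ln_npow_summable[OF s]])
  ultimately have "L * zetaS s = (\<Sum>n. of_real (ln (real (Suc n))) * npow (Suc n) s)" by (rule has_sum_unique)
  then have "L * zetaS s = - deriv zetaS s" using DERIV_imp_deriv[OF zetaS_has_field_derivative[OF s]] by simp
  then have "L = - (deriv zetaS s / zetaS s)" using zetaS_lower(2)[OF s] by (simp add: field_simps)
  then show ?thesis using has_sum_from_1(1)[OF sm] by (simp add: L_def)
qed

lemma zeta_three_four_one:
  assumes a: "a > 1"
  shows "3 * Re (deriv zetaS (of_real a) / zetaS (of_real a))
      + 4 * Re (deriv zetaS (Complex a t) / zetaS (Complex a t))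
      + Re (deriv zetaS (Complex a (2 * t)) / zetaS (Complex a (2 * t))) \<le> 0"
proof -
  have h: "((\<lambda>n. mangoldt n * (real n powr (- a) * cos (y * ln (real n)))) has_sum
        (- Re (deriv zetaS (Complex a y) / zetaS (Complex a y)))) {1..}" for y
  proof -
    have "((\<lambda>n. Re (mangoldt n * npow n (Complex a y))) has_sum (Re (- (deriv zetaS (Complex a y) / zetaS (Complex a y))))) {1..}"
      by (rule has_sum_Re[OF zeta_log_deriv_has_sum]) (use a in simp)
    also have "?this \<longleftrightarrow> ((\<lambda>n. mangoldt n * (real n powr (- a) * cos (y * ln (real n)))) has_sum
        (Re (- (deriv zetaS (Complex a y) / zetaS (Complex a y))))) {1..}"
    proof (rule has_sum_cong)
      fix n :: nat assume "n \<in> {1..}"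
      then have "Re (npow n (Complex a y)) = real n powr (- a) * cos (y * ln (real n))"
        by (simp add: npow_def Re_exp powr_def)
      then show "Re (mangoldt n * npow n (Complex a y)) = mangoldt n * (real n powr (- a) * cos (y * ln (real n)))"
        by simp
    qed
    finally show ?thesis by simp
  qed
  have "((\<lambda>n. 3 * (mangoldt n * (real n powr (- a) * cos (0 * ln (real n)))) + 4 * (mangoldt n * (real n powr (- a) * cos (t * ln (real n))))
     + mangoldt n * (real n powr (- a) * cos (2 * t * ln (real n)))) has_sum 
     (3 * (- Re (deriv zetaS (Complex a 0) / zetaS (Complex a 0))) + 4 * (- Re (deriv zetaS (Complex a t) / zetaS (Complex a t)))
      + (- Re (deriv zetaS (Complex a (2*t)) / zetaS (Complex a (2*t)))))) {1..}"
    by (intro has_sum_add has_sum_cmult_right h)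
  then have "0 \<le> 3 * (- Re (deriv zetaS (Complex a 0) / zetaS (Complex a 0))) + 4 * (- Re (deriv zetaS (Complex a t) / zetaS (Complex a t)))
      + (- Re (deriv zetaS (Complex a (2*t)) / zetaS (Complex a (2*t))))"
  proof (rule has_sum_nonneg)
    fix n :: nat
    have "3 * (mangoldt n * (real n powr (- a) * cos (0 * ln (real n)))) + 4 * (mangoldt n * (real n powr (- a) * cos (t * ln (real n))))
     + mangoldt n * (real n powr (- a) * cos (2 * t * ln (real n)))
      = mangoldt n * real n powr (- a) * (2 * (1 + cos (t * ln (real n))) ^ 2)"
    proof -
      have c: "cos (2 * t * ln (real n)) = 2 * (cos (t * ln (real n)))^2 - 1"
        using cos_double_cos[of "t * ln (real n)"] by (simp add: mult.assoc)
      show ?thesis unfolding c by (simp add: power2_eq_square algebra_simps)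
    qed
    then show "0 \<le> 3 * (mangoldt n * (real n powr (- a) * cos (0 * ln (real n)))) + 4 * (mangoldt n * (real n powr (- a) * cos (t * ln (real n))))
     + mangoldt n * (real n powr (- a) * cos (2 * t * ln (real n)))"
      by (simp add: mangoldt_nonneg)
  qed
  then show ?thesis by (simp add: complex_of_real_def)
qed

section \<open>The classical zero-free region\<close>

lemma zetaF_log_deriv:
  assumes s: "Re s > 1"
  shows "deriv zetaF s / zetaF s = 1 / (s - 1) + deriv zetaS s / zetaS s"
proof -
  have op: "open {s::complex. Re s > 1}" by (simp add: open_halfspace_Re_gt)
  have dz: "(zetaS has_field_derivative deriv zetaS s) (at s)"
    using zetaS_has_field_derivative[OF s] DERIV_imp_deriv[OF zetaS_has_field_derivative[OF s]] by simp
  have "((\<lambda>s. (s - 1) * zetaS s) has_field_derivative (1 * zetaS s + deriv zetaS s * (s - 1))) (at s)"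
    by (rule DERIV_mult[OF _ dz]) (auto intro!: derivative_eq_intros)
  then have "(zetaF has_field_derivative (1 * zetaS s + deriv zetaS s * (s - 1))) (at s)"
    by (rule has_field_derivative_transform_within_open[OF _ op]) (use s zetaF_eq in auto)
  then have d: "deriv zetaF s = zetaS s + deriv zetaS s * (s - 1)" using DERIV_imp_deriv by fastforce
  have "s - 1 \<noteq> 0" using s by auto
  then show ?thesis using zetaS_lower(2)[OF s] unfolding d zetaF_eq[OF s] by (simp add: field_simps)
qed

lemma zetaF_nonzero_right:
  assumes s: "Re s > 1"
  shows "zetaF s \<noteq> 0"
  using zetaS_lower(2)[OF s] s by (auto simp: zetaF_eq)

text \<open>Near height 0 the pole terms Re 1/(s - 1) at heights t and 2t are not bounded
  independently of eta; there, continuity at 1 replaces the argument with zeros.\<close>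

lemma zetaF_lower_near_1:
  "\<exists>\<tau>>0. \<tau> \<le> 1 \<and> (\<forall>s. norm (s - 1) \<le> 2 * \<tau> \<longrightarrow> norm (zetaF s) \<ge> 1/2)"
proof -
  have "continuous_on {s. Re s > 0} zetaF" using zetaF_holomorphic by (rule holomorphic_on_imp_continuous_on)
  moreover have "open {s::complex. Re s > 0}" by (simp add: open_halfspace_Re_gt)
  ultimately have "isCont zetaF 1" by (simp add: continuous_on_eq_continuous_at)
  then obtain d where d: "d > 0" "\<And>s. norm (s - 1) < d \<Longrightarrow> norm (zetaF s - 1) < 1/2"
    unfolding continuous_at_eps_delta dist_norm by (metis half_gt_zero zero_less_one zetaF_1)
  have "norm (zetaF s) \<ge> 1/2" if "norm (s - 1) \<le> 2 * min 1 (d / 4)" for s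
  proof -
    have "norm (s - 1) < d" using that d(1) by (simp add: min_def split: if_splits)
    then have "norm (zetaF s - 1) < 1/2" by (rule d(2))
    moreover have "norm (1 :: complex) \<le> norm (zetaF s) + norm (zetaF s - 1)"
      using norm_triangle_ineq4[of "zetaF s" "zetaF s - 1"] by simp
    ultimately show ?thesis by simp
  qed
  then show ?thesis using d(1) by (intro exI[of _ "min 1 (d/4)"]) auto
qed

text \<open>The base point is 1 + eta + it with eta = a / L and L = log(|t| + 4). The shift to the
  left is at most (7/6) eta, so the main part (3/4)/eta of the zero sum uses up 7/8 of the available
  1. The remaining terms have size O(L), which is a small multiple of 1/eta when a is small.\<close>

lemma zetaF_zero_free_large:
  assumes tau: "\<tau> > 0"
  shows "\<exists>a>0. \<exists>C>0. \<forall>s. \<bar>Im s\<bar> \<ge> \<tau> \<longrightarrow> \<bar>Re s - 1\<bar> \<le> a / ln (\<bar>Im s\<bar> + 4) \<longrightarrow>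
     norm (zetaF s) \<ge> C / ln (\<bar>Im s\<bar> + 4)"
proof -
  obtain C0 where C0: "C0 \<ge> 1" "\<And>s. Re s \<ge> 1/2 \<Longrightarrow> norm (zetaF s) \<le> C0 * (norm s + 1) ^ 2"
    using norm_zetaF_le by blast
  \<comment> \<open>The term -2 ln a is there because the quotient bound B below contains 1 / eta^2;
    since a ln a tends to 0, a small a still qualifies. The threshold 3/56 is chosen so that 7/8 +
    (7/6)(3/56) = 15/16, leaving 1/16.\<close>
  have "((\<lambda>a. a * (24 * (4 + (ln (8 * C0) - 2 * ln a)) + 2 / \<tau>^2)) \<longlongrightarrow> 0) (at_right 0)"
    by real_asymp
  then have "\<forall>\<^sub>F a in at_right 0. a * (24 * (4 + (ln (8 * C0) - 2 * ln a)) + 2 / \<tau>^2) < 3/56"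
    by (rule order_tendstoD) simp
  \<comment> \<open>Below 1/14 the shift (7/6) eta stays within 1/12, the largest one that
    \<open>Landau_local\<close> allows for radius 1/2.\<close>
  moreover have "\<forall>\<^sub>F a in at_right (0::real). a < 1/14" by real_asymp
  moreover have "\<forall>\<^sub>F a in at_right (0::real). a > 0" by real_asymp
  ultimately have "\<forall>\<^sub>F a in at_right (0::real). a > 0 \<and> a < 1/14 \<and> a * (24 * (4 + (ln (8 * C0) - 2 * ln a)) + 2 / \<tau>^2) < 3/56"
    by eventually_elim auto
  then obtain a where a: "a > 0" "a < 1/14" "a * (24 * (4 + (ln (8 * C0) - 2 * ln a)) + 2 / \<tau>^2) < 3/56"
    using eventually_happens'[OF trivial_limit_at_right_real] by blast
  define m where "m = 4 + (ln (8 * C0) - 2 * ln a)"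
  have lna: "ln (8 * C0) - 2 * ln a = ln (8 * C0 / a^2)"
    using a(1) C0(1) by (simp add: ln_div ln_realpow)
  have mq: "m = 4 + ln (8 * C0 / a^2)" by (simp only: m_def lna)
  have q1: "8 * C0 / a^2 \<ge> 1"
  proof -
    have "a^2 \<le> 1" using a by (simp add: power_le_one)
    then show ?thesis using a(1) C0(1) by (simp add: field_simps)
  qed
  have m4: "m \<ge> 4" unfolding mq using q1 by simp
  \<comment> \<open>The product of the three final factors times L: tau eta / 2 for the value at the
    base point, exp(-28 m a) from 24 M u <= 24 M (7/6) eta, and the remaining 1/16.\<close>
  define K where "K = \<tau> * a / 32 * exp (- (28 * m * a))"
  have "norm (zetaF s) \<ge> K / ln (\<bar>Im s\<bar> + 4)"
    if t: "\<bar>Im s\<bar> \<ge> \<tau>" and sig: "\<bar>Re s - 1\<bar> \<le> a / 6 / ln (\<bar>Im s\<bar> + 4)" for s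
  proof -
    define T where "T = Im s"
    define L where "L = ln (\<bar>T\<bar> + 4)"
    have expL: "exp L = \<bar>T\<bar> + 4" by (simp add: L_def)
    have L1: "L \<ge> 1"
    proof -
      have "exp 1 \<le> (4::real)" using exp_le by simp
      then have "exp 1 \<le> \<bar>T\<bar> + 4" by simp
      then have "exp 1 \<le> exp L" unfolding expL .
      then show ?thesis by simp
    qed
    define \<eta> where "\<eta> = a / L"
    have eta: "\<eta> > 0" "\<eta> \<le> a" "\<eta> < 1/14"
      using a L1 by (auto simp: \<eta>_def field_simps intro: order_less_le_trans)
    define M where "M = m * L"
    have M0: "M > 0" using m4 L1 by (simp add: M_def)
    have etaM: "\<eta> * M = a * m" using L1 by (simp add: \<eta>_def M_def)
    define S where "S = {s::complex. Re s > 0}"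
    have opS: "open S" by (simp add: S_def open_halfspace_Re_gt)
    have holS: "zetaF holomorphic_on S" using zetaF_holomorphic by (simp add: S_def)
    \<comment> \<open>The upper bound 4 C0 exp(2 L) on the disc of radius 1/2, divided by the lower
      bound eta^2 / 2 at its centre.\<close>
    define B where "B = 8 * C0 * exp (2 * L) / \<eta>^2"
    have BM: "B < exp M"
    proof -
      have "L < exp L" using exp_ge_add_one_self[of L] by linarith
      then have "L ^ 2 < (exp L) ^ 2" using L1 by (intro power_strict_mono) auto
      then have "L ^ 2 < exp (2 * L)" by (simp add: exp_double)
      then have "B < 8 * C0 / a^2 * (exp (2 * L) * exp (2 * L))"
        using C0(1) a(1) L1 unfolding B_def \<eta>_def by (simp add: field_simps power2_eq_square)
      also have "\<dots> = exp (ln (8 * C0 / a^2) + 4 * L)"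
        using C0(1) a(1) by (simp add: exp_add mult_exp_exp)
      also have "\<dots> \<le> exp M"
      proof -
        have "ln (8 * C0 / a^2) * 1 \<le> ln (8 * C0 / a^2) * L"
          using q1 L1 by (intro mult_left_mono) auto
        then show ?thesis unfolding M_def mq by (simp only: exp_le_cancel_iff distrib_right)
      qed
      finally show ?thesis .
    qed
    have Fz: "norm (zetaF z) \<ge> norm (z - 1) * (\<eta> / 2)" if z: "Re z = 1 + \<eta>" for z
    proof -
      have "Re z > 1" using z eta by simp
      from zetaS_lower(1)[OF this] have "norm (zetaS z) \<ge> \<eta> / (1 + \<eta>)" using z by simp
      moreover have "\<eta> / (1 + \<eta>) \<ge> \<eta> / 2" using eta by (intro divide_left_mono) auto
      ultimately have "\<eta> / 2 \<le> norm (zetaS z)" by linarith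
      then have "norm (z - 1) * (\<eta> / 2) \<le> norm (z - 1) * norm (zetaS z)" by (rule mult_left_mono) simp
      then show ?thesis using \<open>Re z > 1\<close> by (simp only: zetaF_eq norm_mult)
    qed
    have sub: "cball z (1/2) \<subseteq> S" if z: "Re z = 1 + \<eta>" for z
    proof
      fix w assume "w \<in> cball z (1/2)"
      then have "norm (z - w) \<le> 1/2" by (simp add: dist_norm)
      then have "Re (z - w) \<le> 1/2" using complex_Re_le_cmod[of "z - w"] by linarith
      then have "Re w > 0" using z eta by simp
      then show "w \<in> S" by (simp add: S_def)
    qed
    have nzS: "zetaF w \<noteq> 0" if "w \<in> S" "Re w \<ge> Re z" "Re z = 1 + \<eta>" for w z
      using that eta by (intro zetaF_nonzero_right) auto
    have bdS: "norm (zetaF w) \<le> B * norm (zetaF z)"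
      if w: "w \<in> cball z (1/2)" and z: "Re z = 1 + \<eta>" and zT: "\<bar>Im z\<bar> \<le> 2 * \<bar>T\<bar>" for w z
    proof -
      have nzw: "norm (z - w) \<le> 1/2" using w by (simp add: dist_norm)
      then have "Re (z - w) \<le> 1/2" using complex_Re_le_cmod[of "z - w"] by linarith
      then have Rw: "Re w \<ge> 1/2" using z eta by simp
      have "norm w \<le> norm z + 1/2" using norm_triangle_ineq4[of z "z - w"] nzw by simp
      also have "norm z \<le> \<bar>Re z\<bar> + \<bar>Im z\<bar>" by (rule cmod_le)
      finally have "norm w + 1 \<le> 2 * (\<bar>T\<bar> + 4)" using z zT eta by simp
      then have "(norm w + 1) ^ 2 \<le> (2 * (\<bar>T\<bar> + 4)) ^ 2" by (intro power_mono) auto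
      also have "\<dots> = 4 * exp (2 * L)" unfolding exp_double expL power_mult_distrib by simp
      finally have "norm (zetaF w) \<le> C0 * (4 * exp (2 * L))"
        using C0(2)[OF Rw] C0(1) by (meson mult_left_mono order_trans zero_le_one)
      also have "\<dots> = B * (\<eta> * (\<eta> / 2))" using eta by (simp add: B_def power2_eq_square)
      also have "\<dots> \<le> B * norm (zetaF z)"
      proof (rule mult_left_mono)
        have "\<eta> \<le> norm (z - 1)" using z abs_Re_le_cmod[of "z - 1"] eta by simp
        then have "\<eta> * (\<eta> / 2) \<le> norm (z - 1) * (\<eta> / 2)" using eta by (intro mult_right_mono) auto
        then show "\<eta> * (\<eta> / 2) \<le> norm (zetaF z)" using Fz[OF z] by linarith
        show "B \<ge> 0" using C0(1) by (simp add: B_def)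
      qed
      finally show ?thesis .
    qed
    note LL = Landau_local[OF opS holS _ _ _ _ BM M0, where r="1/2"]
    have LA: "Re (deriv zetaF z / zetaF z) \<ge> - (12 * M)" if z: "Re z = 1 + \<eta>" "\<bar>Im z\<bar> \<le> 2 * \<bar>T\<bar>" for z
    proof -
      have "Re (deriv zetaF z / zetaF z) \<ge> - (6 * M / (1/2))"
        by (rule LL(1)[OF sub[OF z(1)]]) (use nzS z bdS in auto)
      then show ?thesis by simp
    qed
    define z0 where "z0 = Complex (1 + \<eta>) T"
    define D where "D = Re (deriv zetaF z0 / zetaF z0)"
    have LB: "norm (zetaF (z0 - of_real u)) \<ge> norm (zetaF z0) * exp (- (24 * M * u)) * (1 - u * (D + 12 * M))"
      if u: "0 \<le> u" "u \<le> 1/12" for u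
    proof -
      have "norm (zetaF (z0 - of_real u)) \<ge> norm (zetaF z0) * exp (- (12 * M * u / (1/2))) * (1 - u * (Re (deriv zetaF z0 / zetaF z0) + 6 * M / (1/2)))"
        by (rule LL(2)[OF sub]) (use nzS[of _ z0] bdS[of _ z0] u in \<open>auto simp: z0_def\<close>)
      then show ?thesis by (simp add: D_def mult_ac)
    qed
    have T2: "T^2 \<ge> \<tau>^2" using t tau by (metis T_def abs_le_square_iff abs_of_pos)
    \<comment> \<open>In the inequality with weights 3, 4, 1 only the real point is close to the
      pole, and it contributes 3/eta against a weight 4. The pole terms at heights T and 2T are at
      most 1/tau^2 each.\<close>
    have Dle: "D \<le> 12 * M + (3/4) / \<eta> + 2 / \<tau>^2"
    proof -
      have ld: "Re (deriv zetaF z / zetaF z) = Re (1 / (z - 1)) + Re (deriv zetaS z / zetaS z)" if "Re z = 1 + \<eta>" for z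
      proof -
        have "Re z > 1" using that eta by simp
        then show ?thesis using arg_cong[OF zetaF_log_deriv[of z], of Re] by simp
      qed
      have R: "Re (1 / (Complex (1 + \<eta>) x - 1)) = \<eta> / (\<eta>^2 + x^2)" for x
        by (simp add: Re_divide)
      have q: "\<eta> / (\<eta>^2 + x^2) \<le> 1 / \<tau>^2" if x: "x^2 \<ge> \<tau>^2" for x
      proof (rule frac_le)
        show "\<tau>^2 > 0" using tau by simp
        show "\<tau>^2 \<le> \<eta>^2 + x^2" using x zero_le_power2[of \<eta>] by linarith
      qed (use eta in auto)
      have A1: "Re (deriv zetaS (of_real (1 + \<eta>)) / zetaS (of_real (1 + \<eta>))) \<ge> - (12 * M) - 1 / \<eta>"
      proof -
        have c: "of_real (1 + \<eta>) = Complex (1 + \<eta>) 0" by (simp add: complex_of_real_def)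
        show ?thesis
          using ld[of "Complex (1 + \<eta>) 0"] R[of 0] LA[of "Complex (1 + \<eta>) 0"] eta
          unfolding c by (simp add: power2_eq_square)
      qed
      have A2: "Re (deriv zetaS (Complex (1 + \<eta>) (2 * T)) / zetaS (Complex (1 + \<eta>) (2 * T))) \<ge> - (12 * M) - 1 / \<tau>^2"
      proof -
        have "(2 * T)^2 = 4 * T^2" by (simp add: power_mult_distrib)
        then have "(2 * T)^2 \<ge> \<tau>^2" using T2 zero_le_power2[of T] by linarith
        from q[OF this] ld[of "Complex (1 + \<eta>) (2 * T)"] R[of "2 * T"] LA[of "Complex (1 + \<eta>) (2 * T)"]
        show ?thesis by (simp add: abs_mult)
      qed
      have A3: "D = \<eta> / (\<eta>^2 + T^2) + Re (deriv zetaS z0 / zetaS z0)"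
        unfolding D_def z0_def using ld[of "Complex (1 + \<eta>) T"] R[of T] by simp
      have "4 * Re (deriv zetaS z0 / zetaS z0) \<le> 48 * M + 3 / \<eta> + 1 / \<tau>^2"
        using zeta_three_four_one[of "1 + \<eta>" T] A1 A2 eta unfolding z0_def by simp
      moreover have "1 / \<tau>^2 \<ge> 0" by simp
      moreover have "3 / \<eta> = 3 * (1 / \<eta>)" "(3/4) / \<eta> = (3/4) * (1 / \<eta>)" "2 / \<tau>^2 = 2 * (1 / \<tau>^2)" by simp_all
      ultimately show ?thesis using A3 q[OF T2] by linarith
    qed
    \<comment> \<open>The distance from the base point to s: eta to reach the line Re s = 1 and at
      most eta/6 beyond it.\<close>
    define u where "u = 1 + \<eta> - Re s"
    have "a / 6 / L = \<eta> / 6" by (simp add: \<eta>_def)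
    then have us: "\<bar>Re s - 1\<bar> \<le> \<eta> / 6" using sig by (simp add: L_def T_def)
    then have u: "0 \<le> u" "u \<le> 7/6 * \<eta>" using eta abs_le_D1[OF us] abs_le_D2[OF us] unfolding u_def by linarith+
    have us0: "z0 - of_real u = s" by (simp add: z0_def u_def T_def complex_eq_iff)
    have f1: "1 - u * (D + 12 * M) \<ge> 1/16"
    proof -
      have "u * (D + 12 * M) \<le> 7/6 * \<eta> * (24 * M + (3/4) / \<eta> + 2 / \<tau>^2)"
      proof (cases "D + 12 * M \<ge> 0")
        case True
        then show ?thesis using u Dle by (intro mult_mono) auto
      next
        case False
        then have "u * (D + 12 * M) \<le> 0" using u by (intro mult_nonneg_nonpos) auto
        also have "0 \<le> 7/6 * \<eta> * (24 * M + (3/4) / \<eta> + 2 / \<tau>^2)" using eta M0 by simp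
        finally show ?thesis .
      qed
      also have "\<dots> = 7/8 + 7/6 * (24 * (\<eta> * M) + \<eta> * (2 / \<tau>^2))" using eta by (simp add: field_simps)
      also have "\<dots> \<le> 7/8 + 7/6 * (24 * (a * m) + a * (2 / \<tau>^2))"
        unfolding etaM using eta by (intro add_left_mono mult_left_mono mult_right_mono) auto
      finally have "u * (D + 12 * M) \<le> 7/8 + 7/6 * (24 * (a * m) + a * (2 / \<tau>^2))" .
      moreover have "24 * (a * m) + a * (2 / \<tau>^2) < 3/56"
        using a(3) by (simp add: m_def algebra_simps)
      ultimately have "u * (D + 12 * M) \<le> 7/8 + 7/6 * (3/56)"
        by (meson add_left_mono less_imp_le mult_left_mono order_trans zero_le_divide_iff zero_le_numeral)
      then show ?thesis by simp
    qed
    have f2: "exp (- (24 * M * u)) \<ge> exp (- (28 * m * a))"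
    proof -
      have "24 * M * u \<le> 24 * M * (7/6 * \<eta>)" using u M0 by (intro mult_left_mono) auto
      also have "\<dots> = 28 * m * a" using etaM by (simp add: mult_ac)
      finally show ?thesis by simp
    qed
    have f3: "norm (zetaF z0) \<ge> \<tau> * (\<eta> / 2)"
    proof -
      have "\<tau> \<le> norm (z0 - 1)" using t abs_Im_le_cmod[of "z0 - 1"] by (simp add: z0_def T_def)
      then have "\<tau> * (\<eta> / 2) \<le> norm (z0 - 1) * (\<eta> / 2)" using eta by (intro mult_right_mono) auto
      then show ?thesis using Fz[of z0] by (simp add: z0_def)
    qed
    have "K / L = \<tau> * (\<eta> / 2) * exp (- (28 * m * a)) * (1/16)"
      by (simp add: K_def \<eta>_def)
    also have "\<dots> \<le> norm (zetaF z0) * exp (- (24 * M * u)) * (1 - u * (D + 12 * M))"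
      using f1 f2 f3 eta tau by (intro mult_mono) auto
    also have "\<dots> \<le> norm (zetaF s)" using LB[of u] u eta unfolding us0 by simp
    finally show ?thesis by (simp add: L_def T_def)
  qed
  moreover have "K > 0" using tau a by (simp add: K_def)
  ultimately show ?thesis using a(1) by (intro exI[of _ "a / 6"] conjI exI[of _ K]) auto
qed

theorem zetaF_zero_free:
  "\<exists>c>0. \<exists>C>0. c \<le> 1/4 \<and> (\<forall>s. \<bar>Re s - 1\<bar> \<le> c / ln (\<bar>Im s\<bar> + 4) \<longrightarrow>
     zetaF s \<noteq> 0 \<and> norm (1 / zetaF s) \<le> C * ln (\<bar>Im s\<bar> + 4))"
proof -
  obtain \<tau> where tau: "\<tau> > 0" "\<tau> \<le> 1" "\<And>s. norm (s - 1) \<le> 2 * \<tau> \<Longrightarrow> norm (zetaF s) \<ge> 1/2"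
    using zetaF_lower_near_1 by blast
  obtain a K where aK: "a > 0" "K > 0" "\<And>s. \<bar>Im s\<bar> \<ge> \<tau> \<Longrightarrow> \<bar>Re s - 1\<bar> \<le> a / ln (\<bar>Im s\<bar> + 4) \<Longrightarrow>
     norm (zetaF s) \<ge> K / ln (\<bar>Im s\<bar> + 4)"
    using zetaF_zero_free_large[OF tau(1)] by blast
  \<comment> \<open>The bound tau puts every s of the region with |Im s| < tau into the disc |s - 1|
    <= 2 tau.\<close>
  define c where "c = min (1/4) (min a \<tau>)"
  define C where "C = max 2 (1 / K)"
  have "zetaF s \<noteq> 0 \<and> norm (1 / zetaF s) \<le> C * ln (\<bar>Im s\<bar> + 4)"
    if s: "\<bar>Re s - 1\<bar> \<le> c / ln (\<bar>Im s\<bar> + 4)" for s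
  proof -
    define L where "L = ln (\<bar>Im s\<bar> + 4)"
    have L1: "L \<ge> 1"
    proof -
      have "exp 1 \<le> (4::real)" using exp_le by simp
      then have "exp 1 \<le> \<bar>Im s\<bar> + 4" by simp
      then have "exp 1 \<le> exp L" by (simp add: L_def)
      then show ?thesis by simp
    qed
    have s': "\<bar>Re s - 1\<bar> \<le> c / L" using s by (simp add: L_def)
    have c: "c > 0" "c \<le> a" "c \<le> \<tau>" using aK(1) tau(1) by (auto simp: c_def)
    have C: "C \<ge> 2" "C \<ge> 1 / K" by (auto simp: C_def)
    show ?thesis
    proof (cases "\<bar>Im s\<bar> \<ge> \<tau>")
      case True
      have "c / L \<le> a / L" using c L1 by (intro divide_right_mono) auto
      then have F: "norm (zetaF s) \<ge> K / L" using aK(3)[OF True] s' by (simp add: L_def)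
      moreover have "K / L > 0" using aK(2) L1 by simp
      ultimately have nz: "zetaF s \<noteq> 0" by auto
      have "norm (1 / zetaF s) \<le> 1 / (K / L)"
        unfolding norm_divide norm_one using F \<open>K / L > 0\<close> nz by (intro divide_left_mono mult_pos_pos) auto
      also have "\<dots> = 1 / K * L" by simp
      also have "\<dots> \<le> C * L" using C L1 by (intro mult_right_mono) auto
      finally show ?thesis using nz by (simp add: L_def)
    next
      case False
      have "c / L \<le> c / 1" using c L1 by (intro divide_left_mono) auto
      then have "norm (s - 1) \<le> 2 * \<tau>"
        using False s' c cmod_le[of "s - 1"] by simp
      then have F: "norm (zetaF s) \<ge> 1/2" by (rule tau(3))
      then have nz: "zetaF s \<noteq> 0" by auto
      have "norm (1 / zetaF s) \<le> 1 / (1/2)"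
        unfolding norm_divide norm_one using F nz by (intro divide_left_mono) (auto intro: mult_pos_pos)
      also have "\<dots> \<le> C * L" using mult_mono[of 2 C 1 L] C L1 by simp
      finally show ?thesis using nz by (simp add: L_def)
    qed
  qed
  moreover have "c > 0" "c \<le> 1/4" using aK(1) tau(1) by (auto simp: c_def)
  moreover have "C > 0" by (simp add: C_def)
  ultimately show ?thesis by blast
qed

section \<open>The prime number theorem for the Moebius function\<close>

definition nle :: "real \<Rightarrow> nat set" where
  "nle x = {m. 1 \<le> m \<and> real m \<le> x}"

lemma nle_eq: "nle x = {1..nat \<lfloor>x\<rfloor>}"
proof -
  have "1 \<le> m \<and> real m \<le> x \<longleftrightarrow> m \<in> {1..nat \<lfloor>x\<rfloor>}" for m
  proof -
    have "real m \<le> x \<longleftrightarrow> int m \<le> \<lfloor>x\<rfloor>" by (simp add: le_floor_iff)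
    then show ?thesis by auto
  qed
  then show ?thesis unfolding nle_def by blast
qed

lemma finite_nle [simp]: "finite (nle x)"
  by (simp add: nle_eq)

section \<open>Newman's contour method\<close>

lemma part_circlepath_split:
  assumes ab: "a < b" and bc: "b < c" and r: "r > 0" and f: "continuous_on (sphere z r) f"
  shows "contour_integral (part_circlepath z r a c) f
    = contour_integral (part_circlepath z r a b) f + contour_integral (part_circlepath z r b c) f"
proof -
  define g where "g t = f (z + of_real r * cis t) * of_real r * \<i> * cis t" for t
  have cg: "continuous_on A g" for A
  proof -
    have "continuous_on A (\<lambda>t. f (z + of_real r * cis t))"
      by (rule continuous_on_compose2[OF f]) (use r in \<open>auto intro!: continuous_intros simp: dist_norm norm_mult\<close>)
    then show ?thesis unfolding g_def by (intro continuous_intros)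
  qed
  have h: "contour_integral (part_circlepath z r u v) f = integral {u..v} g" if "u < v" for u v
    unfolding g_def by (rule contour_integral_part_circlepath_eq[OF that])
  have "integral {a..b} g + integral {b..c} g = integral {a..c} g"
    by (rule Henstock_Kurzweil_Integration.integral_combine) (use ab bc cg in \<open>auto intro: integrable_continuous_real\<close>)
  then show ?thesis using h ab bc by simp
qed

lemma path_image_arc_norm:
  assumes "s \<in> path_image (part_circlepath 0 r a b)" "r > 0" "a \<le> b"
  shows "norm s = r" "\<exists>t. a \<le> t \<and> t \<le> b \<and> s = of_real r * cis t"
  using assms by (auto simp: path_image_part_circlepath cis_conv_exp norm_mult)

lemma arc_Re:
  assumes "s \<in> path_image (part_circlepath 0 r a b)" "r > 0" "a \<le> b"
  shows "a = 0 \<Longrightarrow> b = pi/2 \<Longrightarrow> Re s \<ge> 0" "a = pi/2 \<Longrightarrow> b = 3*pi/2 \<Longrightarrow> Re s \<le> 0"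
    "a = 3*pi/2 \<Longrightarrow> b = 2*pi \<Longrightarrow> Re s \<ge> 0"
proof -
  obtain t where t: "a \<le> t" "t \<le> b" "s = of_real r * cis t" using path_image_arc_norm(2)[OF assms] by blast
  have R: "Re s = r * cos t" using t by simp
  show "a = 0 \<Longrightarrow> b = pi/2 \<Longrightarrow> Re s \<ge> 0"
    unfolding R using t assms(2) by (intro mult_nonneg_nonneg cos_ge_zero) auto
  show "Re s \<le> 0" if "a = pi/2" "b = 3*pi/2"
  proof -
    have "cos (t - pi) \<ge> 0" using t that by (intro cos_ge_zero) auto
    then have "cos t \<le> 0" by (simp add: cos_diff)
    then show ?thesis unfolding R using assms(2) by (simp add: mult_le_0_iff)
  qed
  show "Re s \<ge> 0" if "a = 3*pi/2" "b = 2*pi"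
  proof -
    have "cos (t - 2 * pi) \<ge> 0" using t that by (intro cos_ge_zero) auto
    then have "cos t \<ge> 0" by (simp add: cos_diff)
    then show ?thesis unfolding R using assms(2) by simp
  qed
qed

text \<open>On the circle rho^2 = s cnj(s), so the weight is s (2 Re s) / rho^2. It vanishes where
  the circle meets the imaginary axis and there cancels the 1 / Re s of the tail estimate.\<close>

lemma Newman_weight:
  assumes "norm s = \<rho>" "\<rho> > 0"
  shows "norm (1 + s^2 / of_real \<rho>^2) = 2 * \<bar>Re s\<bar> / \<rho>"
proof -
  have "of_real \<rho>^2 = s * cnj s" using assms(1) complex_norm_square[of s] by simp
  then have "of_real \<rho>^2 * (1 + s^2 / of_real \<rho>^2) = s * cnj s + s^2"
    using assms(2) by (simp add: field_simps)
  also have "\<dots> = s * of_real (2 * Re s)"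
    using complex_add_cnj[of s] by (simp add: power2_eq_square algebra_simps flip: distrib_left)
  finally have "\<rho>^2 * norm (1 + s^2 / of_real \<rho>^2) = \<rho> * (2 * \<bar>Re s\<bar>)"
    using arg_cong[of _ _ norm] assms by (metis abs_mult abs_numeral norm_mult norm_of_real norm_power abs_of_pos)
  then show ?thesis using assms(2) by (simp add: field_simps power2_eq_square)
qed

text \<open>At 0 the weight has value 1 and derivative 0, so the two summands have residues
  \<open>A'\<close> and 1. The double pole is there because the quantity wanted is a derivative at
  0. The circle is cut where Re s changes sign, as the halves are estimated differently.\<close>

lemma Newman_circle_split:
  fixes A X :: "complex \<Rightarrow> complex"
  assumes A: "(A has_field_derivative A') (at 0)" "A holomorphic_on UNIV" and X: "X holomorphic_on UNIV" "X 0 = 1"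
    and rho: "\<rho> > 0"
  defines "G \<equiv> \<lambda>s. A s * (1 + s^2 / of_real \<rho>^2) / s^2 - X s * (1 + s^2 / of_real \<rho>^2) / s"
  shows "contour_integral (part_circlepath 0 \<rho> (3*pi/2) (2*pi)) G + contour_integral (part_circlepath 0 \<rho> 0 (pi/2)) G
     + contour_integral (part_circlepath 0 \<rho> (pi/2) (3*pi/2)) G = 2 * of_real pi * \<i> * (A' - 1)"
proof -
  define w where "w s = 1 + s^2 / of_real \<rho>^2" for s :: complex
  have wh: "w holomorphic_on S" for S unfolding w_def using rho by (intro holomorphic_intros) auto
  have Ah: "A holomorphic_on S" "X holomorphic_on S" for S using A X holomorphic_on_subset by auto
  have h1: "(\<lambda>s. A s * w s) holomorphic_on S" "(\<lambda>s. X s * w s) holomorphic_on S" for S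
    by (intro holomorphic_intros wh Ah)+
  have c1: "continuous_on S (\<lambda>s. A s * w s)" "continuous_on S (\<lambda>s. X s * w s)" for S
    by (intro holomorphic_on_imp_continuous_on h1)+
  have z: "0 \<in> ball 0 \<rho>" using rho by simp
  note C1 = Cauchy_derivative_integral_circlepath[OF c1(1) h1(1) z, unfolded diff_zero]
  have "((\<lambda>s. A s * w s) has_field_derivative A' * w 0 + 0 * A 0) (at 0)"
    by (rule DERIV_mult[OF A(1)]) (unfold w_def, use rho in \<open>auto intro!: derivative_eq_intros\<close>)
  then have "A' * w 0 + 0 * A 0 = 1 / (2 * of_real pi * \<i>) * contour_integral (circlepath 0 \<rho>) (\<lambda>s. A s * w s / s^2)"
    using C1(2) DERIV_unique by blast
  then have i1: "((\<lambda>s. A s * w s / s^2) has_contour_integral (2 * of_real pi * \<i> * A')) (circlepath 0 \<rho>)"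
    using has_contour_integral_integral[OF C1(1)] by (simp add: w_def field_simps)
  have i2: "((\<lambda>s. X s * w s / s) has_contour_integral (2 * of_real pi * \<i>)) (circlepath 0 \<rho>)"
    using Cauchy_integral_circlepath[OF c1(2) h1(2), of 0 0 \<rho>] rho X(2) by (simp add: w_def)
  have "(G has_contour_integral (2 * of_real pi * \<i> * A' - 2 * of_real pi * \<i>)) (circlepath 0 \<rho>)"
    using has_contour_integral_diff[OF i1 i2] by (simp add: G_def w_def)
  then have "contour_integral (circlepath 0 \<rho>) G = 2 * of_real pi * \<i> * (A' - 1)"
    by (simp add: contour_integral_unique algebra_simps)
  moreover have cG: "continuous_on (sphere 0 \<rho>) G"
  proof -
    have "continuous_on (sphere 0 \<rho>) (\<lambda>s. A s * w s / s^2 - X s * w s / s)"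
      using rho by (intro continuous_intros c1) auto
    then show ?thesis by (simp add: G_def w_def)
  qed
  have "contour_integral (circlepath 0 \<rho>) G = contour_integral (part_circlepath 0 \<rho> 0 (pi/2)) G
      + contour_integral (part_circlepath 0 \<rho> (pi/2) (2*pi)) G"
    unfolding circlepath_def by (rule part_circlepath_split[OF _ _ rho cG]) auto
  moreover have "contour_integral (part_circlepath 0 \<rho> (pi/2) (2*pi)) G
    = contour_integral (part_circlepath 0 \<rho> (pi/2) (3*pi/2)) G + contour_integral (part_circlepath 0 \<rho> (3*pi/2) (2*pi)) G"
    by (rule part_circlepath_split[OF _ _ rho cG]) auto
  ultimately show ?thesis by (simp add: add_ac)
qed

definition hsum :: "real \<Rightarrow> real" where
  "hsum x = (\<Sum>d\<in>nle x. moebius d / real d * ln (x / real d))"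

lemma sum_inverse_le:
  assumes "n > 0"
  shows "(\<Sum>d=1..n. 1 / real d) \<le> 1 + ln (real n)"
  using assms
proof (induction n rule: nat_induct_non_zero)
  case (Suc n)
  have "ln (real n / real (Suc n)) \<le> real n / real (Suc n) - 1"
    using Suc.hyps by (intro ln_le_minus_one) auto
  then have "1 / real (Suc n) \<le> ln (real (Suc n)) - ln (real n)"
    using Suc.hyps by (simp add: ln_div field_simps)
  then show ?case using Suc.IH by simp
qed simp

lemma sum_inverse_nle_le:
  assumes "x \<ge> 1"
  shows "(\<Sum>d\<in>nle x. 1 / real d) \<le> 1 + ln x"
proof -
  have N: "nat \<lfloor>x\<rfloor> > 0" "real (nat \<lfloor>x\<rfloor>) \<le> x" using assms by auto
  have "(\<Sum>d\<in>nle x. 1 / real d) \<le> 1 + ln (real (nat \<lfloor>x\<rfloor>))"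
    unfolding nle_eq by (rule sum_inverse_le[OF N(1)])
  also have "\<dots> \<le> 1 + ln x" using N by simp
  finally show ?thesis .
qed

text \<open>The tail of the Moebius series beyond x, compared with an integral. On the contour the
  factor x^(-Re s) is cancelled by x^s, and 1 / Re s by the weight.\<close>

lemma moebius_tail_le:
  assumes x: "x \<ge> 1" and s: "Re s > 0"
  shows "norm ((\<Sum>d\<in>nle x. of_real (moebius d) * npow d (1 + s)) - s / zetaF (1 + s))
    \<le> x powr (- Re s) * (1 / x + 1 / Re s)"
proof -
  define N where "N = nat \<lfloor>x\<rfloor>"
  define f where "f n = of_real (moebius (Suc n)) * npow (Suc n) (1 + s)" for n
  have s1: "Re (1 + s) > 1" using s by simp
  have N: "x \<le> real (N + 1)" "real (N + 1) > 0" unfolding N_def by linarith+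
  have sm: "summable (\<lambda>n. norm (f n))" unfolding f_def by (rule moebius_npow_summable[OF s1])
  have "suminf f * zetaS (1 + s) = 1" unfolding f_def by (rule moebius_npow_sum[OF s1])
  moreover have "zetaF (1 + s) = s * zetaS (1 + s)" using zetaF_eq[OF s1] by simp
  moreover have "zetaS (1 + s) \<noteq> 0" by (rule zetaS_lower(2)[OF s1])
  moreover have "s \<noteq> 0" using s by auto
  ultimately have "suminf f = s / zetaF (1 + s)"
    by (simp add: nonzero_eq_divide_eq)
  moreover have "(\<Sum>d\<in>nle x. of_real (moebius d) * npow d (1 + s)) = (\<Sum>i<N. f i)"
    unfolding nle_eq f_def N_def[symmetric]
    by (rule sum.reindex_bij_witness[of _ Suc "\<lambda>n. n - 1"]) auto
  ultimately have e: "(\<Sum>d\<in>nle x. of_real (moebius d) * npow d (1 + s)) - s / zetaF (1 + s) = - (\<Sum>n. f (n + N))"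
    using suminf_split_initial_segment[OF summable_norm_cancel[OF sm], of N] by (simp add: eq_diff_eq algebra_simps)
  have sm': "summable (\<lambda>n. norm (f (n + N)))" by (rule summable_ignore_initial_segment[OF sm])
  have "norm (\<Sum>n. f (n + N)) \<le> (\<Sum>n. norm (f (n + N)))" by (rule summable_norm[OF sm'])
  also have "\<dots> \<le> (\<Sum>n. real (n + (N + 1)) powr (-1 - Re s))"
  proof (rule suminf_le[OF _ sm'])
    fix n
    have "norm (f (n + N)) \<le> 1 * norm (npow (Suc (n + N)) (1 + s))"
      unfolding f_def norm_mult by (intro mult_right_mono) (auto intro: abs_moebius_le)
    also have "\<dots> = real (n + (N + 1)) powr (-1 - Re s)" by (simp add: norm_npow del: of_nat_Suc)
    finally show "norm (f (n + N)) \<le> real (n + (N + 1)) powr (-1 - Re s)" .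
    show "summable (\<lambda>n. real (n + (N + 1)) powr (-1 - Re s))" by (rule powr_tail_le(1)[OF s]) simp
  qed
  also have "\<dots> \<le> real (N + 1) powr (-1 - Re s) + real (N + 1) powr (- Re s) / Re s"
    by (rule powr_tail_le(2)[OF s]) simp
  also have "\<dots> \<le> x powr (-1 - Re s) + x powr (- Re s) / Re s"
    using N x s by (intro add_mono divide_right_mono powr_mono2') auto
  also have "\<dots> = x powr (- Re s) * (1 / x + 1 / Re s)"
  proof -
    have "-1 - Re s = - Re s + (-1)" by simp
    then have "x powr (-1 - Re s) = x powr (- Re s) * x powr (-1)" by (simp only: powr_add)
    then show ?thesis using x by (simp add: powr_minus_divide algebra_simps)
  qed
  finally show ?thesis unfolding e by simp
qed

text \<open>Here A(s) is the sum of mu(d)/d (x/d)^s over d <= x. Differentiating at 0 brings down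
  log(x/d), and for Re s <= 0 no term exceeds 1/d because x/d >= 1.\<close>

lemma hsum_generating:
  fixes x :: real
  assumes x: "x \<ge> 1"
  defines "A \<equiv> \<lambda>s. (\<Sum>d\<in>nle x. of_real (moebius d) * npow d (1 + s)) * exp (s * of_real (ln x))"
  shows "A holomorphic_on UNIV" "(A has_field_derivative of_real (hsum x)) (at 0)"
    "Re s \<le> 0 \<Longrightarrow> norm (A s) \<le> 1 + ln x"
proof -
  have e: "A s = (\<Sum>d\<in>nle x. of_real (moebius d / real d) * exp (s * of_real (ln (x / real d))))" for s
    unfolding A_def sum_distrib_right
  proof (rule sum.cong[OF refl])
    fix d assume "d \<in> nle x"
    then have d: "d > 0" by (simp add: nle_def)
    have "npow d (1 + s) * exp (s * of_real (ln x)) = exp (- of_real (ln (real d))) * exp (s * of_real (ln (x / real d)))"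
      unfolding npow_def using x d by (simp add: ln_div mult_exp_exp algebra_simps)
    also have "exp (- of_real (ln (real d)) :: complex) = of_real (1 / real d)"
      using d by (simp add: exp_minus exp_of_real[symmetric] inverse_eq_divide del: exp_of_real) (simp add: exp_of_real)
    finally show "of_real (moebius d) * npow d (1 + s) * exp (s * of_real (ln x)) = of_real (moebius d / real d) * exp (s * of_real (ln (x / real d)))"
      by (simp add: mult.assoc)
  qed
  have e': "A = (\<lambda>s. \<Sum>d\<in>nle x. of_real (moebius d / real d) * exp (s * of_real (ln (x / real d))))"
    using e by blast
  show "A holomorphic_on UNIV" unfolding e' by (intro holomorphic_intros)
  have "(A has_field_derivative (\<Sum>d\<in>nle x. of_real (moebius d / real d) * (exp (0 * of_real (ln (x / real d))) * of_real (ln (x / real d))))) (at 0)"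
    unfolding e' by (rule DERIV_sum) (auto intro!: derivative_eq_intros simp: nle_def)
  then show "(A has_field_derivative of_real (hsum x)) (at 0)" by (simp add: hsum_def)
  show "norm (A s) \<le> 1 + ln x" if s: "Re s \<le> 0"
  proof -
    have "norm (A s) \<le> (\<Sum>d\<in>nle x. norm (of_real (moebius d / real d) * exp (s * of_real (ln (x / real d)))))"
      unfolding e by (rule norm_sum)
    also have "\<dots> \<le> (\<Sum>d\<in>nle x. 1 / real d)"
    proof (rule sum_mono)
      fix d assume "d \<in> nle x"
      then have d: "d \<ge> 1" "real d \<le> x" by (auto simp: nle_def)
      then have "ln (x / real d) \<ge> 0" by (intro ln_ge_zero) simp
      then have "Re s * ln (x / real d) \<le> 0" using s by (simp add: mult_le_0_iff)
      then have 1: "norm (exp (s * of_real (ln (x / real d)))) \<le> 1" by (simp add: norm_exp_eq_Re)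
      have 2: "norm (of_real (moebius d / real d) :: complex) \<le> 1 / real d"
        using abs_moebius_le[of d] by (simp add: abs_divide divide_right_mono norm_divide)
      show "norm (of_real (moebius d / real d) * exp (s * of_real (ln (x / real d)))) \<le> 1 / real d"
        unfolding norm_mult using mult_mono[OF 2 1] by simp
    qed
    also have "\<dots> \<le> 1 + ln x" by (rule sum_inverse_nle_le[OF x])
    finally show ?thesis .
  qed
qed

text \<open>The first term collects the left arc and the replacement of the partial sum by the full
  series on the right arcs. The part (C L + 1) / rho comes from the horizontal segments at height
  rho, the rest from the vertical segment Re s = -delta, where x^s has size x^(-delta).\<close>

lemma Newman_estimate:
  assumes c: "c > 0" "c \<le> 1/4" and C: "C > 0"
    and Z: "\<And>s. \<bar>Re s - 1\<bar> \<le> c / ln (\<bar>Im s\<bar> + 4) \<Longrightarrow> zetaF s \<noteq> 0 \<and> norm (1 / zetaF s) \<le> C * ln (\<bar>Im s\<bar> + 4)"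
    and x: "x \<ge> exp 1" and rho: "1 \<le> \<rho>" "\<rho> \<le> x"
  defines "L \<equiv> ln (\<rho> + 5)"
  defines "\<delta> \<equiv> c / (2 * L)"
  shows "\<bar>hsum x - 1\<bar> \<le> (4 + ln x) / \<rho> + (C * L + 1) * (1 / \<rho> + \<rho> * exp (- \<delta> * ln x) / \<delta>)"
proof -
  have x1: "x \<ge> 1" using x exp_gt_one[of "1::real"] by linarith
  have lnx: "ln x \<ge> 1" using x x1 by (metis exp_gt_zero ln_exp ln_mono order_less_le_trans)
  have L1: "L \<ge> 1"
  proof -
    have "exp 1 \<le> (3::real)" by (rule exp_le)
    then have "exp 1 \<le> \<rho> + 5" using rho by simp
    then have "exp 1 \<le> exp L" using rho by (simp add: L_def)
    then show ?thesis by simp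
  qed
  have del: "\<delta> > 0" "\<delta> < 1" "2 * \<delta> = c / L" using c L1 by (auto simp: \<delta>_def field_simps)
  define w where "w s = 1 + s^2 / of_real \<rho>^2" for s :: complex
  define X where "X s = exp (s * of_real (ln x))" for s :: complex
  define Sx where "Sx s = (\<Sum>d\<in>nle x. of_real (moebius d) * npow d (1 + s))" for s
  define A where "A s = Sx s * X s" for s
  define G where "G s = A s * w s / s^2 - X s * w s / s" for s
  have normX: "norm (X s) = exp (Re s * ln x)" for s by (simp add: X_def norm_exp_eq_Re)
  have A: "A holomorphic_on UNIV" "(A has_field_derivative of_real (hsum x)) (at 0)"
    "\<And>s. Re s \<le> 0 \<Longrightarrow> norm (A s) \<le> 1 + ln x"
    using hsum_generating[OF x1] unfolding A_def X_def Sx_def by blast+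
  have Xh: "X holomorphic_on S" for S unfolding X_def by (intro holomorphic_intros)
  have X0: "X 0 = 1" by (simp add: X_def)
  have rho0: "\<rho> > 0" using rho by simp
  define a1 where "a1 = part_circlepath 0 \<rho> 0 (pi/2)"
  define a2 where "a2 = part_circlepath 0 \<rho> (pi/2) (3*pi/2)"
  define a3 where "a3 = part_circlepath 0 \<rho> (3*pi/2) (2*pi)"
  have main: "contour_integral a3 G + contour_integral a1 G + contour_integral a2 G = 2 * of_real pi * \<i> * (of_real (hsum x) - 1)"
    using Newman_circle_split[OF A(2,1) Xh X0 rho0] unfolding G_def w_def a1_def a2_def a3_def by simp
  have arcs: "norm s = \<rho>" if "s \<in> path_image a1 \<or> s \<in> path_image a2 \<or> s \<in> path_image a3" for s
    using that path_image_arc_norm(1)[OF _ rho0] unfolding a1_def a2_def a3_def by fastforce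
  have arcsR: "Re s \<ge> 0" if "s \<in> path_image a1 \<or> s \<in> path_image a3" for s
    using that arc_Re(1)[OF _ rho0, of s 0 "pi/2"] arc_Re(3)[OF _ rho0, of s "3*pi/2" "2*pi"] unfolding a1_def a3_def by auto
  have arcsL: "Re s \<le> 0" if "s \<in> path_image a2" for s
    using that arc_Re(2)[OF _ rho0, of s "pi/2" "3*pi/2"] unfolding a2_def by auto
  have wn: "norm (w s) = 2 * \<bar>Re s\<bar> / \<rho>" if "norm s = \<rho>" for s
    unfolding w_def by (rule Newman_weight[OF that rho0])
  have wh: "w holomorphic_on S" for S unfolding w_def using rho0 by (intro holomorphic_intros) auto
  have Gh: "G holomorphic_on - {0}"
    unfolding G_def using A(1) holomorphic_on_subset by (intro holomorphic_intros wh Xh) auto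
  have Gc: "continuous_on (path_image p) G" if "p = a1 \<or> p = a2 \<or> p = a3" for p
    by (rule continuous_on_subset[OF holomorphic_on_imp_continuous_on[OF Gh]]) (use that arcs rho0 in fastforce)
  have Gi: "G contour_integrable_on a1" "G contour_integrable_on a2" "G contour_integrable_on a3"
    using Gc unfolding a1_def a2_def a3_def by (auto intro!: contour_integrable_continuous_part_circlepath)
  \<comment> \<open>the left arc, where the partial sum itself is small\<close>
  have left: "norm (contour_integral a2 G) \<le> 2 * pi * (2 + ln x) / \<rho>"
  proof -
    have "norm (contour_integral a2 G) \<le> 2 * (2 + ln x) / \<rho>^2 * \<rho> * \<bar>3*pi/2 - pi/2\<bar>"
      unfolding a2_def
    proof (rule contour_integral_bound_part_circlepath)
      fix s assume s: "s \<in> path_image (part_circlepath 0 \<rho> (pi / 2) (3 * pi / 2))"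
      then have sn: "norm s = \<rho>" and sr: "Re s \<le> 0" using arcs[of s] arcsL[of s] by (auto simp: a2_def)
      have k: "\<bar>Re s\<bar> \<le> \<rho>" using abs_Re_le_cmod[of s] sn by simp
      have "norm (A s * w s / s^2) = norm (A s) * (2 * \<bar>Re s\<bar> / \<rho>) / \<rho>^2"
        by (simp add: norm_mult norm_divide norm_power sn wn[OF sn])
      also have "\<dots> \<le> (1 + ln x) * (2 * \<rho> / \<rho>) / \<rho>^2"
        using A(3)[OF sr] k rho0 lnx by (intro divide_right_mono mult_mono) auto
      also have "\<dots> = 2 * (1 + ln x) / \<rho>^2" using rho0 by (simp add: field_simps)
      finally have 1: "norm (A s * w s / s^2) \<le> 2 * (1 + ln x) / \<rho>^2" .
      have "\<bar>Re s\<bar> * exp (Re s * ln x) \<le> 1"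
      proof -
        have "Re s * ln x \<le> Re s" using mult_left_mono_neg[OF lnx sr] by simp
        then have "\<bar>Re s\<bar> * exp (Re s * ln x) \<le> - Re s * exp (Re s)"
          using sr by (simp add: mult_left_mono_neg)
        also have "\<dots> \<le> exp (- Re s) * exp (Re s)"
          using exp_ge_add_one_self[of "- Re s"] by (intro mult_right_mono) auto
        finally show ?thesis by (simp add: mult_exp_exp)
      qed
      then have "2 * (\<bar>Re s\<bar> * exp (Re s * ln x)) / \<rho>^2 \<le> 2 * 1 / \<rho>^2"
        by (intro divide_right_mono mult_left_mono) auto
      moreover have "norm (X s * w s / s) = 2 * (\<bar>Re s\<bar> * exp (Re s * ln x)) / \<rho>^2"
        by (simp add: norm_mult norm_divide normX sn wn[OF sn] power2_eq_square)
      ultimately have 2: "norm (X s * w s / s) \<le> 2 / \<rho>^2" by simp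
      have "norm (G s) \<le> norm (A s * w s / s^2) + norm (X s * w s / s)"
        unfolding G_def by (rule norm_triangle_ineq4)
      also have "\<dots> \<le> 2 * (1 + ln x) / \<rho>^2 + 2 / \<rho>^2" using 1 2 by linarith
      also have "\<dots> = 2 * (2 + ln x) / \<rho>^2" by (simp add: add_divide_distrib[symmetric])
      finally show "norm (G s) \<le> 2 * (2 + ln x) / \<rho>^2" .
    qed (use Gi lnx rho0 in \<open>auto simp: a2_def\<close>)
    then show ?thesis using rho0 by (simp add: power2_eq_square mult_ac)
  qed
  \<comment> \<open>With the complete series in place of the partial sum the integrand becomes X w
    q. Since \<open>zetaF 1\<close> is 1, the singularity of q at 0 is removable, and no residue
    arises when the right half of the circle is moved to the left of 0.\<close>
  define q where "q s = (if s = 0 then deriv (\<lambda>s. 1 / zetaF (1 + s)) 0 else (1 / zetaF (1 + s) - 1 / zetaF (1 + 0)) / (s - 0))" for s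
  define G1 where "G1 s = X s * w s * q s" for s
  \<comment> \<open>The box reaches one unit above the circle, which is why L is log(rho + 5), and
    its left side lies at -2 delta, beyond the contour at -delta.\<close>
  define U where "U = box (Complex (- (c / L)) (- (\<rho> + 1))) (Complex (\<rho> + 1) (\<rho> + 1))"
  have Fnz: "zetaF (1 + s) \<noteq> 0 \<and> (\<bar>Re s\<bar> \<le> c / L \<longrightarrow> norm (1 / zetaF (1 + s)) \<le> C * L)"
    if "- (c / L) \<le> Re s" "\<bar>Im s\<bar> \<le> \<rho> + 1" for s
  proof (cases "\<bar>Re s\<bar> \<le> c / L")
    case True
    have l: "ln (\<bar>Im s\<bar> + 4) \<le> L" "ln (\<bar>Im s\<bar> + 4) > 0" using that rho0 by (auto simp: L_def)
    have "c / L \<le> c / ln (\<bar>Im s\<bar> + 4)" using l c L1 by (intro divide_left_mono mult_pos_pos) auto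
    then have "zetaF (1 + s) \<noteq> 0 \<and> norm (1 / zetaF (1 + s)) \<le> C * ln (\<bar>Im s\<bar> + 4)"
      using Z[of "1 + s"] True by simp
    moreover have "C * ln (\<bar>Im s\<bar> + 4) \<le> C * L" using l C by simp
    ultimately show ?thesis by linarith
  next
    case False
    then have "Re s > 0" using that by linarith
    then show ?thesis using zetaF_nonzero_right[of "1 + s"] False by simp
  qed
  have inU: "s \<in> U \<longleftrightarrow> - (c / L) < Re s \<and> Re s < \<rho> + 1 \<and> - (\<rho> + 1) < Im s \<and> Im s < \<rho> + 1" for s
    unfolding U_def by (auto simp: in_box_complex_iff)
  have qh: "q holomorphic_on U"
    unfolding q_def
  proof (rule pole_lemma_open)
    have "c / L \<le> c / 1" using c L1 by (intro divide_left_mono) auto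
    then have cl: "c / L < 1" using c by simp
    have "(\<lambda>s. zetaF (1 + s)) holomorphic_on U"
      by (rule holomorphic_on_compose_gen[OF _ zetaF_holomorphic, unfolded o_def])
         (use cl in \<open>auto intro!: holomorphic_intros simp: inU\<close>)
    then show "(\<lambda>s. 1 / zetaF (1 + s)) holomorphic_on U"
      using Fnz by (intro holomorphic_intros) (auto simp: inU)
  qed (unfold U_def, rule open_box)
  have G1h: "G1 holomorphic_on U" unfolding G1_def by (intro holomorphic_intros wh Xh qh)
  have arcU: "path_image a1 \<subseteq> U" "path_image a3 \<subseteq> U"
  proof -
    have "s \<in> U" if "s \<in> path_image a1 \<or> s \<in> path_image a3" for s
    proof -
      have "norm s = \<rho>" "Re s \<ge> 0" using arcs arcsR that by blast+
      moreover have "\<bar>Re s\<bar> \<le> norm s" "\<bar>Im s\<bar> \<le> norm s" by (rule abs_Re_le_cmod abs_Im_le_cmod)+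
      moreover have "c / L > 0" using c L1 by simp
      ultimately show ?thesis unfolding inU by linarith
    qed
    then show "path_image a1 \<subseteq> U" "path_image a3 \<subseteq> U" by blast+
  qed
  define z1 z2 z3 z4 where z: "z1 = Complex 0 \<rho>" "z2 = Complex (- \<delta>) \<rho>" "z3 = Complex (- \<delta>) (- \<rho>)" "z4 = Complex 0 (- \<rho>)"
  have segs: "closed_segment z1 z2 \<subseteq> cbox (Complex (- \<delta>) \<rho>) (Complex 0 \<rho>)"
     "closed_segment z2 z3 \<subseteq> cbox (Complex (- \<delta>) (- \<rho>)) (Complex (- \<delta>) \<rho>)"
     "closed_segment z3 z4 \<subseteq> cbox (Complex (- \<delta>) (- \<rho>)) (Complex 0 (- \<rho>))"
    by ((rule closed_segment_subset; use del rho0 in \<open>simp add: z in_cbox_complex_iff convex_box\<close>))+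
  have segsU: "closed_segment z1 z2 \<subseteq> U" "closed_segment z2 z3 \<subseteq> U" "closed_segment z3 z4 \<subseteq> U"
    using segs del rho0 by (auto simp: inU in_cbox_complex_iff subset_iff)
  have G1i: "G1 contour_integrable_on p" if "valid_path p" "path_image p \<subseteq> U" for p
    by (rule contour_integrable_holomorphic_simple[OF G1h _ that]) (unfold U_def, rule open_box)
  have va: "valid_path a1" "valid_path a3" by (simp_all add: a1_def a3_def)
  have ends: "pathstart a3 = z4" "pathfinish a3 = pathstart a1" "pathfinish a1 = z1"
  proof -
    have "cis (3 * pi / 2) = Complex 0 (-1)" "cis (pi / 2) = Complex 0 1" "cis (2 * pi) = 1" "cis 0 = 1"
      using cos_3over2_pi sin_3over2_pi by (simp_all add: complex_eq_iff)
    then show "pathstart a3 = z4" "pathfinish a3 = pathstart a1" "pathfinish a1 = z1"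
      unfolding a1_def a3_def z pathstart_part_circlepath pathfinish_part_circlepath cis_conv_exp[symmetric]
      by (simp_all add: complex_eq_iff)
  qed
  have cauchy: "contour_integral a3 G1 + contour_integral a1 G1 + contour_integral (linepath z1 z2) G1
     + contour_integral (linepath z2 z3) G1 + contour_integral (linepath z3 z4) G1 = 0"
  proof -
    define p where "p = a3 +++ (a1 +++ (linepath z1 z2 +++ (linepath z2 z3 +++ linepath z3 z4)))"
    have "(G1 has_contour_integral 0) p"
    proof (rule Cauchy_theorem_convex_simple[OF G1h])
      show "convex U" unfolding U_def by (rule convex_box)
      show "valid_path p" unfolding p_def using va ends by (intro valid_path_join) auto
      show "path_image p \<subseteq> U" unfolding p_def
        by (intro subset_path_image_join) (use arcU segsU in auto)
      show "pathfinish p = pathstart p" by (simp add: p_def ends)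
    qed
    then have "contour_integral p G1 = 0" by (rule contour_integral_unique)
    moreover have "contour_integral p G1 = contour_integral a3 G1 + (contour_integral a1 G1 + (contour_integral (linepath z1 z2) G1
     + (contour_integral (linepath z2 z3) G1 + contour_integral (linepath z3 z4) G1)))"
      unfolding p_def using va ends arcU segsU
      by (simp add: contour_integral_join contour_integrable_joinI valid_path_join G1i)
    ultimately show ?thesis by (simp add: add_ac)
  qed
  have G1b: "norm (G1 s) \<le> exp (Re s * ln x) * 3 * ((C * L + 1) / norm s)"
    if s: "- \<delta> \<le> Re s" "Re s \<le> 0" "\<bar>Im s\<bar> \<le> \<rho>" "s \<noteq> 0" for s
  proof -
    have r: "\<bar>Re s\<bar> \<le> \<delta>" using s by linarith
    have "norm s ^ 2 = Re s ^ 2 + Im s ^ 2" by (rule cmod_power2)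
    moreover have "Re s ^ 2 \<le> 1 ^ 2" using r del by (intro power2_le_iff_abs_le[THEN iffD2]) auto
    moreover have "Im s ^ 2 \<le> \<rho> ^ 2" using s rho0 by (intro power2_le_iff_abs_le[THEN iffD2]) auto
    moreover have "1 ^ 2 \<le> \<rho> ^ 2" using rho by (intro power_mono) auto
    ultimately have "norm s ^ 2 / \<rho>^2 \<le> 2" using rho0 by (simp add: field_simps)
    then have w3: "norm (w s) \<le> 3"
      unfolding w_def using norm_triangle_ineq[of 1 "s^2 / of_real \<rho>^2"] rho0 by (simp add: norm_divide norm_power)
    have F: "norm (1 / zetaF (1 + s)) \<le> C * L"
    proof -
      have "- (c / L) \<le> Re s" "\<bar>Im s\<bar> \<le> \<rho> + 1" "\<bar>Re s\<bar> \<le> c / L" using s r del by linarith+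
      then show ?thesis using Fnz by blast
    qed
    have "norm (q s) = norm (1 / zetaF (1 + s) - 1) / norm s"
      using s by (simp add: q_def norm_divide)
    also have "norm (1 / zetaF (1 + s) - 1) \<le> C * L + 1"
      using norm_triangle_ineq4[of "1 / zetaF (1 + s)" 1] F by simp
    finally have "norm (q s) \<le> (C * L + 1) / norm s" by (simp add: divide_right_mono)
    then show ?thesis unfolding G1_def norm_mult normX using w3 by (intro mult_mono) auto
  qed
  have CL: "C * L + 1 > 0" using C L1 by (simp add: add_pos_pos)
  have hb: "norm (contour_integral (linepath u v) G1) \<le> 3 * ((C * L + 1) / \<rho>)"
    if uv: "closed_segment u v \<subseteq> U" "norm (v - u) \<le> 1"
      "\<And>s. s \<in> closed_segment u v \<Longrightarrow> - \<delta> \<le> Re s \<and> Re s \<le> 0 \<and> \<bar>Im s\<bar> = \<rho>" for u v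
  proof -
    have "norm (contour_integral (linepath u v) G1) \<le> 3 * ((C * L + 1) / \<rho>) * norm (v - u)"
    proof (rule contour_integral_bound_linepath)
      show "G1 contour_integrable_on linepath u v" by (rule G1i) (use uv in auto)
      show "0 \<le> 3 * ((C * L + 1) / \<rho>)" using CL rho0 by simp
      fix s assume "s \<in> closed_segment u v"
      note s = uv(3)[OF this]
      then have n: "norm s \<ge> \<rho>" "s \<noteq> 0" using abs_Im_le_cmod[of s] rho0 by auto
      have "norm (G1 s) \<le> exp (Re s * ln x) * 3 * ((C * L + 1) / norm s)" using s n by (intro G1b) auto
      also have "\<dots> \<le> 1 * 3 * ((C * L + 1) / \<rho>)"
      proof (intro mult_mono)
        have "Re s * ln x \<le> 0" using s lnx by (simp add: mult_le_0_iff)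
        then show "exp (Re s * ln x) \<le> 1" by simp
        show "(C * L + 1) / norm s \<le> (C * L + 1) / \<rho>" using n CL rho0 by (intro divide_left_mono mult_pos_pos) auto
      qed (use CL in auto)
      finally show "norm (G1 s) \<le> 3 * ((C * L + 1) / \<rho>)" by simp
    qed
    also have "\<dots> \<le> 3 * ((C * L + 1) / \<rho>) * 1" using uv(2) CL rho0 by (intro mult_left_mono) auto
    finally show ?thesis by simp
  qed
  have zd: "z2 - z1 = of_real (- \<delta>)" "z4 - z3 = of_real \<delta>" "z3 - z2 = \<i> * of_real (- 2 * \<rho>)"
    by (simp_all add: z complex_eq_iff)
  have h1: "norm (contour_integral (linepath z1 z2) G1) \<le> 3 * ((C * L + 1) / \<rho>)"
    using segs(1) segsU(1) del rho0 by (intro hb) (auto simp: zd in_cbox_complex_iff subset_iff)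
  have h2: "norm (contour_integral (linepath z3 z4) G1) \<le> 3 * ((C * L + 1) / \<rho>)"
    using segs(3) segsU(3) del rho0 by (intro hb) (auto simp: zd in_cbox_complex_iff subset_iff)
  have h3: "norm (contour_integral (linepath z2 z3) G1) \<le> exp (- \<delta> * ln x) * 3 * ((C * L + 1) / \<delta>) * (2 * \<rho>)"
  proof -
    have "norm (contour_integral (linepath z2 z3) G1) \<le> exp (- \<delta> * ln x) * 3 * ((C * L + 1) / \<delta>) * norm (z3 - z2)"
    proof (rule contour_integral_bound_linepath)
      show "G1 contour_integrable_on linepath z2 z3" by (rule G1i) (use segsU in auto)
      show "0 \<le> exp (- \<delta> * ln x) * 3 * ((C * L + 1) / \<delta>)" using CL del by simp
      fix s assume "s \<in> closed_segment z2 z3"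
      then have s: "Re s = - \<delta>" "\<bar>Im s\<bar> \<le> \<rho>" using segs(2) by (auto simp: in_cbox_complex_iff subset_iff abs_le_iff)
      then have n: "norm s \<ge> \<delta>" "s \<noteq> 0" using abs_Re_le_cmod[of s] del by auto
      have "norm (G1 s) \<le> exp (Re s * ln x) * 3 * ((C * L + 1) / norm s)" using s n del by (intro G1b) auto
      also have "\<dots> \<le> exp (- \<delta> * ln x) * 3 * ((C * L + 1) / \<delta>)"
        unfolding s(1) using n CL del by (intro mult_left_mono divide_left_mono mult_pos_pos) auto
      finally show "norm (G1 s) \<le> exp (- \<delta> * ln x) * 3 * ((C * L + 1) / \<delta>)" .
    qed
    then show ?thesis using rho0 by (simp add: zd norm_mult)
  qed
  \<comment> \<open>the right arcs, where the partial sum is close to \<open>1 / \<zeta>(1 + s)\<close>\<close>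
  have G2: "norm (G s - G1 s) \<le> 4 / \<rho>^2" if "s \<in> path_image a1 \<or> s \<in> path_image a3" for s
  proof -
    have sn: "norm s = \<rho>" and sr: "Re s \<ge> 0" using arcs arcsR that by blast+
    have s0: "s \<noteq> 0" using sn rho0 by auto
    have e: "G s - G1 s = X s * w s * (Sx s - s / zetaF (1 + s)) / s^2"
      unfolding G_def G1_def A_def q_def using s0 by (simp add: field_simps power2_eq_square)
    show ?thesis
    proof (cases "Re s = 0")
      case True
      then have "w s = 0" using wn[OF sn] by simp
      then show ?thesis unfolding e by simp
    next
      case False
      then have sp: "Re s > 0" using sr by simp
      have T: "norm (Sx s - s / zetaF (1 + s)) \<le> x powr (- Re s) * (1 / x + 1 / Re s)"
        unfolding Sx_def by (rule moebius_tail_le[OF x1 sp])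
      have XX: "exp (Re s * ln x) * x powr (- Re s) = 1"
        using x1 by (simp add: powr_def mult_exp_exp)
      have "norm (G s - G1 s) = exp (Re s * ln x) * (2 * Re s / \<rho>) * norm (Sx s - s / zetaF (1 + s)) / \<rho>^2"
        unfolding e using sp by (simp add: norm_mult norm_divide norm_power normX sn wn[OF sn])
      also have "\<dots> \<le> exp (Re s * ln x) * (2 * Re s / \<rho>) * (x powr (- Re s) * (1 / x + 1 / Re s)) / \<rho>^2"
        using T sp rho0 by (intro divide_right_mono mult_left_mono) auto
      also have "\<dots> = (exp (Re s * ln x) * x powr (- Re s)) * ((2 * Re s / \<rho>) * (1 / x + 1 / Re s)) / \<rho>^2"
        by (simp only: mult_ac)
      also have "(2 * Re s / \<rho>) * (1 / x + 1 / Re s) = 2 / \<rho> * (Re s / x + 1)"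
        using sp by (simp add: distrib_left)
      also have "(exp (Re s * ln x) * x powr (- Re s)) * (2 / \<rho> * (Re s / x + 1)) / \<rho>^2
        = 2 / \<rho> * (Re s / x + 1) / \<rho>^2" unfolding XX by simp
      also have "\<dots> \<le> 2 / 1 * (1 + 1) / \<rho>^2"
      proof (intro divide_right_mono mult_mono add_mono divide_left_mono)
        have "Re s \<le> x" using complex_Re_le_cmod[of s] sn rho by simp
        then show "Re s / x \<le> 1" using x1 by simp
      qed (use rho sp x1 in auto)
      finally show ?thesis by simp
    qed
  qed
  have right: "norm (contour_integral p G - contour_integral p G1) \<le> 4 / \<rho>^2 * \<rho> * (pi / 2)"
    if p: "p = a1 \<or> p = a3" for p
  proof -
    have i: "G contour_integrable_on p" "G1 contour_integrable_on p" using p Gi G1i va arcU by auto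
    have "(\<lambda>s. G s - G1 s) contour_integrable_on p" using i by (rule contour_integrable_diff)
    moreover have "contour_integral p (\<lambda>s. G s - G1 s) = contour_integral p G - contour_integral p G1"
      using i by (rule contour_integral_diff)
    moreover have "norm (contour_integral (part_circlepath 0 \<rho> u v) (\<lambda>s. G s - G1 s)) \<le> 4 / \<rho>^2 * \<rho> * \<bar>v - u\<bar>"
      if "(\<lambda>s. G s - G1 s) contour_integrable_on (part_circlepath 0 \<rho> u v)" "p = part_circlepath 0 \<rho> u v" for u v
      by (rule contour_integral_bound_part_circlepath) (use that p G2 rho0 in auto)
    ultimately show ?thesis using p unfolding a1_def a3_def by force
  qed
  have "norm (2 * of_real pi * \<i> * (of_real (hsum x) - 1)) \<le>
     norm (contour_integral a3 G - contour_integral a3 G1) + norm (contour_integral a1 G - contour_integral a1 G1)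
     + norm (contour_integral (linepath z1 z2) G1) + norm (contour_integral (linepath z2 z3) G1)
     + norm (contour_integral (linepath z3 z4) G1) + norm (contour_integral a2 G)"
  proof -
    have e: "2 * of_real pi * \<i> * (of_real (hsum x) - 1) =
      (contour_integral a3 G - contour_integral a3 G1) + (contour_integral a1 G - contour_integral a1 G1)
      + (- contour_integral (linepath z1 z2) G1) + (- contour_integral (linepath z2 z3) G1)
      + (- contour_integral (linepath z3 z4) G1) + contour_integral a2 G"
      using cauchy unfolding main[symmetric] by (simp add: algebra_simps add_eq_0_iff)
    show ?thesis unfolding e
      by (intro order_trans[OF norm_triangle_ineq] add_mono order_refl) simp_all
  qed
  also have "\<dots> \<le> 4 / \<rho>^2 * \<rho> * (pi / 2) + 4 / \<rho>^2 * \<rho> * (pi / 2) + 3 * ((C * L + 1) / \<rho>)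
     + exp (- \<delta> * ln x) * 3 * ((C * L + 1) / \<delta>) * (2 * \<rho>) + 3 * ((C * L + 1) / \<rho>) + 2 * pi * (2 + ln x) / \<rho>"
    using right h1 h2 h3 left by (intro add_mono) auto
  \<comment> \<open>The two right arcs give 4 pi / rho and complete the 2 + ln x of the left arc to
    4 + ln x. The three segments come with the factor 6, which is then raised to 2 pi so that 2 pi
    can be cancelled.\<close>
  also have "\<dots> = 2 * pi * ((4 + ln x) / \<rho>) + 6 * ((C * L + 1) * (1 / \<rho> + \<rho> * exp (- \<delta> * ln x) / \<delta>))"
    using rho0 del by (simp add: field_simps power2_eq_square)
  also have "\<dots> \<le> 2 * pi * ((4 + ln x) / \<rho>) + 2 * pi * ((C * L + 1) * (1 / \<rho> + \<rho> * exp (- \<delta> * ln x) / \<delta>))"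
  proof (intro add_left_mono mult_right_mono)
    show "6 \<le> 2 * pi" using pi_gt3 by simp
    show "0 \<le> (C * L + 1) * (1 / \<rho> + \<rho> * exp (- \<delta> * ln x) / \<delta>)" using CL rho0 del by simp
  qed
  also have "\<dots> = 2 * pi * ((4 + ln x) / \<rho> + (C * L + 1) * (1 / \<rho> + \<rho> * exp (- \<delta> * ln x) / \<delta>))"
    by (simp only: distrib_left)
  finally have that: "norm (2 * of_real pi * \<i> * (of_real (hsum x) - 1)) \<le> 2 * pi * ((4 + ln x) / \<rho> + (C * L + 1) * (1 / \<rho> + \<rho> * exp (- \<delta> * ln x) / \<delta>))" .
  have "2 * pi * \<bar>hsum x - 1\<bar> \<le> 2 * pi * ((4 + ln x) / \<rho> + (C * L + 1) * (1 / \<rho> + \<rho> * exp (- \<delta> * ln x) / \<delta>))"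
  proof -
    have "norm (2 * of_real pi * \<i> * (of_real (hsum x) - 1)) = norm (2 * of_real pi * \<i> * of_real (hsum x - 1))"
      by simp
    also have "\<dots> = 2 * pi * \<bar>hsum x - 1\<bar>" unfolding norm_mult norm_of_real by simp
    finally show ?thesis using that by linarith
  qed
  then show ?thesis by simp
qed

text \<open>The maximum makes the factor 1 for x < 1, where the sums are empty and the main term is
  bounded trivially; inductions can then run over all positive x.\<close>

definition Edec :: "real \<Rightarrow> real \<Rightarrow> real" where
  "Edec c x = exp (- c * sqrt (max 0 (ln x)))"

theorem hsum_bound:
  "\<exists>c>0. \<exists>K\<ge>1. c \<le> 1/5 \<and> (\<forall>x\<ge>1. \<bar>hsum x - 1\<bar> \<le> K * Edec c x)"
proof -
  obtain c C where c: "c > 0" "c \<le> 1/4" and C: "C > 0"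
    and Z: "\<And>s. \<bar>Re s - 1\<bar> \<le> c / ln (\<bar>Im s\<bar> + 4) \<Longrightarrow> zetaF s \<noteq> 0 \<and> norm (1 / zetaF s) \<le> C * ln (\<bar>Im s\<bar> + 4)"
    using zetaF_zero_free by blast
  \<comment> \<open>With y = sqrt(ln x) and rho = exp(k y) one has L <= 2 k y, so delta ln x >= c y
    / (4 k). This equals 2 k y exactly when k^2 = c/8, and then rho x^(-delta) is at most
    1/rho.\<close>
  define k where "k = sqrt (c / 8)"
  have k: "k > 0" "k^2 = c / 8" using c by (auto simp: k_def)
  \<comment> \<open>All polynomial factors of the estimate as a function of y; half of the decay
    exp(-k y) absorbs them, so the final rate is at most k/2.\<close>
  define P where "P y = 4 + y^2 + (2 * C * k * y + 1) * (1 + 4 * k * y / c)" for y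
  have "((\<lambda>y. P y * exp (- (k / 2) * y)) \<longlongrightarrow> 0) at_top"
    unfolding P_def using k c C by real_asymp
  then have "\<forall>\<^sub>F y in at_top. P y * exp (- (k / 2) * y) < 1"
    by (rule order_tendstoD) simp
  then obtain Y where Y: "\<And>y. y \<ge> Y \<Longrightarrow> P y * exp (- (k / 2) * y) < 1"
    by (auto simp: eventually_at_top_linorder)
  \<comment> \<open>Besides Y: the entry 1 gives x >= e, k gives rho <= x, and 2/k gives rho >= e^2
    >= 5, hence rho + 5 <= rho^2.\<close>
  define Y0 where "Y0 = max Y (max 1 (max k (2 / k)))"
  define c' where "c' = min (k / 2) (1/5)"
  have c': "c' > 0" "c' \<le> 1/5" "c' \<le> k / 2" using k by (auto simp: c'_def)
  define X0 where "X0 = exp (Y0^2)"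
  have large: "\<bar>hsum x - 1\<bar> \<le> Edec c' x" if x: "x \<ge> X0" for x
  proof -
    define y where "y = sqrt (ln x)"
    have "1 \<le> exp (Y0^2)" by simp
    then have x0: "x \<ge> 1" "x > 0" using x unfolding X0_def by linarith+
    have lnx: "ln x \<ge> Y0^2" using x x0 unfolding X0_def by (simp add: ln_ge_iff)
    have Y01: "Y0 \<ge> 1" by (simp add: Y0_def)
    have yY: "y \<ge> Y0" unfolding y_def using lnx by (rule real_le_rsqrt)
    have y: "y \<ge> Y" "y \<ge> 1" "y \<ge> k" "y \<ge> 2 / k" using yY unfolding Y0_def by auto
    have y2: "ln x = y^2" using x0 by (simp add: y_def)
    define \<rho> where "\<rho> = exp (k * y)"
    have rho1: "\<rho> \<ge> 1" using k y by (simp add: \<rho>_def)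
    have rho5: "\<rho> \<ge> 5"
    proof -
      have "k * y \<ge> 2" using y(4) k by (simp add: field_simps)
      then have "exp (2::real) \<le> \<rho>" unfolding \<rho>_def by simp
      moreover have "exp (2::real) = exp 1 * exp 1" by (simp add: mult_exp_exp)
      moreover have "exp (1::real) \<ge> 5/2" using exp_lower_Taylor_quadratic[of 1] by simp
      then have "exp (1::real) * exp 1 \<ge> 5/2 * (5/2)" by (intro mult_mono) auto
      ultimately show ?thesis by linarith
    qed
    have rhox: "\<rho> \<le> x"
    proof -
      have "k * y \<le> y * y" using y by (intro mult_right_mono) auto
      then have "\<rho> \<le> exp (ln x)" unfolding \<rho>_def y2 by (simp add: power2_eq_square)
      then show ?thesis using x0 by simp
    qed
    define L where "L = ln (\<rho> + 5)"
    have L: "0 < L" "L \<le> 2 * k * y"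
    proof -
      show "0 < L" using rho1 by (simp add: L_def)
      have "\<rho> + 5 \<le> 2 * \<rho>" using rho5 by simp
      also have "\<dots> \<le> \<rho> * \<rho>" using rho5 by (intro mult_right_mono) auto
      finally have "L \<le> ln (\<rho> * \<rho>)" unfolding L_def using rho1 by (intro ln_mono) auto
      also have "\<dots> = 2 * k * y" unfolding \<rho>_def by (simp add: mult_exp_exp)
      finally show "L \<le> 2 * k * y" .
    qed
    define \<delta> where "\<delta> = c / (2 * L)"
    have d: "\<delta> > 0" "\<delta> * ln x \<ge> 2 * k * y" "1 / \<delta> \<le> 4 * k * y / c"
    proof -
      show "\<delta> > 0" using c L by (simp add: \<delta>_def)
      have ky: "k * y > 0" using k y by simp
      have "2 * k * y = c / (2 * (2 * k * y)) * y^2"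
        using k y c by (simp add: field_simps power2_eq_square)
      also have "\<dots> \<le> \<delta> * y^2"
        unfolding \<delta>_def using L c ky by (intro mult_right_mono divide_left_mono) (auto simp: mult_ac)
      finally show "\<delta> * ln x \<ge> 2 * k * y" by (simp add: y2)
      show "1 / \<delta> \<le> 4 * k * y / c" unfolding \<delta>_def using L c by (simp add: divide_right_mono)
    qed
    have xe: "x \<ge> exp 1"
    proof -
      have "1 \<le> Y0^2" using Y01 by simp
      then show ?thesis using x unfolding X0_def by (metis exp_le_cancel_iff order_trans)
    qed
    have "\<bar>hsum x - 1\<bar> \<le> (4 + ln x) / \<rho> + (C * L + 1) * (1 / \<rho> + \<rho> * exp (- \<delta> * ln x) / \<delta>)"
      using Newman_estimate[OF c C Z xe rho1 rhox] unfolding L_def \<delta>_def by blast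
    also have "\<dots> \<le> (4 + y^2) * exp (- (k * y)) + (2 * C * k * y + 1) * (exp (- (k * y)) + exp (- (k * y)) * (4 * k * y / c))"
    proof -
      have 1: "(4 + ln x) / \<rho> \<le> (4 + y^2) * exp (- (k * y))"
        by (simp add: y2 \<rho>_def exp_minus field_simps)
      have 2: "C * L + 1 \<le> 2 * C * k * y + 1" using L C mult_left_mono[of L "2 * k * y" C] by (simp add: mult_ac)
      have 3: "1 / \<rho> \<le> exp (- (k * y))" by (simp add: \<rho>_def exp_minus field_simps)
      have "\<rho> * exp (- \<delta> * ln x) \<le> exp (k * y) * exp (- (2 * k * y))"
        unfolding \<rho>_def using d by (intro mult_left_mono) auto
      also have "\<dots> = exp (- (k * y))" by (simp add: mult_exp_exp)
      finally have "\<rho> * exp (- \<delta> * ln x) * (1 / \<delta>) \<le> exp (- (k * y)) * (4 * k * y / c)"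
        using d by (intro mult_mono) auto
      then have 4: "\<rho> * exp (- \<delta> * ln x) / \<delta> \<le> exp (- (k * y)) * (4 * k * y / c)" by simp
      have 5: "(C * L + 1) * (1 / \<rho> + \<rho> * exp (- \<delta> * ln x) / \<delta>)
         \<le> (2 * C * k * y + 1) * (exp (- (k * y)) + exp (- (k * y)) * (4 * k * y / c))"
      proof (rule mult_mono[OF 2 add_mono[OF 3 4]])
        show "0 \<le> 2 * C * k * y + 1" using C k y by simp
        show "0 \<le> 1 / \<rho> + \<rho> * exp (- \<delta> * ln x) / \<delta>" using rho1 d by simp
      qed
      show ?thesis by (rule add_mono[OF 1 5])
    qed
    also have "\<dots> = (4 + y^2 + (2 * C * k * y + 1) * (1 + 4 * k * y / c)) * exp (- (k * y))"
    proof -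
      have "a * E + S * (E + E * T) = (a + S * (1 + T)) * E" for a E S T :: real
        by (simp add: algebra_simps)
      then show ?thesis .
    qed
    also have "\<dots> = P y * exp (- (k / 2) * y) * exp (- (k / 2) * y)"
    proof -
      have "exp (- (k / 2) * y) * exp (- (k / 2) * y) = exp (- (k * y))" by (simp add: mult_exp_exp)
      then have "P y * exp (- (k / 2) * y) * exp (- (k / 2) * y) = P y * exp (- (k * y))" by (simp add: mult.assoc)
      then show ?thesis unfolding P_def by (rule sym)
    qed
    also have "\<dots> \<le> 1 * exp (- (k / 2) * y)"
      using Y[OF y(1)] by (intro mult_right_mono) auto
    also have "\<dots> \<le> Edec c' x"
    proof -
      have "c' * y \<le> (k / 2) * y" using c' y by (intro mult_right_mono) auto
      then show ?thesis unfolding Edec_def using x0 by (simp add: y_def)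
    qed
    finally show ?thesis .
  qed
  \<comment> \<open>On the bounded range x < X0 a trivial bound for \<open>hsum x - 1\<close> is
    divided by exp(-Y0), a lower bound for the decay factor there.\<close>
  define K where "K = (2 + (1 + ln X0) * ln X0) * exp Y0"
  have X01: "X0 \<ge> 1" unfolding X0_def by simp
  have Y01: "Y0 \<ge> 1" by (simp add: Y0_def)
  have small: "\<bar>hsum x - 1\<bar> \<le> K * Edec c' x" if x: "1 \<le> x" "x < X0" for x
  proof -
    have lx: "0 \<le> ln x" "ln x \<le> ln X0" using x by auto
    have "\<bar>hsum x\<bar> \<le> (\<Sum>d\<in>nle x. \<bar>moebius d / real d * ln (x / real d)\<bar>)"
      unfolding hsum_def by (rule sum_abs)
    also have "\<dots> \<le> (\<Sum>d\<in>nle x. 1 / real d * ln X0)"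
    proof (rule sum_mono)
      fix d assume "d \<in> nle x"
      then have d: "d \<ge> 1" "real d \<le> x" by (auto simp: nle_def)
      have 1: "\<bar>moebius d / real d\<bar> \<le> 1 / real d"
        using abs_moebius_le[of d] by (simp add: abs_divide divide_right_mono)
      have "x / real d \<le> X0 / 1" using d x by (intro frac_le) auto
      then have "\<bar>ln (x / real d)\<bar> \<le> ln X0" using d x by (simp add: ln_ge_zero)
      then show "\<bar>moebius d / real d * ln (x / real d)\<bar> \<le> 1 / real d * ln X0"
        unfolding abs_mult using 1 by (intro mult_mono) auto
    qed
    also have "\<dots> = (\<Sum>d\<in>nle x. 1 / real d) * ln X0" by (rule sum_distrib_right[symmetric])
    also have "\<dots> \<le> (1 + ln X0) * ln X0"
      using sum_inverse_nle_le[OF x(1)] lx X01 by (intro mult_right_mono) auto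
    finally have h: "\<bar>hsum x - 1\<bar> \<le> 2 + (1 + ln X0) * ln X0" by linarith
    have "sqrt (ln x) \<le> sqrt (Y0^2)" using lx unfolding X0_def by (intro real_sqrt_le_mono) simp
    then have s: "sqrt (ln x) \<le> Y0" using Y01 by simp
    have "c' * sqrt (ln x) \<le> 1 * Y0" using s c' lx by (intro mult_mono) auto
    then have "exp (- Y0) \<le> Edec c' x" unfolding Edec_def using lx by simp
    then have "1 \<le> exp Y0 * Edec c' x"
      using mult_left_mono[of "exp (- Y0)" "Edec c' x" "exp Y0"] by (simp add: mult_exp_exp)
    then have "(2 + (1 + ln X0) * ln X0) * 1 \<le> (2 + (1 + ln X0) * ln X0) * (exp Y0 * Edec c' x)"
      using X01 by (intro mult_left_mono) auto
    then show ?thesis using h by (simp add: K_def mult.assoc)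
  qed
  have K1: "K \<ge> 1"
  proof -
    have "(1 + ln X0) * ln X0 \<ge> 0" using X01 by simp
    then have "1 * 1 \<le> K" unfolding K_def using Y01 by (intro mult_mono) auto
    then show ?thesis by simp
  qed
  have "\<bar>hsum x - 1\<bar> \<le> K * Edec c' x" if "x \<ge> 1" for x
  proof (cases "x < X0")
    case False
    then have "\<bar>hsum x - 1\<bar> \<le> 1 * Edec c' x" using large by simp
    also have "\<dots> \<le> K * Edec c' x" using K1 by (intro mult_right_mono) (auto simp: Edec_def)
    finally show ?thesis .
  qed (use small that in auto)
  then show ?thesis using c' K1 by blast
qed

section \<open>Coprimality conditions and divisor sums\<close>

text \<open>B is a set of excluded primes. The weight f is 1/d, or later the product of the primes
  in A dividing d, over d, which on the squarefree d prime to B stands for gcd(D, d)/d.\<close>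

definition moebius_log_sum :: "(nat \<Rightarrow> real) \<Rightarrow> nat set \<Rightarrow> real \<Rightarrow> real" where
  "moebius_log_sum f B x = (\<Sum>d | d \<in> nle x \<and> (\<forall>q\<in>B. \<not> q dvd d). moebius d * f d * ln (x / real d))"

text \<open>The terms with p dividing d are those with d = p e, where mu(p e) is -mu(e) if p does
  not divide e and 0 otherwise.\<close>

lemma moebius_log_sum_remove_prime:
  assumes p: "prime p" "p \<notin> B" and B: "\<And>q. q \<in> B \<Longrightarrow> prime q"
    and f: "\<And>e. \<not> p dvd e \<Longrightarrow> f (p * e) = a * f e"
  shows "moebius_log_sum f B x = moebius_log_sum f (insert p B) x - a * moebius_log_sum f (insert p B) (x / real p)"
proof -
  define g where "g d = moebius d * f d * ln (x / real d)" for d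
  define S where "S = {d. d \<in> nle x \<and> (\<forall>q\<in>B. \<not> q dvd d)}"
  define T where "T = {d. d \<in> nle (x / real p) \<and> (\<forall>q\<in>B. \<not> q dvd d)}"
  have p0: "p > 0" using p(1) by (simp add: prime_gt_0_nat)
  have fin: "finite S" "finite T" by (auto simp: S_def T_def)
  have qp: "q dvd p * e \<longleftrightarrow> q dvd e" if "q \<in> B" for q e
    using B[OF that] p that by (metis prime_dvd_mult_iff primes_dvd_imp_eq)
  have "S = {d\<in>S. \<not> p dvd d} \<union> {d\<in>S. p dvd d}" by auto
  then have "sum g S = sum g {d\<in>S. \<not> p dvd d} + sum g {d\<in>S. p dvd d}"
    using fin(1) by (metis (no_types, lifting) Collect_disj_eq disjoint_iff finite_Un mem_Collect_eq sum.union_disjoint)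
  also have "{d\<in>S. \<not> p dvd d} = {d. d \<in> nle x \<and> (\<forall>q\<in>insert p B. \<not> q dvd d)}"
    by (auto simp: S_def)
  also have "sum g {d\<in>S. p dvd d} = (\<Sum>e\<in>T. g (p * e))"
  proof (rule sum.reindex_bij_witness[of _ "\<lambda>e. p * e" "\<lambda>d. d div p"])
    fix d assume "d \<in> {d\<in>S. p dvd d}"
    then obtain e where e: "d = p * e" "p * e \<in> S" by (auto elim: dvdE)
    show "p * (d div p) = d" using e p0 by simp
    have "e \<in> T" using e p0 qp by (auto simp: S_def T_def nle_def field_simps Suc_le_eq)
    then show "d div p \<in> T" using e p0 by simp
  next
    fix e assume "e \<in> T"
    then have "p * e \<in> S" using p0 qp by (auto simp: S_def T_def nle_def field_simps Suc_le_eq)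
    then show "p * e \<in> {d\<in>S. p dvd d}" by simp
    show "p * e div p = e" using p0 by simp
  qed (use p0 in auto)
  also have "\<dots> = (\<Sum>e | e \<in> nle (x / real p) \<and> (\<forall>q\<in>insert p B. \<not> q dvd e). g (p * e))"
    by (rule sum.mono_neutral_right)
       (auto simp: T_def g_def moebius_mult_prime_dvd[OF p(1)])
  also have "\<dots> = (\<Sum>e | e \<in> nle (x / real p) \<and> (\<forall>q\<in>insert p B. \<not> q dvd e). - (a * (moebius e * f e * ln (x / real p / real e))))"
    by (rule sum.cong) (auto simp: g_def moebius_mult_prime[OF p(1)] f)
  finally show ?thesis
    by (simp add: moebius_log_sum_def g_def S_def sum_negf sum_distrib_left)
qed

lemma moebius_log_sum_cong:
  assumes "\<And>d. d > 0 \<Longrightarrow> (\<forall>q\<in>B. \<not> q dvd d) \<Longrightarrow> f d = g d"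
  shows "moebius_log_sum f B x = moebius_log_sum g B x"
  unfolding moebius_log_sum_def by (rule sum.cong) (auto simp: nle_def assms)

lemma Edec_pos: "Edec c x > 0"
  by (simp add: Edec_def)

lemma Edec_antimono:
  assumes "0 < x" "x \<le> y" "c \<ge> 0"
  shows "Edec c y \<le> Edec c x"
proof -
  have "ln x \<le> ln y" using assms by simp
  then have "sqrt (max 0 (ln x)) \<le> sqrt (max 0 (ln y))" by (intro real_sqrt_le_mono) auto
  then show ?thesis using assms(3) by (simp add: Edec_def mult_left_mono)
qed

text \<open>The square root is subadditive, so x/p costs a factor exp(c sqrt(log p)), and c <= 1/5
  makes this at most 3p/4 already for p = 2. After the division by p in the recursion a fraction 3/4
  is left, strictly less than 1.\<close>

lemma Edec_divide_prime:
  assumes x: "x > 0" and c: "0 < c" "c \<le> 1/5" and p: "p \<ge> (2 :: real)"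
  shows "Edec c (x / p) \<le> 3/4 * p * Edec c x"
proof -
  define t where "t = ln p"
  have t: "t \<ge> 2/3" unfolding t_def using ln2_ge_two_thirds p by (meson ln_mono order_trans zero_less_numeral)
  have "sqrt (max 0 (ln x)) \<le> sqrt (max 0 (ln (x / p)) + t)"
    using x p t by (intro real_sqrt_le_mono) (auto simp: ln_div t_def)
  also have "\<dots> \<le> sqrt (max 0 (ln (x / p))) + sqrt t"
    using t by (intro sqrt_add_le_add_sqrt) auto
  finally have 1: "c * sqrt (max 0 (ln x)) \<le> c * sqrt (max 0 (ln (x / p))) + c * sqrt t"
    using c by (simp add: distrib_left[symmetric])
  have 2: "c * sqrt t \<le> t - ln (4/3)"
  proof -
    have "0 \<le> (sqrt t - 1)^2" by simp
    then have "sqrt t \<le> (1 + t) / 2" using t by (simp add: power2_diff)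
    then have "c * sqrt t \<le> 1/5 * ((1 + t) / 2)" using c t by (intro mult_mono) auto
    also have "\<dots> = 1/10 + t/10" by simp
    finally have "c * sqrt t \<le> 1/10 + t/10" .
    moreover have "ln (4/3 :: real) \<le> 1/3" using ln_le_minus_one[of "4/3::real"] by simp
    ultimately show ?thesis using t by argo
  qed
  have "Edec c (x / p) \<le> exp (t - ln (4/3) + (- c * sqrt (max 0 (ln x))))"
    unfolding Edec_def using 1 2 by simp
  also have "\<dots> = 3/4 * p * Edec c x"
    using p unfolding exp_add exp_diff Edec_def t_def by simp
  finally show ?thesis .
qed

lemma prod_prime_ratio_le:
  assumes "finite S" "\<And>p. p \<in> S \<Longrightarrow> prime p"
  shows "0 \<le> (\<Prod>p\<in>S. real p / (real p - 1))" "(\<Prod>p\<in>S. real p / (real p - 1)) \<le> 2 ^ card S"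
proof -
  have p: "0 \<le> real p / (real p - 1) \<and> real p / (real p - 1) \<le> 2" if "p \<in> S" for p
  proof -
    have "real p \<ge> 2" using assms(2)[OF that] prime_ge_2_nat by fastforce
    then show ?thesis by (simp add: field_simps)
  qed
  show "0 \<le> (\<Prod>p\<in>S. real p / (real p - 1))" using p by (intro prod_nonneg) auto
  have "(\<Prod>p\<in>S. real p / (real p - 1)) \<le> (\<Prod>p\<in>S. 2)" using p by (intro prod_mono) auto
  then show "(\<Prod>p\<in>S. real p / (real p - 1)) \<le> 2 ^ card S" by simp
qed

lemma nle_empty: "x < 1 \<Longrightarrow> nle x = {}"
  by (auto simp: nle_def)

text \<open>Carries the estimate for \<open>hsum\<close> with its constants fixed, so that the later
  bounds are explicit in the same c and K; it is interpreted once, in the final proof.\<close>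

locale pnt_error =
  fixes c K :: real
  assumes c: "0 < c" "c \<le> 1/5" and K: "K \<ge> 1"
    and hsum: "\<And>x. x \<ge> 1 \<Longrightarrow> \<bar>hsum x - 1\<bar> \<le> K * Edec c x"
begin

text \<open>Excluding one more prime p gives the recursion F(y) = F_old(y) + F(y/p)/p, whose limit
  acquires the Euler factor p/(p - 1). With 4 as the cost of a prime the errors add up as 1/4 + 3/4
  = 1, so the induction closes exactly.\<close>

lemma coprime_moebius_log_sum:
  assumes "finite S" "\<And>p. p \<in> S \<Longrightarrow> prime p" "x > 0"
  shows "\<bar>moebius_log_sum (\<lambda>d. 1 / real d) S x - (\<Prod>p\<in>S. real p / (real p - 1))\<bar> \<le> K * 4 ^ card S * Edec c x"
  using assms
proof (induction S arbitrary: x rule: finite_induct)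
  case empty
  show ?case
  proof (cases "x \<ge> 1")
    case True
    then show ?thesis using hsum[OF True] by (simp add: moebius_log_sum_def hsum_def)
  next
    case False
    then show ?thesis using K empty by (simp add: moebius_log_sum_def nle_empty Edec_def)
  qed
next
  case (insert p S)
  let ?f = "\<lambda>d. 1 / real d"
  define T where "T = (\<Prod>p\<in>S. real p / (real p - 1))"
  define T' where "T' = (\<Prod>p\<in>insert p S. real p / (real p - 1))"
  have pp: "prime p" "real p \<ge> 2" using insert.prems(1)[of p] prime_ge_2_nat[of p] by auto
  \<comment> \<open>The main terms satisfy the same recursion as the sums, hence so do the
    errors.\<close>
  have TT: "T' = T + T' / real p"
    unfolding T'_def T_def using insert.hyps pp by (simp add: field_simps)
  have card: "card (insert p S) = Suc (card S)" using insert.hyps by simp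
  have small: "\<bar>moebius_log_sum ?f (insert p S) y - T'\<bar> \<le> K * 4 ^ card (insert p S) * Edec c y" if y: "0 < y" "y < 1" for y
  proof -
    have "T' \<le> 2 ^ card (insert p S)" "0 \<le> T'" unfolding T'_def
      using prod_prime_ratio_le[of "insert p S"] insert by auto
    moreover have "(2::real) ^ card (insert p S) \<le> 1 * 4 ^ card (insert p S)" by (simp add: power_mono)
    moreover have "1 * 4 ^ card (insert p S) \<le> K * 4 ^ card (insert p S)" using K by (intro mult_right_mono) auto
    moreover have "Edec c y = 1" using y by (simp add: Edec_def)
    ultimately have "\<bar>0 - T'\<bar> \<le> K * 4 ^ card (insert p S) * Edec c y"
      unfolding \<open>Edec c y = 1\<close> by linarith
    then show ?thesis using y by (simp add: moebius_log_sum_def nle_empty)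
  qed
  \<comment> \<open>Induction on the dyadic size of y, since y/p <= y/2; for y < 1 the sum is empty
    and the bound is trivial.\<close>
  have "\<bar>moebius_log_sum ?f (insert p S) y - T'\<bar> \<le> K * 4 ^ card (insert p S) * Edec c y"
    if "0 < y" "y < 2 ^ n" for y n
    using that
  proof (induction n arbitrary: y)
    case 0
    then show ?case using small by simp
  next
    case (Suc n)
    show ?case
    proof (cases "y < 1")
      case True
      then show ?thesis using small Suc by simp
    next
      case False
      have yp: "0 < y / real p" "y / real p < 2 ^ n"
      proof -
        show "0 < y / real p" using Suc pp by simp
        have "y / real p \<le> y / 2" using Suc pp by (intro divide_left_mono) auto
        also have "y / 2 < 2 ^ n" using Suc.prems by simp
        finally show "y / real p < 2 ^ n" .
      qed
      have rec: "moebius_log_sum ?f S y = moebius_log_sum ?f (insert p S) y - 1 / real p * moebius_log_sum ?f (insert p S) (y / real p)"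
        by (rule moebius_log_sum_remove_prime) (use insert pp in auto)
      have "\<bar>moebius_log_sum ?f (insert p S) y - T'\<bar>
         = \<bar>(moebius_log_sum ?f S y - T) + (moebius_log_sum ?f (insert p S) (y / real p) - T') / real p\<bar>"
        using rec TT by (simp add: diff_divide_distrib)
      also have "\<dots> \<le> \<bar>moebius_log_sum ?f S y - T\<bar> + \<bar>moebius_log_sum ?f (insert p S) (y / real p) - T'\<bar> / real p"
        using abs_triangle_ineq[of "moebius_log_sum ?f S y - T" "(moebius_log_sum ?f (insert p S) (y / real p) - T') / real p"]
        by simp
      also have "\<dots> \<le> K * 4 ^ card S * Edec c y + K * 4 ^ card (insert p S) * Edec c (y / real p) / real p"
        using insert.IH[of y] insert.prems(1) Suc.prems Suc.IH[OF yp] pp unfolding T_def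
        by (intro add_mono divide_right_mono) auto
      also have "\<dots> \<le> K * 4 ^ card S * Edec c y + K * 4 ^ card (insert p S) * (3/4 * Edec c y)"
      proof -
        have "Edec c (y / real p) / real p \<le> 3/4 * real p * Edec c y / real p"
          using Edec_divide_prime[OF Suc.prems(1) c pp(2)] by (intro divide_right_mono) auto
        also have "\<dots> = 3/4 * Edec c y" using pp by simp
        finally have "K * 4 ^ card (insert p S) * (Edec c (y / real p) / real p) \<le> K * 4 ^ card (insert p S) * (3/4 * Edec c y)"
          using K by (intro mult_left_mono) auto
        then show ?thesis by simp
      qed
      finally show ?thesis by (simp add: card algebra_simps)
    qed
  qed
  moreover obtain n where "x < 2 ^ n" using real_arch_pow[of 2 x] by auto
  ultimately show ?case using insert.prems unfolding T'_def by blast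
qed

text \<open>For p in A the weight of p e equals that of e, without the factor 1/p, so the sum is a
  difference of one function at x and at x/p. The main terms cancel as soon as A is nonempty. Each
  such prime doubles the error and joins B, which gives the cost 8 = 2 * 4, and the arguments go
  down to x divided by the product of A.\<close>

lemma mixed_moebius_log_sum:
  assumes "finite A" "finite B" "A \<inter> B = {}" "\<And>p. p \<in> A \<union> B \<Longrightarrow> prime p" "x > 0"
  shows "\<bar>moebius_log_sum (\<lambda>d. real (\<Prod>p | p \<in> A \<and> p dvd d. p) / real d) B x
      - (if A = {} then \<Prod>p\<in>B. real p / (real p - 1) else 0)\<bar>
    \<le> K * 8 ^ card A * 4 ^ card B * Edec c (x / real (\<Prod>A))"
  using assms
proof (induction A arbitrary: B x rule: finite_induct)
  case empty
  then show ?case using coprime_moebius_log_sum[of B x] by simp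
next
  case (insert p A)
  let ?w = "\<lambda>A d. real (\<Prod>p | p \<in> A \<and> p dvd d. p) / real d"
  define Mn where "Mn = (if A = {} then \<Prod>p\<in>insert p B. real p / (real p - 1) else 0)"
  have pp: "prime p" "p > 0" using insert.prems(3)[of p] prime_gt_0_nat[of p] by auto
  have pB: "p \<notin> B" using insert.prems by auto
  have fin: "finite {q. q \<in> A \<and> P q}" for P using insert.hyps by simp
  have w1: "?w (insert p A) d = ?w A d" if "\<not> p dvd d" for d
    using that by (metis (no_types, lifting) insert_iff)
  have w2: "?w (insert p A) (p * e) = 1 * ?w (insert p A) e" if "\<not> p dvd e" for e
  proof -
    have q: "q dvd p * e \<longleftrightarrow> q dvd e" if "q \<in> A" for q
      using insert.prems(3)[of q] insert.hyps pp that by (metis UnI1 insertI2 prime_dvd_mult_iff primes_dvd_imp_eq)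
    have "{q. q \<in> insert p A \<and> q dvd p * e} = insert p {q. q \<in> A \<and> q dvd e}" using q by auto
    then have "(\<Prod>q | q \<in> insert p A \<and> q dvd p * e. q) = p * (\<Prod>q | q \<in> A \<and> q dvd e. q)"
      using insert.hyps fin by (simp add: prod.insert)
    then show ?thesis using w1[OF that] pp by (cases "e = 0") auto
  qed
  have rec: "moebius_log_sum (?w (insert p A)) B x = moebius_log_sum (?w (insert p A)) (insert p B) x - 1 * moebius_log_sum (?w (insert p A)) (insert p B) (x / real p)"
    by (rule moebius_log_sum_remove_prime) (use insert.prems pp pB w2 in auto)
  have e: "moebius_log_sum (?w (insert p A)) (insert p B) y = moebius_log_sum (?w A) (insert p B) y" for y
    by (rule moebius_log_sum_cong) (use w1 in auto)
  have IH: "\<bar>moebius_log_sum (?w A) (insert p B) y - Mn\<bar> \<le> K * 8 ^ card A * 4 ^ card (insert p B) * Edec c (y / real (\<Prod>A))" if "y > 0" for y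
    unfolding Mn_def by (rule insert.IH) (use insert that in auto)
  have PA: "real (\<Prod>A) \<ge> 1" "real (\<Prod>A) > 0"
  proof -
    have "\<Prod>A > 0" using insert.prems(3) by (intro prod_pos) (auto simp: prime_gt_0_nat)
    then show "real (\<Prod>A) \<ge> 1" "real (\<Prod>A) > 0" by linarith+
  qed
  have Pp: "x / real p / real (\<Prod>A) = x / real (\<Prod>(insert p A))" using insert.hyps by simp
  have p1: "real p \<ge> 1" using pp by simp
  have mono: "Edec c (x / real (\<Prod>A)) \<le> Edec c (x / real p / real (\<Prod>A))"
  proof (rule Edec_antimono)
    show "0 < x / real p / real (\<Prod>A)" using insert.prems pp PA by simp
    have "x / real p \<le> x / 1" using insert.prems p1 by (intro divide_left_mono) auto
    then show "x / real p / real (\<Prod>A) \<le> x / real (\<Prod>A)" using PA by (intro divide_right_mono) auto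
  qed (use c in auto)
  have "\<bar>moebius_log_sum (?w (insert p A)) B x\<bar> = \<bar>(moebius_log_sum (?w A) (insert p B) x - Mn) - (moebius_log_sum (?w A) (insert p B) (x / real p) - Mn)\<bar>"
    using rec e by simp
  also have "\<dots> \<le> K * 8 ^ card A * 4 ^ card (insert p B) * Edec c (x / real (\<Prod>A)) + K * 8 ^ card A * 4 ^ card (insert p B) * Edec c (x / real p / real (\<Prod>A))"
  proof (rule order_trans[OF abs_triangle_ineq4 add_mono])
    show "\<bar>moebius_log_sum (?w A) (insert p B) x - Mn\<bar> \<le> K * 8 ^ card A * 4 ^ card (insert p B) * Edec c (x / real (\<Prod>A))"
      by (rule IH) (use insert.prems in simp)
    show "\<bar>moebius_log_sum (?w A) (insert p B) (x / real p) - Mn\<bar> \<le> K * 8 ^ card A * 4 ^ card (insert p B) * Edec c (x / real p / real (\<Prod>A))"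
      by (rule IH) (use insert.prems pp in simp)
  qed
  also have "\<dots> \<le> K * 8 ^ card A * 4 ^ card (insert p B) * Edec c (x / real p / real (\<Prod>A)) + K * 8 ^ card A * 4 ^ card (insert p B) * Edec c (x / real p / real (\<Prod>A))"
    using mono K by (intro add_mono mult_left_mono) auto
  also have "\<dots> = K * 8 ^ card (insert p A) * 4 ^ card B * Edec c (x / real (\<Prod>(insert p A)))"
    unfolding Pp using insert.hyps insert.prems pB by simp
  finally show ?case by simp
qed

end

section \<open>The divisor function and its moments\<close>

definition tau :: "nat \<Rightarrow> nat" where
  "tau n = card {d. d dvd n}"

lemma tau_pos: "n > 0 \<Longrightarrow> tau n \<ge> 1"
  unfolding tau_def by (metis One_nat_def Suc_leI card_gt_0_iff dvd_refl empty_iff finite_divisors_nat mem_Collect_eq)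

lemma tau_mult_le:
  assumes "a > 0" "b > 0"
  shows "tau (a * b) \<le> tau a * tau b"
proof -
  have "{d. d dvd a * b} \<subseteq> (\<lambda>(u, v). u * v) ` ({d. d dvd a} \<times> {d. d dvd b})"
  proof
    fix d assume "d \<in> {d. d dvd a * b}"
    then obtain u v where "d = u * v" "u dvd a" "v dvd b" by (auto dest: division_decomp)
    then show "d \<in> (\<lambda>(u, v). u * v) ` ({d. d dvd a} \<times> {d. d dvd b})" by force
  qed
  moreover have f: "finite ({d. d dvd a} \<times> {d. d dvd b})" using assms by simp
  ultimately have "card {d. d dvd a * b} \<le> card ({d. d dvd a} \<times> {d. d dvd b})"
    by (meson card_image_le card_mono finite_imageI order_trans)
  then show ?thesis by (simp add: tau_def card_cartesian_product)
qed

text \<open>One factor tau(q) counts the factorizations q = d e, and tau is submultiplicative. So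
  the sum for m + 1 is at most the square of the sum for m, and the exponent doubles at each
  step.\<close>

lemma sum_tau_power_le:
  assumes x: "x \<ge> 1"
  shows "(\<Sum>q\<in>nle x. real (tau q) ^ m / real q) \<le> (1 + ln x) ^ (2 ^ m)"
proof (induction m)
  case 0
  then show ?case using sum_inverse_nle_le[OF x] by simp
next
  case (Suc m)
  define g where "g q = real (tau q) ^ m / real q" for q
  have g0: "g q \<ge> 0" for q by (simp add: g_def)
  have "(\<Sum>q\<in>nle x. real (tau q) ^ Suc m / real q) = (\<Sum>q\<in>nle x. \<Sum>d | d dvd q. g q)"
    by (simp add: g_def tau_def)
  also have "\<dots> = (\<Sum>(q, d)\<in>Sigma (nle x) (\<lambda>q. {d. d dvd q}). g q)"
    by (rule sum.Sigma[OF finite_nle]) (auto simp: nle_def)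
  also have "\<dots> \<le> (\<Sum>(a, b)\<in>nle x \<times> nle x. g a * g b)"
  proof (rule sum_le_included[where i = "\<lambda>(a, b). (a * b, a)"])
    show "finite (Sigma (nle x) (\<lambda>q. {d. d dvd q}))" by (rule finite_SigmaI[OF finite_nle]) (auto simp: nle_def)
    show "\<forall>s\<in>Sigma (nle x) (\<lambda>q. {d. d dvd q}). \<exists>t\<in>nle x \<times> nle x. (case t of (a, b) \<Rightarrow> (a * b, a)) = s \<and>
       (case s of (q, d) \<Rightarrow> g q) \<le> (case t of (a, b) \<Rightarrow> g a * g b)"
    proof
      fix s assume "s \<in> Sigma (nle x) (\<lambda>q. {d. d dvd q})"
      then obtain q d where s: "s = (q, d)" "q \<in> nle x" "d dvd q" by auto
      define e where "e = q div d"
      have q: "q \<ge> 1" "real q \<le> x" using s by (auto simp: nle_def)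
      have de: "d * e = q" "d \<ge> 1" "e \<ge> 1" using dvd_div_ge_1[OF q(1) s(3)] by (auto simp: e_def)
      have "d \<le> q" "e \<le> q" using de by (metis le_add1 mult_le_mono mult_1_right mult_1_left le_refl)+
      then have in_nle: "d \<in> nle x" "e \<in> nle x" using de q by (auto simp: nle_def)
      have "real (tau q) ^ m \<le> (real (tau d) * real (tau e)) ^ m"
        using tau_mult_le[of d e] de by (intro power_mono) (auto simp flip: of_nat_mult)
      then have "g q \<le> g d * g e"
        unfolding g_def de(1)[symmetric] by (simp add: power_mult_distrib divide_right_mono)
      then show "\<exists>t\<in>nle x \<times> nle x. (case t of (a, b) \<Rightarrow> (a * b, a)) = s \<and>
         (case s of (q, d) \<Rightarrow> g q) \<le> (case t of (a, b) \<Rightarrow> g a * g b)"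
        using in_nle de s by (intro bexI[of _ "(d, e)"]) auto
    qed
  qed (use g0 in auto)
  also have "\<dots> = (\<Sum>a\<in>nle x. g a) * (\<Sum>b\<in>nle x. g b)"
    by (simp add: sum_product sum.cartesian_product)
  also have "\<dots> \<le> (1 + ln x) ^ (2 ^ m) * (1 + ln x) ^ (2 ^ m)"
    using Suc x g0 unfolding g_def[symmetric] by (intro mult_mono sum_nonneg) auto
  also have "\<dots> = (1 + ln x) ^ (2 ^ Suc m)" by (simp add: power_add[symmetric] mult_2)
  finally show ?case .
qed

text \<open>In the divisor sum q = sum of phi(d) each term is at most phi(q).\<close>

lemma le_totient_tau:
  assumes "q > 0"
  shows "q \<le> totient q * tau q"
proof -
  have "q = (\<Sum>d | d dvd q. totient d)" by (rule totient_divisor_sum[symmetric])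
  also have "\<dots> \<le> (\<Sum>d | d dvd q. totient q)"
    using assms by (intro sum_mono) (auto intro: totient_dvd_mono)
  finally show ?thesis by (simp add: tau_def mult.commute)
qed

lemma prod_primes_dvd:
  assumes "finite S" "\<And>p. p \<in> S \<Longrightarrow> prime p" "\<And>p. p \<in> S \<Longrightarrow> p dvd (n::nat)"
  shows "\<Prod>S dvd n"
  using assms
proof (induction S rule: finite_induct)
  case (insert p S)
  have "coprime p (\<Prod>S)"
    using insert by (intro prod_coprime_right) (auto intro: primes_coprime)
  then show ?case using insert by (auto intro: divides_mult)
qed simp

text \<open>Different subsets of S have different products, all of them divisors of n.\<close>

lemma two_power_card_prime_factors_le_tau:
  assumes n: "n > 0" and S: "S \<subseteq> prime_factors n"
  shows "2 ^ card S \<le> tau n"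
proof -
  have fS: "finite S" using S finite_subset by blast
  have "inj_on (\<lambda>T. \<Prod>T) (Pow S)"
  proof (rule inj_onI)
    fix T U assume TU: "T \<in> Pow S" "U \<in> Pow S" "\<Prod>T = \<Prod>U"
    have "prime_factors (\<Prod>V) = V" if "V \<in> Pow S" for V
    proof -
      have "finite V" "\<forall>p\<in>V. prime p" using that S fS by (auto intro: finite_subset dest: in_prime_factors_imp_prime)
      then show ?thesis
      proof (induction V rule: finite_induct)
        case (insert p V)
        have "\<Prod>V \<noteq> 0" "p \<noteq> 0" using insert by (auto simp: prod_zero_iff prime_gt_0_nat)
        then show ?case using insert by (simp add: prime_factorization_mult prime_factorization_prime)
      qed simp
    qed
    then show "T = U" using TU by metis
  qed
  then have "card ((\<lambda>T. \<Prod>T) ` Pow S) = 2 ^ card S" using fS by (simp add: card_image card_Pow)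
  moreover have "(\<lambda>T. \<Prod>T) ` Pow S \<subseteq> {d. d dvd n}"
    using S fS by (auto intro!: prod_primes_dvd intro: finite_subset dest: in_prime_factors_imp_prime in_prime_factors_imp_dvd)
  ultimately show ?thesis unfolding tau_def using n by (metis card_mono finite_divisors_nat)
qed

section \<open>Tuples of moduli\<close>

text \<open>The gcd with m distributes over the lcm, so divisibility can be tested on each modulus
  separately.\<close>

lemma gcd_Lcm_dvd:
  fixes D :: "'a \<Rightarrow> nat" and y :: int
  assumes "finite I" "\<And>i. i \<in> I \<Longrightarrow> int (gcd (D i) m) dvd y"
  shows "int (gcd (Lcm (D ` I)) m) dvd y"
  using assms
proof (induction I rule: finite_induct)
  case (insert a I)
  have "gcd (Lcm (D ` insert a I)) m = lcm (gcd (D a) m) (gcd (Lcm (D ` I)) m)"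
    using gcd_lcm_distrib[of m "D a" "Lcm (D ` I)"] by (simp add: gcd.commute)
  then show ?case using insert by (simp flip: lcm_int_int_eq)
qed simp

text \<open>The congruences are merged one at a time. Pairwise consistency passes to the merged one
  because the gcd of the accumulated lcm with the next modulus is controlled by the individual
  gcds.\<close>

lemma Chinese_remainder_noncoprime:
  fixes D :: "'a \<Rightarrow> nat" and b :: "'a \<Rightarrow> int"
  assumes "finite I" "\<And>r s. r \<in> I \<Longrightarrow> s \<in> I \<Longrightarrow> int (gcd (D r) (D s)) dvd b r - b s"
  shows "\<exists>x. \<forall>i\<in>I. int (D i) dvd x - b i"
  using assms
proof (induction I rule: finite_induct)
  case (insert a I)
  then obtain x where x: "\<And>i. i \<in> I \<Longrightarrow> int (D i) dvd x - b i" by (metis insertI2)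
  define L where "L = Lcm (D ` I)"
  have "int (gcd L (D a)) dvd b a - x"
    unfolding L_def
  proof (rule gcd_Lcm_dvd[OF insert.hyps(1)])
    fix i assume i: "i \<in> I"
    have "int (gcd (D i) (D a)) dvd b i - b a" using insert.prems i by simp
    moreover have "int (gcd (D i) (D a)) dvd x - b i"
      using x[OF i] by (meson dvd_trans gcd_dvd1 of_nat_dvd_iff)
    ultimately have "int (gcd (D i) (D a)) dvd (x - b i) + (b i - b a)" using dvd_add by blast
    then have "int (gcd (D i) (D a)) dvd x - b a" by simp
    then show "int (gcd (D i) (D a)) dvd b a - x" by (rule dvd_diff_commute[THEN iffD1])
  qed
  then have "gcd (int L) (int (D a)) dvd b a - x" by simp
  then obtain u where "[int L * u = b a - x] (mod int (D a))" using cong_solve_dvd_int by blast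
  then have u: "int (D a) dvd (x + int L * u) - b a"
    by (simp add: cong_iff_dvd_diff algebra_simps)
  have "int (D i) dvd (x + int L * u) - b i" if "i \<in> I" for i
  proof -
    have "int (D i) dvd int L" unfolding L_def using that by (simp add: dvd_Lcm)
    then have "int (D i) dvd (x - b i) + int L * u" using x[OF that] by (intro dvd_add dvd_mult2)
    then show ?thesis by (simp add: algebra_simps)
  qed
  then show ?case using u by blast
qed simp

lemma Lcm_dvd_iff_int:
  fixes D :: "'a \<Rightarrow> nat" and y :: int
  assumes "finite I"
  shows "int (Lcm (D ` I)) dvd y \<longleftrightarrow> (\<forall>i\<in>I. int (D i) dvd y)"
proof -
  have "Lcm (D ` I) dvd t \<longleftrightarrow> (\<forall>i\<in>I. D i dvd t)" for t by (auto simp: Lcm_dvd_iff)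
  from this[of "nat \<bar>y\<bar>"] show ?thesis by (simp only: dvd_nat_abs_iff)
qed

lemma count_residue_class:
  fixes L :: nat and x J N :: int
  assumes L: "L > 0" and JN: "J \<le> N"
  shows "finite {n \<in> {J<..N}. int L dvd n - x}"
    "\<bar>real (card {n \<in> {J<..N}. int L dvd n - x}) - (of_int N - of_int J) / real L\<bar> \<le> 1"
proof -
  show "finite {n \<in> {J<..N}. int L dvd n - x}" by (rule finite_subset[of _ "{J<..N}"]) auto
  define u v where "u = (J - x) div int L" and "v = (N - x) div int L"
  have Lp: "int L > 0" using L by simp
  have key: "m \<le> y div int L \<longleftrightarrow> int L * m \<le> y" for m y
  proof -
    have "m \<le> y div int L \<longleftrightarrow> real_of_int m \<le> real_of_int y / real L"
      using floor_divide_of_int_eq[of y "int L", where 'a=real] le_floor_iff[of m "real_of_int y / real L"] by simp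
    also have "\<dots> \<longleftrightarrow> real_of_int (int L * m) \<le> real_of_int y"
      using L by (simp add: pos_le_divide_eq mult.commute)
    finally show ?thesis by (simp only: of_int_le_iff)
  qed
  have "bij_betw (\<lambda>m. x + int L * m) {u<..v} {n \<in> {J<..N}. int L dvd n - x}"
  proof (rule bij_betwI[where g = "\<lambda>n. (n - x) div int L"])
    show "(\<lambda>m. x + int L * m) \<in> {u<..v} \<rightarrow> {n \<in> {J<..N}. int L dvd n - x}"
    proof
      fix m assume m: "m \<in> {u<..v}"
      have "int L * m \<le> N - x" using m key unfolding v_def by simp
      moreover have "\<not> int L * m \<le> J - x" using m key[of m "J - x"] unfolding u_def by simp
      ultimately show "x + int L * m \<in> {n \<in> {J<..N}. int L dvd n - x}" by simp
    qed
    show "(\<lambda>n. (n - x) div int L) \<in> {n \<in> {J<..N}. int L dvd n - x} \<rightarrow> {u<..v}"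
    proof
      fix n assume "n \<in> {n \<in> {J<..N}. int L dvd n - x}"
      then obtain m where m: "n - x = int L * m" "J < n" "n \<le> N" by (auto elim: dvdE)
      have "(n - x) div int L = m" using m(1) Lp by simp
      moreover have "\<not> m \<le> u" unfolding u_def key using m by linarith
      moreover have "m \<le> v" unfolding v_def key using m by linarith
      ultimately show "(n - x) div int L \<in> {u<..v}" by simp
    qed
  qed (use Lp in auto)
  then have "card {n \<in> {J<..N}. int L dvd n - x} = card {u<..v}" by (rule bij_betw_same_card[symmetric])
  moreover have "u \<le> v" unfolding u_def v_def using JN Lp by (intro zdiv_mono1) auto
  ultimately have c: "real (card {n \<in> {J<..N}. int L dvd n - x}) = of_int v - of_int u" by simp
  have fl: "of_int ((y :: int) div int L) \<le> of_int y / real L \<and> of_int y / real L < of_int (y div int L) + (1 :: real)" for y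
    using floor_divide_of_int_eq[of y "int L", where 'a=real] floor_correct[of "of_int y / real L :: real"] by simp
  have "(of_int N - of_int J) / real L = of_int (N - x) / real L - of_int (J - x) / real L"
    by (simp add: diff_divide_distrib)
  then show "\<bar>real (card {n \<in> {J<..N}. int L dvd n - x}) - (of_int N - of_int J) / real L\<bar> \<le> 1"
    unfolding c using fl[of "N - x"] fl[of "J - x"] unfolding u_def v_def by linarith
qed

section \<open>Expansion of truncated divisor sums over tuples of moduli\<close>

lemma sum_ln_ge:
  assumes "n > 0"
  shows "(\<Sum>m=1..n. ln (real m)) \<ge> real n * ln (real n) - real n"
  using assms
proof (induction n rule: nat_induct_non_zero)
  case (Suc n)
  have "ln (real (Suc n) / real n) \<le> real (Suc n) / real n - 1" using Suc.hyps by (intro ln_le_minus_one) auto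
  then have "real n * (ln (real (Suc n)) - ln (real n)) \<le> real n * (1 / real n)"
    using Suc.hyps by (intro mult_left_mono) (auto simp: ln_div field_simps)
  then show ?case using Suc by (simp add: algebra_simps)
qed simp

text \<open>By Stirling the average of log(R/m) is bounded. The pointwise bound log R would lose a
  logarithm for each variable; this one is what makes the counting error R^k free of
  logarithms.\<close>

lemma sum_ln_quotient_le:
  assumes R: "R \<ge> 1"
  shows "(\<Sum>m\<in>nle R. ln (R / real m)) \<le> R"
proof -
  define n where "n = nat \<lfloor>R\<rfloor>"
  have n: "n > 0" "real n \<le> R" using R by (auto simp: n_def)
  have "(\<Sum>m\<in>nle R. ln (R / real m)) = (\<Sum>m=1..n. ln R - ln (real m))"
    unfolding nle_eq n_def[symmetric] using R by (intro sum.cong) (auto simp: ln_div)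
  also have "\<dots> = real n * ln R - (\<Sum>m=1..n. ln (real m))" by (simp add: sum_subtractf)
  also have "\<dots> \<le> real n * ln R - (real n * ln (real n) - real n)"
    using sum_ln_ge[OF n(1)] by linarith
  also have "\<dots> = real n * ln (R / real n) + real n" using R n by (simp add: ln_div algebra_simps)
  also have "\<dots> \<le> real n * (R / real n - 1) + real n"
    using n R by (intro add_right_mono mult_left_mono ln_le_minus_one) auto
  also have "\<dots> = R" using n by (simp add: algebra_simps)
  finally show ?thesis .
qed

lemma LambdaT_eq:
  assumes "m > 0"
  shows "LambdaT P m = (\<Sum>d\<in>nle P. if int d dvd m then moebius d * ln (P / real d) else 0)"
proof -
  have "{d. d dvd nat m \<and> real d \<le> P} = {d \<in> nle P. int d dvd m}"
  proof -
    have "d dvd nat m \<longleftrightarrow> int d dvd m" for d using assms dvd_nat_abs_iff[of d m] by simp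
    moreover have "d \<ge> 1" if "d dvd nat m" for d
      using dvd_pos_nat[of "nat m" d] that assms by simp
    ultimately show ?thesis by (auto simp: nle_def)
  qed
  then show ?thesis using assms by (simp add: LambdaT_def sum.inter_filter)
qed

text \<open>Deliberately crude, with at most m divisors of size up to log P each; it serves only on
  the short range n <= J.\<close>

lemma abs_LambdaT_le:
  assumes "P \<ge> 1" "m > 0"
  shows "\<bar>LambdaT P m\<bar> \<le> of_int m * ln P"
proof -
  have fin: "finite {d. d dvd nat m \<and> real d \<le> P}" using assms by (intro finite_subset[OF _ finite_divisors_nat[of "nat m"]]) auto
  have "\<bar>LambdaT P m\<bar> \<le> (\<Sum>d | d dvd nat m \<and> real d \<le> P. \<bar>moebius d * ln (P / real d)\<bar>)"
    using assms by (simp add: LambdaT_def)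
  also have "\<dots> \<le> (\<Sum>d | d dvd nat m \<and> real d \<le> P. 1 * ln P)"
  proof (rule sum_mono)
    fix d assume d: "d \<in> {d. d dvd nat m \<and> real d \<le> P}"
    then have "d > 0" using assms dvd_pos_nat[of "nat m" d] by simp
    then have "P / real d \<ge> 1" "P / real d \<le> P" using d assms by (auto simp: field_simps)
    then have "\<bar>ln (P / real d)\<bar> \<le> ln P" using assms \<open>d > 0\<close> by (simp add: ln_ge_zero)
    then show "\<bar>moebius d * ln (P / real d)\<bar> \<le> 1 * ln P"
      unfolding abs_mult using abs_moebius_le by (intro mult_mono) auto
  qed
  also have "\<dots> = real (card {d. d dvd nat m \<and> real d \<le> P}) * ln P" by simp
  also have "\<dots> \<le> of_int m * ln P"
  proof (rule mult_right_mono)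
    have "{d. d dvd nat m \<and> real d \<le> P} \<subseteq> {1..nat m}"
    proof
      fix d assume "d \<in> {d. d dvd nat m \<and> real d \<le> P}"
      then have "d dvd nat m" by simp
      then show "d \<in> {1..nat m}" using assms dvd_imp_le[of d "nat m"] dvd_pos_nat[of "nat m" d] by simp
    qed
    then have "card {d. d dvd nat m \<and> real d \<le> P} \<le> card {1..nat m}" by (intro card_mono) auto
    then have "card {d. d dvd nat m \<and> real d \<le> P} \<le> nat m" by simp
    then show "real (card {d. d dvd nat m \<and> real d \<le> P}) \<le> of_int m" using assms by linarith
  qed (use assms in simp)
  finally show ?thesis .
qed

lemma prod_if_all:
  fixes c :: "'a \<Rightarrow> real"
  assumes "finite I"
  shows "(\<Prod>i\<in>I. if P i then c i else 0) = (if \<forall>i\<in>I. P i then \<Prod>i\<in>I. c i else 0)"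
  using assms by (induction I rule: finite_induct) auto

definition tuples :: "nat \<Rightarrow> real \<Rightarrow> (nat \<Rightarrow> nat) set" where
  "tuples k R = {1..k-1} \<rightarrow>\<^sub>E nle R"

definition tuple_coeff :: "nat \<Rightarrow> real \<Rightarrow> (nat \<Rightarrow> nat) \<Rightarrow> real" where
  "tuple_coeff k R d = (\<Prod>i=1..k-1. moebius (d i) * ln (R / real (d i)))"

definition tuple_lcm :: "nat \<Rightarrow> (nat \<Rightarrow> nat) \<Rightarrow> nat" where
  "tuple_lcm k d = Lcm (d ` {1..k-1})"

lemma finite_tuples [simp]: "finite (tuples k R)"
  unfolding tuples_def by (intro finite_PiE) auto

lemma tuplesD: "d \<in> tuples k R \<Longrightarrow> i \<in> {1..k-1} \<Longrightarrow> d i \<ge> 1 \<and> real (d i) \<le> R"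
  unfolding tuples_def using PiE_mem[of d "{1..k-1}" "\<lambda>_. nle R" i] by (simp add: nle_def)

text \<open>Positivity matters: at a nonpositive argument \<open>LambdaT\<close> is 0 by definition,
  whereas the divisor sum on the right would not be.\<close>

lemma correlation_expand:
  assumes pos: "\<And>n i. n \<in> A \<Longrightarrow> i \<in> {1..k-1} \<Longrightarrow> int n + j i > 0"
  shows "(\<Sum>n\<in>A. (\<Prod>i=1..k-1. LambdaT R (int n + j i)) * G n)
    = (\<Sum>d\<in>tuples k R. tuple_coeff k R d * (\<Sum>n\<in>A. if \<forall>i\<in>{1..k-1}. int (d i) dvd int n + j i then G n else 0))"
proof -
  have "(\<Prod>i=1..k-1. LambdaT R (int n + j i)) * G n
    = (\<Sum>d\<in>tuples k R. tuple_coeff k R d * (if \<forall>i\<in>{1..k-1}. int (d i) dvd int n + j i then G n else 0))"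
    if n: "n \<in> A" for n
  proof -
    have "(\<Prod>i=1..k-1. LambdaT R (int n + j i)) = (\<Prod>i=1..k-1. \<Sum>d\<in>nle R. if int d dvd int n + j i then moebius d * ln (R / real d) else 0)"
      using pos[OF n] by (intro prod.cong refl LambdaT_eq)
    also have "\<dots> = (\<Sum>d\<in>tuples k R. \<Prod>i=1..k-1. if int (d i) dvd int n + j i then moebius (d i) * ln (R / real (d i)) else 0)"
      unfolding tuples_def by (rule prod_sum_PiE) auto
    also have "\<dots> = (\<Sum>d\<in>tuples k R. if \<forall>i\<in>{1..k-1}. int (d i) dvd int n + j i then tuple_coeff k R d else 0)"
      unfolding tuple_coeff_def by (intro sum.cong refl prod_if_all) simp
    finally show ?thesis by (simp add: sum_distrib_right if_distrib if_distribR cong: if_cong)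
  qed
  then have "(\<Sum>n\<in>A. (\<Prod>i=1..k-1. LambdaT R (int n + j i)) * G n)
     = (\<Sum>n\<in>A. \<Sum>d\<in>tuples k R. tuple_coeff k R d * (if \<forall>i\<in>{1..k-1}. int (d i) dvd int n + j i then G n else 0))"
    by (rule sum.cong[OF refl])
  also have "\<dots> = (\<Sum>d\<in>tuples k R. \<Sum>n\<in>A. tuple_coeff k R d * (if \<forall>i\<in>{1..k-1}. int (d i) dvd int n + j i then G n else 0))"
    by (rule sum.swap)
  finally show ?thesis by (simp only: sum_distrib_left)
qed

lemma sum_abs_tuple_coeff_le:
  assumes R: "R \<ge> 1"
  shows "(\<Sum>d\<in>tuples k R. \<bar>tuple_coeff k R d\<bar>) \<le> R ^ (k - 1)"
proof -
  have "(\<Sum>d\<in>tuples k R. \<bar>tuple_coeff k R d\<bar>) = (\<Sum>d\<in>tuples k R. \<Prod>i=1..k-1. \<bar>moebius (d i) * ln (R / real (d i))\<bar>)"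
    by (simp add: tuple_coeff_def abs_prod)
  also have "\<dots> = (\<Prod>i=1..k-1. \<Sum>d\<in>nle R. \<bar>moebius d * ln (R / real d)\<bar>)"
    unfolding tuples_def by (rule prod_sum_PiE[symmetric]) auto
  also have "\<dots> \<le> (\<Prod>i=1..k-1. R)"
  proof (intro prod_mono conjI sum_nonneg)
    have "(\<Sum>d\<in>nle R. \<bar>moebius d * ln (R / real d)\<bar>) \<le> (\<Sum>d\<in>nle R. ln (R / real d))"
    proof (rule sum_mono)
      fix d assume "d \<in> nle R"
      then have "ln (R / real d) \<ge> 0" by (auto simp: nle_def intro!: ln_ge_zero)
      then show "\<bar>moebius d * ln (R / real d)\<bar> \<le> ln (R / real d)"
        unfolding abs_mult using abs_moebius_le[of d] by (simp add: mult_left_le_one_le)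
    qed
    then show "(\<Sum>d\<in>nle R. \<bar>moebius d * ln (R / real d)\<bar>) \<le> R" using sum_ln_quotient_le[OF R] by linarith
  qed auto
  finally show ?thesis by simp
qed

lemma abs_tuple_coeff_le:
  assumes "d \<in> tuples k R"
  shows "\<bar>tuple_coeff k R d\<bar> \<le> ln R ^ (k - 1)"
proof -
  have "\<bar>tuple_coeff k R d\<bar> = (\<Prod>i=1..k-1. \<bar>moebius (d i) * ln (R / real (d i))\<bar>)"
    by (simp add: tuple_coeff_def abs_prod)
  also have "\<dots> \<le> (\<Prod>i=1..k-1. ln R)"
  proof (intro prod_mono conjI)
    fix i assume "i \<in> {1..k-1}"
    then have d: "d i \<ge> 1" "real (d i) \<le> R" using tuplesD[OF assms] by auto
    then have "R / real (d i) \<ge> 1" "R / real (d i) \<le> R" by (auto simp: field_simps mult_le_cancel_left1)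
    then have "\<bar>ln (R / real (d i))\<bar> \<le> ln R" using d by (simp add: ln_ge_zero)
    then have "\<bar>moebius (d i)\<bar> * \<bar>ln (R / real (d i))\<bar> \<le> 1 * ln R"
      using abs_moebius_le by (intro mult_mono) auto
    then show "\<bar>moebius (d i) * ln (R / real (d i))\<bar> \<le> ln R" by (simp add: abs_mult)
  qed auto
  finally show ?thesis by simp
qed

lemma Lcm_le_prod:
  fixes d :: "'a \<Rightarrow> nat"
  assumes "finite I" "\<And>i. i \<in> I \<Longrightarrow> d i \<ge> 1"
  shows "1 \<le> Lcm (d ` I)" "Lcm (d ` I) \<le> (\<Prod>i\<in>I. d i)"
proof -
  have p: "(\<Prod>i\<in>I. d i) \<ge> 1" using assms(2) by (intro prod_ge_1) auto
  have "Lcm (d ` I) dvd (\<Prod>i\<in>I. d i)" using assms(1) by (auto simp: Lcm_dvd_iff)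
  then show "1 \<le> Lcm (d ` I)" "Lcm (d ` I) \<le> (\<Prod>i\<in>I. d i)"
    using p dvd_pos_nat[of "\<Prod>i\<in>I. d i"] dvd_imp_le by (auto simp: Suc_le_eq)
qed

lemma tuple_lcm_in_nle:
  assumes "d \<in> tuples k R" "R \<ge> 1"
  shows "tuple_lcm k d \<in> nle (R ^ (k - 1))"
proof -
  have "real (tuple_lcm k d) \<le> real (\<Prod>i\<in>{1..k-1}. d i)"
    unfolding tuple_lcm_def using Lcm_le_prod(2)[of "{1..k-1}" d] tuplesD[OF assms(1)] by (metis finite_atLeastAtMost of_nat_le_iff)
  also have "\<dots> = (\<Prod>i\<in>{1..k-1}. real (d i))" by simp
  also have "\<dots> \<le> (\<Prod>i\<in>{1..k-1}. R)" using tuplesD[OF assms(1)] by (intro prod_mono) auto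
  finally have "real (tuple_lcm k d) \<le> R ^ (k - 1)" by simp
  moreover have "1 \<le> tuple_lcm k d" unfolding tuple_lcm_def
    using tuplesD[OF assms(1)] by (intro Lcm_le_prod) auto
  ultimately show ?thesis by (simp add: nle_def)
qed

text \<open>Every entry of a tuple with lcm q divides q, so at most tau(q)^(k-1) tuples share that
  lcm.\<close>

lemma sum_tuple_lcm_le:
  assumes R: "R \<ge> 1" and g: "\<And>q. g q \<ge> (0::real)"
  shows "(\<Sum>d\<in>tuples k R. g (tuple_lcm k d)) \<le> (\<Sum>q\<in>nle (R ^ (k - 1)). real (tau q) ^ (k - 1) * g q)"
proof -
  have "(\<Sum>d\<in>tuples k R. g (tuple_lcm k d))
     = (\<Sum>q\<in>nle (R ^ (k - 1)). \<Sum>d | d \<in> tuples k R \<and> tuple_lcm k d = q. g (tuple_lcm k d))"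
    by (rule sum.group[symmetric]) (use tuple_lcm_in_nle R in auto)
  also have "\<dots> \<le> (\<Sum>q\<in>nle (R ^ (k - 1)). real (tau q) ^ (k - 1) * g q)"
  proof (rule sum_mono)
    fix q assume "q \<in> nle (R ^ (k - 1))"
    then have q: "q > 0" by (simp add: nle_def)
    have "{d \<in> tuples k R. tuple_lcm k d = q} \<subseteq> {1..k-1} \<rightarrow>\<^sub>E {m. m dvd q}"
    proof
      fix d assume d: "d \<in> {d \<in> tuples k R. tuple_lcm k d = q}"
      have "d i dvd q" if "i \<in> {1..k-1}" for i
      proof -
        have "d i dvd Lcm (d ` {1..k-1})" using that by (intro dvd_Lcm) auto
        then show ?thesis using d by (simp add: tuple_lcm_def)
      qed
      then show "d \<in> {1..k-1} \<rightarrow>\<^sub>E {m. m dvd q}" using d by (auto simp: tuples_def PiE_iff)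
    qed
    moreover have "finite ({1..k-1} \<rightarrow>\<^sub>E {m. m dvd q})" using q by (intro finite_PiE) auto
    ultimately have "card {d \<in> tuples k R. tuple_lcm k d = q} \<le> card ({1..k-1} \<rightarrow>\<^sub>E {m. m dvd q})"
      by (intro card_mono)
    also have "\<dots> = tau q ^ (k - 1)" by (simp add: card_PiE tau_def)
    finally have "real (card {d \<in> tuples k R. tuple_lcm k d = q}) \<le> real (tau q) ^ (k - 1)"
      by (metis of_nat_le_iff of_nat_power)
    then have "real (card {d \<in> tuples k R. tuple_lcm k d = q}) * g q \<le> real (tau q) ^ (k - 1) * g q"
      using g by (intro mult_right_mono)
    then show "(\<Sum>d | d \<in> tuples k R \<and> tuple_lcm k d = q. g (tuple_lcm k d)) \<le> real (tau q) ^ (k - 1) * g q"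
      by simp
  qed
  finally show ?thesis .
qed

text \<open>The multiplicity of an lcm raises the power of tau from m to k - 1 + m, and the moment
  bound turns this into the exponent 2^(k-1+m) of the logarithm.\<close>

lemma sum_tau_tuple_le:
  assumes R: "R \<ge> 1"
  shows "(\<Sum>d\<in>tuples k R. \<bar>tuple_coeff k R d\<bar> * (real (tau (tuple_lcm k d)) ^ m / real (tuple_lcm k d)))
    \<le> ln R ^ (k - 1) * (1 + real (k - 1) * ln R) ^ (2 ^ (k - 1 + m))"
proof -
  have l: "ln R \<ge> 0" using R by simp
  have "(\<Sum>d\<in>tuples k R. \<bar>tuple_coeff k R d\<bar> * (real (tau (tuple_lcm k d)) ^ m / real (tuple_lcm k d)))
    \<le> (\<Sum>d\<in>tuples k R. ln R ^ (k - 1) * (real (tau (tuple_lcm k d)) ^ m / real (tuple_lcm k d)))"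
    by (intro sum_mono mult_right_mono abs_tuple_coeff_le) auto
  also have "\<dots> = ln R ^ (k - 1) * (\<Sum>d\<in>tuples k R. real (tau (tuple_lcm k d)) ^ m / real (tuple_lcm k d))"
    by (simp add: sum_distrib_left)
  also have "\<dots> \<le> ln R ^ (k - 1) * (\<Sum>q\<in>nle (R ^ (k - 1)). real (tau q) ^ (k - 1) * (real (tau q) ^ m / real q))"
    using l by (intro mult_left_mono sum_tuple_lcm_le[OF R]) auto
  also have "\<dots> = ln R ^ (k - 1) * (\<Sum>q\<in>nle (R ^ (k - 1)). real (tau q) ^ (k - 1 + m) / real q)"
    by (simp add: power_add)
  also have "\<dots> \<le> ln R ^ (k - 1) * (1 + ln (R ^ (k - 1))) ^ (2 ^ (k - 1 + m))"
    using l R by (intro mult_left_mono sum_tau_power_le) auto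
  finally show ?thesis using R by (simp add: ln_realpow)
qed

section \<open>Congruence systems attached to a tuple\<close>

definition compatible_tuple :: "nat \<Rightarrow> (nat \<Rightarrow> int) \<Rightarrow> (nat \<Rightarrow> nat) \<Rightarrow> bool" where
  "compatible_tuple k j d \<longleftrightarrow> (\<forall>r\<in>{1..k-1}. \<forall>s\<in>{1..k-1}. r < s \<longrightarrow> int (gcd (d r) (d s)) dvd j s - j r)"

text \<open>The solutions of the system are congruent to -j_i modulo d_i, so for a solvable system
  this says that its residue class modulo the lcm is reduced.\<close>

definition shift_coprime :: "nat \<Rightarrow> (nat \<Rightarrow> int) \<Rightarrow> (nat \<Rightarrow> nat) \<Rightarrow> bool" where
  "shift_coprime k j d \<longleftrightarrow> (\<forall>i\<in>{1..k-1}. coprime (int (d i)) (j i))"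

lemma W_eq:
  "W k R j = (\<Sum>d\<in>tuples k R. if shift_coprime k j d \<and> compatible_tuple k j d
     then tuple_coeff k R d / real (totient (tuple_lcm k d)) else 0)"
proof -
  have "W_index k R j = {d \<in> tuples k R. shift_coprime k j d \<and> compatible_tuple k j d}"
    unfolding W_index_def tuples_def nle_def shift_coprime_def compatible_tuple_def by blast
  then have "W k R j = (\<Sum>d | d \<in> tuples k R \<and> shift_coprime k j d \<and> compatible_tuple k j d. tuple_coeff k R d / real (totient (tuple_lcm k d)))"
    unfolding W_def by (simp add: tuple_coeff_def tuple_lcm_def)
  also have "\<dots> = (\<Sum>d\<in>tuples k R. if shift_coprime k j d \<and> compatible_tuple k j d
     then tuple_coeff k R d / real (totient (tuple_lcm k d)) else 0)"
    by (rule sum.inter_filter) simp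
  finally show ?thesis .
qed

lemma compatible_tupleD:
  assumes "compatible_tuple k j d" "r \<in> {1..k-1}" "s \<in> {1..k-1}"
  shows "int (gcd (d r) (d s)) dvd j s - j r"
proof (cases r s rule: linorder_cases)
  case less
  then show ?thesis using assms by (simp add: compatible_tuple_def)
next
  case greater
  then have "int (gcd (d s) (d r)) dvd j r - j s" using assms by (simp add: compatible_tuple_def)
  then show ?thesis by (metis dvd_diff_commute gcd.commute)
qed simp

lemma compatible_tupleI:
  assumes "\<And>i. i \<in> {1..k-1} \<Longrightarrow> int (d i) dvd n + j i"
  shows "compatible_tuple k j d"
  unfolding compatible_tuple_def
proof (intro ballI impI)
  fix r s assume "r \<in> {1..k-1}" "s \<in> {1..k-1}"
  then have "int (gcd (d r) (d s)) dvd n + j r" "int (gcd (d r) (d s)) dvd n + j s"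
    using assms by (meson dvd_trans gcd_dvd1 gcd_dvd2 of_nat_dvd_iff)+
  then have "int (gcd (d r) (d s)) dvd (n + j s) - (n + j r)" by (intro dvd_diff)
  then show "int (gcd (d r) (d s)) dvd j s - j r" by simp
qed

lemma residue_class_of_system:
  fixes D :: "nat \<Rightarrow> nat"
  assumes "finite I" "\<And>r s. r \<in> I \<Longrightarrow> s \<in> I \<Longrightarrow> int (gcd (D r) (D s)) dvd j s - j r"
  shows "\<exists>x. \<forall>n. (\<forall>i\<in>I. int (D i) dvd n + j i) \<longleftrightarrow> int (Lcm (D ` I)) dvd n - x"
proof -
  obtain x where x: "\<And>i. i \<in> I \<Longrightarrow> int (D i) dvd x - (- j i)"
    using Chinese_remainder_noncoprime[of I D "\<lambda>i. - j i"] assms by fastforce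
  have "int (D i) dvd n + j i \<longleftrightarrow> int (D i) dvd n - x" if "i \<in> I" for n i
  proof -
    have "int (D i) dvd x + j i" using x[OF that] by simp
    then have "int (D i) dvd (n - x) + (x + j i) \<longleftrightarrow> int (D i) dvd n - x" by (rule dvd_add_left_iff)
    then show ?thesis by simp
  qed
  then have "\<forall>n. (\<forall>i\<in>I. int (D i) dvd n + j i) \<longleftrightarrow> int (Lcm (D ` I)) dvd n - x"
    unfolding Lcm_dvd_iff_int[OF assms(1)] by blast
  then show ?thesis ..
qed

lemma tuple_count:
  assumes d: "d \<in> tuples k R" and co: "compatible_tuple k j d" and e: "e \<ge> 1" and JN: "J \<le> N"
  shows "\<bar>real (card {n \<in> {J<..N}. (\<forall>i\<in>{1..k-1}. int (d i) dvd n + j i) \<and> int e dvd n})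
    - (if \<forall>i\<in>{1..k-1}. int (gcd (d i) e) dvd j i then (of_int N - of_int J) / real (lcm (tuple_lcm k d) e) else 0)\<bar> \<le> 1"
proof (cases "\<forall>i\<in>{1..k-1}. int (gcd (d i) e) dvd j i")
  case False
  then obtain i where i: "i \<in> {1..k-1}" "\<not> int (gcd (d i) e) dvd j i" by blast
  have "\<not> (int (d i) dvd n + j i \<and> int e dvd n)" for n
  proof
    assume "int (d i) dvd n + j i \<and> int e dvd n"
    then have "int (gcd (d i) e) dvd n + j i" "int (gcd (d i) e) dvd n"
      by (meson dvd_trans gcd_dvd1 gcd_dvd2 of_nat_dvd_iff)+
    then show False using i(2) by (simp add: dvd_add_right_iff)
  qed
  then have "{n \<in> {J<..N}. (\<forall>i\<in>{1..k-1}. int (d i) dvd n + j i) \<and> int e dvd n} = {}" using i(1) by blast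
  then show ?thesis unfolding if_not_P[OF False] by (simp only: card.empty of_nat_0 diff_self abs_zero zero_le_one)
next
  case True
  \<comment> \<open>The condition e | n is one more congruence, with modulus e and shift 0, stored
    at the index 0, which lies outside the tuple.\<close>
  define d' where "d' = d(0 := e)"
  define j' where "j' = j(0 := 0)"
  define I where "I = {1..k-1}"
  have I0: "0 \<notin> I" by (simp add: I_def)
  have im: "d' ` insert 0 I = insert e (d ` I)" 
  proof -
    have "d' ` I = d ` I" using I0 by (intro image_cong) (auto simp: d'_def)
    moreover have "d' 0 = e" by (simp add: d'_def)
    ultimately show ?thesis by (metis image_insert)
  qed
  have "\<exists>x. \<forall>n. (\<forall>i\<in>insert 0 I. int (d' i) dvd n + j' i) \<longleftrightarrow> int (Lcm (d' ` insert 0 I)) dvd n - x"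
  proof (rule residue_class_of_system)
    fix r s assume rs: "r \<in> insert 0 I" "s \<in> insert 0 I"
    have 1: "int (gcd (d i) e) dvd j i" if "i \<in> I" for i using True that by (simp add: I_def)
    have 2: "int (gcd (d r) (d s)) dvd j s - j r" if "r \<in> I" "s \<in> I" using compatible_tupleD[OF co] that by (simp add: I_def)
    show "int (gcd (d' r) (d' s)) dvd j' s - j' r"
    proof (cases "r = 0"; cases "s = 0")
      assume "r \<noteq> 0" "s \<noteq> 0" then show ?thesis using rs 2 by (simp add: d'_def j'_def)
    next
      assume "r = 0" "s \<noteq> 0" then show ?thesis using rs 1[of s] by (simp add: d'_def j'_def gcd.commute)
    next
      assume "r \<noteq> 0" "s = 0" then show ?thesis using rs 1[of r] by (simp add: d'_def j'_def)
    qed (simp add: d'_def j'_def)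
  qed (simp add: I_def)
  moreover have LL: "Lcm (d' ` insert 0 I) = lcm e (tuple_lcm k d)" unfolding im by (simp add: tuple_lcm_def I_def)
  ultimately obtain x where x: "\<And>n. (\<forall>i\<in>insert 0 I. int (d' i) dvd n + j' i) \<longleftrightarrow> int (lcm e (tuple_lcm k d)) dvd n - x"
    unfolding LL by blast
  have ins: "(\<forall>i\<in>insert 0 I. int (d' i) dvd n + j' i) \<longleftrightarrow> (\<forall>i\<in>{1..k-1}. int (d i) dvd n + j i) \<and> int e dvd n" for n
    using I0 by (auto simp: d'_def j'_def I_def)
  have "tuple_lcm k d \<ge> 1" unfolding tuple_lcm_def using tuplesD[OF d] by (intro Lcm_le_prod) auto
  then have L: "lcm e (tuple_lcm k d) > 0" using e by (simp add: lcm_pos_nat)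
  show ?thesis
    using count_residue_class(2)[OF L JN, of x] True unfolding x[symmetric] ins by (simp add: lcm.commute)
qed

lemma squarefree_eq_prod_prime_factors:
  assumes "squarefree (g :: nat)"
  shows "g = \<Prod>(prime_factors g)"
proof -
  have g: "g > 0" using assms by (metis gr0I not_squarefree_0)
  have "g = (\<Prod>p\<in>prime_factors g. p ^ multiplicity p g)" by (rule prime_factorization_nat[OF g])
  also have "\<dots> = (\<Prod>p\<in>prime_factors g. p)"
    using assms g squarefree_factorial_semiring'[of g] by (intro prod.cong) auto
  finally show ?thesis .
qed

lemma prime_dvd_Lcm:
  fixes d :: "'a \<Rightarrow> nat"
  assumes "finite I" "prime p" "p dvd Lcm (d ` I)" "\<And>i. i \<in> I \<Longrightarrow> d i \<ge> 1"
  shows "\<exists>i\<in>I. p dvd d i"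
proof -
  have "Lcm (d ` I) dvd (\<Prod>i\<in>I. d i)" using assms(1) by (auto simp: Lcm_dvd_iff)
  then have "p dvd (\<Prod>i\<in>I. d i)" using assms(3) by (rule dvd_trans[rotated])
  then show ?thesis using assms(1,2) by (simp add: prime_dvd_prod_iff)
qed

lemma divide_totient:
  assumes "D > 0"
  shows "real D / real (totient D) = (\<Prod>p\<in>prime_factors D. real p / (real p - 1))"
proof -
  have "real (totient D) = real D * (\<Prod>p\<in>prime_factors D. 1 - 1 / real p)" by (rule totient_formula2)
  then have "real D / real (totient D) = 1 / (\<Prod>p\<in>prime_factors D. 1 - 1 / real p)" using assms by simp
  also have "\<dots> = (\<Prod>p\<in>prime_factors D. 1 / (1 - 1 / real p))" by (simp add: prod_dividef)
  also have "\<dots> = (\<Prod>p\<in>prime_factors D. real p / (real p - 1))"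
  proof (rule prod.cong[OF refl])
    fix p assume "p \<in> prime_factors D"
    then have "p > 1" using prime_gt_1_nat by auto
    then show "1 / (1 - 1 / real p) = real p / (real p - 1)" by (simp add: field_simps)
  qed
  finally show ?thesis .
qed

context pnt_error
begin

text \<open>For squarefree e the conditions on the gcds only say which primes of D may divide e,
  namely those in A below. Multiplied by D the sum becomes a \<open>moebius_log_sum\<close> with
  weight gcd(D, e)/e, whose main term is D/phi(D) if A is empty and 0 otherwise.\<close>

lemma tuple_main_term:
  assumes d: "d \<in> tuples k R" and R: "R \<ge> 1" and sqf: "\<And>i. i \<in> {1..k-1} \<Longrightarrow> squarefree (d i)"
    and co: "compatible_tuple k j d" and j: "\<And>i. i \<in> {1..k-1} \<Longrightarrow> j i \<noteq> 0 \<and> \<bar>j i\<bar> \<le> int J"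
  shows "\<bar>(\<Sum>e\<in>nle R. if \<forall>i\<in>{1..k-1}. int (gcd (d i) e) dvd j i
        then moebius e * ln (R / real e) / real (lcm (tuple_lcm k d) e) else 0)
      - (if shift_coprime k j d then 1 / real (totient (tuple_lcm k d)) else 0)\<bar>
    \<le> K * Edec c (R / real J ^ (k - 1)) * (real (tau (tuple_lcm k d)) ^ 3 / real (tuple_lcm k d))"
proof -
  define D where "D = tuple_lcm k d"
  define I where "I = {1..k-1}"
  have D1: "D \<ge> 1" unfolding D_def tuple_lcm_def using tuplesD[OF d] by (intro Lcm_le_prod) auto
  \<comment> \<open>A prime p of D may divide e precisely when it divides j_i for every i with p |
    d_i; the other primes of D form B.\<close>
  define A where "A = {p \<in> prime_factors D. \<forall>i\<in>I. p dvd d i \<longrightarrow> int p dvd j i}"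
  define B where "B = prime_factors D - A"
  define w where "w e = real (\<Prod>p | p \<in> A \<and> p dvd e. p) / real e" for e
  have di: "d i dvd D" if "i \<in> I" for i
    unfolding D_def tuple_lcm_def using that by (auto simp: I_def)
  have pD: "\<exists>i\<in>I. p dvd d i" if "p \<in> prime_factors D" for p
    using prime_dvd_Lcm[of "{1..k-1}" p d] that tuplesD[OF d] unfolding D_def tuple_lcm_def I_def
    by (auto simp: in_prime_factors_iff)
  have fin: "finite A" "finite B" by (simp_all add: A_def B_def)
  have disj: "A \<inter> B = {}" by (auto simp: B_def)
  have un: "A \<union> B = prime_factors D" by (auto simp: A_def B_def)
  have pr: "prime p" if "p \<in> A \<union> B" for p using that unfolding un by auto
  have term_eq: "real D * (if \<forall>i\<in>I. int (gcd (d i) e) dvd j i then moebius e * ln (R / real e) / real (lcm D e) else 0)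
     = (if \<forall>q\<in>B. \<not> q dvd e then moebius e * w e * ln (R / real e) else 0)" if e: "e \<in> nle R" for e
  proof (cases "squarefree e")
    case False
    then show ?thesis by (simp add: moebius_def)
  next
    case sq: True
    have e1: "e \<ge> 1" using e by (simp add: nle_def)
    have iff: "(\<forall>i\<in>I. int (gcd (d i) e) dvd j i) \<longleftrightarrow> (\<forall>q\<in>B. \<not> q dvd e)"
    proof (intro iffI ballI notI)
      fix q assume h: "\<forall>i\<in>I. int (gcd (d i) e) dvd j i" "q \<in> B" "q dvd e"
      then obtain i where i: "i \<in> I" "q dvd d i" "\<not> int q dvd j i"
        unfolding B_def A_def by blast
      have "q dvd gcd (d i) e" using i h by simp
      then have "int q dvd j i" using h i by (meson dvd_trans of_nat_dvd_iff)
      then show False using i by simp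
    next
      fix i assume h: "\<forall>q\<in>B. \<not> q dvd e" "i \<in> I"
      define g where "g = gcd (d i) e"
      have "squarefree g" unfolding g_def using sq by (rule squarefree_mono[rotated]) simp
      then have "g = \<Prod>(prime_factors g)" by (rule squarefree_eq_prod_prime_factors)
      moreover have "\<Prod>(prime_factors g) dvd nat \<bar>j i\<bar>"
      proof (rule prod_primes_dvd)
        fix p assume p: "p \<in> prime_factors g"
        then have pp: "prime p" "p dvd d i" "p dvd e" unfolding g_def by (auto dest: in_prime_factors_imp_dvd)
        have "p \<in> prime_factors D" using pp di[OF h(2)] D1 by (auto simp: in_prime_factors_iff)
        moreover have "p \<notin> B" using pp h by blast
        ultimately have "p \<in> A" using un by blast
        then have "int p dvd j i" using pp h by (simp add: A_def)
        then show "p dvd nat \<bar>j i\<bar>" by (simp only: dvd_nat_abs_iff)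
      qed auto
      ultimately have "g dvd nat \<bar>j i\<bar>" by metis
      then show "int (gcd (d i) e) dvd j i" by (simp only: dvd_nat_abs_iff g_def)
    qed
    show ?thesis
    proof (cases "\<forall>q\<in>B. \<not> q dvd e")
      case True
      have "prime_factors (gcd D e) = {p \<in> A. p dvd e}"
      proof -
        have "p \<in> prime_factors (gcd D e) \<longleftrightarrow> p \<in> prime_factors D \<and> p dvd e" for p
          using D1 e1 by (auto simp: in_prime_factors_iff)
        then show ?thesis using True un by blast
      qed
      moreover have "squarefree (gcd D e)" using sq by (rule squarefree_mono[rotated]) simp
      ultimately have g: "gcd D e = (\<Prod>p | p \<in> A \<and> p dvd e. p)"
        using squarefree_eq_prod_prime_factors[of "gcd D e"] by simp
      have "real (gcd D e) * real (lcm D e) = real D * real e"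
        by (metis of_nat_mult prod_gcd_lcm_nat)
      then have "real D / real (lcm D e) = w e"
        unfolding w_def g[symmetric] using D1 e1 by (simp add: field_simps lcm_pos_nat)
      moreover have "real D * (moebius e * ln (R / real e) / real (lcm D e)) = moebius e * (real D / real (lcm D e)) * ln (R / real e)"
        by simp
      ultimately show ?thesis unfolding iff if_P[OF True] by simp
    next
      case False
      show ?thesis unfolding iff if_not_P[OF False] by simp
    qed
  qed
  define Q where "Q = (\<Sum>e\<in>nle R. if \<forall>i\<in>I. int (gcd (d i) e) dvd j i then moebius e * ln (R / real e) / real (lcm D e) else 0)"
  have "real D * Q = (\<Sum>e\<in>nle R. if \<forall>q\<in>B. \<not> q dvd e then moebius e * w e * ln (R / real e) else 0)"
    unfolding Q_def sum_distrib_left by (rule sum.cong[OF refl term_eq])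
  also have "\<dots> = moebius_log_sum w B R"
    unfolding moebius_log_sum_def by (rule sum.inter_filter[symmetric]) simp
  finally have DQ: "real D * Q = moebius_log_sum w B R" .
  \<comment> \<open>Compatibility is essential here: if p divides d_i and j_i, it also divides j_s
    for every s with p | d_s, because it divides the gcd of the moduli and hence j_s - j_i. One
    failure of coprimality thus puts p into A.\<close>
  have A_iff: "A = {} \<longleftrightarrow> shift_coprime k j d"
  proof
    assume A0: "A = {}"
    show "shift_coprime k j d"
      unfolding shift_coprime_def
    proof
      fix i assume i: "i \<in> {1..k-1}"
      show "coprime (int (d i)) (j i)"
      proof (rule ccontr)
        assume "\<not> coprime (int (d i)) (j i)"
        then have "\<not> coprime (d i) (nat \<bar>j i\<bar>)" by (simp add: coprime_nat_abs_right_iff)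
        then have "gcd (d i) (nat \<bar>j i\<bar>) \<noteq> 1" by (simp add: coprime_iff_gcd_eq_1)
        then obtain p where "prime p" "p dvd gcd (d i) (nat \<bar>j i\<bar>)"
          using prime_factor_nat by blast
        then have p: "prime p" "p dvd d i" "p dvd nat \<bar>j i\<bar>"
          using gcd_dvd1 gcd_dvd2 dvd_trans by blast+
        have pj: "int p dvd j i" using p(3) by (simp only: dvd_nat_abs_iff)
        have "int p dvd j s" if s: "s \<in> I" "p dvd d s" for s
        proof -
          have "int p dvd int (gcd (d i) (d s))" using p s by simp
          also have "\<dots> dvd j s - j i" using compatible_tupleD[OF co i] s by (simp add: I_def)
          finally have "int p dvd (j s - j i) + j i" using pj by (rule dvd_add)
          then show ?thesis by simp
        qed
        moreover have "p \<in> prime_factors D" using p di[of i] i D1 by (auto simp: in_prime_factors_iff I_def intro: dvd_trans)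
        ultimately have "p \<in> A" by (simp add: A_def)
        then show False using A0 by simp
      qed
    qed
  next
    assume sc: "shift_coprime k j d"
    show "A = {}"
    proof (rule ccontr)
      assume "A \<noteq> {}"
      then obtain p where p: "p \<in> A" by blast
      then obtain i where i: "i \<in> I" "p dvd d i" "int p dvd j i" using pD by (auto simp: A_def)
      then have "is_unit (int p)" using sc coprime_common_divisor[of "int (d i)" "j i" "int p"]
        by (simp add: shift_coprime_def I_def)
      then show False using pr[of p] p by (auto simp: not_prime_1)
    qed
  qed
  have prodA: "real (\<Prod>A) \<ge> 1" "real (\<Prod>A) \<le> real J ^ (k - 1)"
  proof -
    have "\<Prod>A > 0" using pr by (intro prod_pos) (auto simp: prime_gt_0_nat)
    then show "real (\<Prod>A) \<ge> 1" by linarith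
    have ji: "nat \<bar>j i\<bar> > 0 \<and> nat \<bar>j i\<bar> \<le> J" if "i \<in> {1..k-1}" for i using j[OF that] by auto
    have "\<Prod>A dvd (\<Prod>i\<in>{1..k-1}. nat \<bar>j i\<bar>)"
    proof (rule prod_primes_dvd[OF fin(1)])
      fix p assume p: "p \<in> A"
      then show "prime p" using pr by blast
      obtain i where i: "i \<in> I" "int p dvd j i" using pD p by (auto simp: A_def)
      then have "p dvd nat \<bar>j i\<bar>" by (simp only: dvd_nat_abs_iff)
      also have "\<dots> dvd (\<Prod>i\<in>{1..k-1}. nat \<bar>j i\<bar>)" using i by (intro dvd_prodI) (auto simp: I_def)
      finally show "p dvd (\<Prod>i\<in>{1..k-1}. nat \<bar>j i\<bar>)" .
    qed
    moreover have "(\<Prod>i\<in>{1..k-1}. nat \<bar>j i\<bar>) > 0" using ji by (intro prod_pos) auto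
    ultimately have "\<Prod>A \<le> (\<Prod>i\<in>{1..k-1}. nat \<bar>j i\<bar>)" by (rule dvd_imp_le)
    also have "\<dots> \<le> (\<Prod>i\<in>{1..k-1}. J)" using ji by (intro prod_mono) auto
    finally have "\<Prod>A \<le> J ^ (k - 1)" by simp
    then show "real (\<Prod>A) \<le> real J ^ (k - 1)" by (metis of_nat_le_iff of_nat_power)
  qed
  have main: "\<bar>real D * Q - (if A = {} then \<Prod>p\<in>B. real p / (real p - 1) else 0)\<bar> \<le> K * 8 ^ card A * 4 ^ card B * Edec c (R / real (\<Prod>A))"
    unfolding DQ w_def using R by (intro mixed_moebius_log_sum fin disj pr) auto
  have tgt: "(if A = {} then \<Prod>p\<in>B. real p / (real p - 1) else 0) = real D * (if shift_coprime k j d then 1 / real (totient D) else 0)"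
    using A_iff divide_totient[of D] D1 by (auto simp: B_def)
  \<comment> \<open>Both costs are raised to 8 = 2^3 per prime of D, and 2^omega(D) <= tau(D); this
    is the origin of the third power of tau.\<close>
  have t8: "(8::real) ^ card A * 4 ^ card B \<le> real (tau D) ^ 3"
  proof -
    have "(8::real) ^ card A * 4 ^ card B \<le> 8 ^ card A * 8 ^ card B" by (intro mult_left_mono power_mono) auto
    also have "\<dots> = 8 ^ card (prime_factors D)"
      using card_Un_disjoint[OF fin disj] unfolding un by (simp add: power_add)
    also have "\<dots> = (real (2 ^ card (prime_factors D))) ^ 3"
      by (simp add: power_mult[symmetric] mult.commute) (simp add: power_mult)
    also have "\<dots> \<le> real (tau D) ^ 3"
      using two_power_card_prime_factors_le_tau[of D "prime_factors D"] D1 by (intro power_mono) (auto simp only: of_nat_le_iff)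
    finally show ?thesis .
  qed
  have "real J ^ (k - 1) > 0" using prodA by linarith
  then have "Edec c (R / real (\<Prod>A)) \<le> Edec c (R / real J ^ (k - 1))"
    using prodA R c by (intro Edec_antimono divide_left_mono) auto
  then have "K * (8 ^ card A * 4 ^ card B) * Edec c (R / real (\<Prod>A)) \<le> K * real (tau D) ^ 3 * Edec c (R / real J ^ (k - 1))"
    using t8 K Edec_pos[of c] by (intro mult_mono mult_left_mono) (auto simp: less_imp_le)
  then have "real D * \<bar>Q - (if shift_coprime k j d then 1 / real (totient D) else 0)\<bar> \<le> K * real (tau D) ^ 3 * Edec c (R / real J ^ (k - 1))"
    using main unfolding tgt right_diff_distrib[symmetric] abs_mult by (simp add: mult.assoc)
  then have "\<bar>Q - (if shift_coprime k j d then 1 / real (totient D) else 0)\<bar> \<le> (K * real (tau D) ^ 3 * Edec c (R / real J ^ (k - 1))) / real D"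
    using D1 by (simp add: pos_le_divide_eq mult.commute)
  then show ?thesis unfolding Q_def D_def I_def by (simp add: mult_ac)
qed

end

lemma card_nat_int_interval:
  "card {n \<in> {int J<..int N}. P n} = card {n \<in> {J<..N}. P (int n)}"
proof -
  have "bij_betw int {n \<in> {J<..N}. P (int n)} {n \<in> {int J<..int N}. P n}"
    by (rule bij_betwI[where g = nat]) auto
  then show ?thesis by (rule bij_betw_same_card[symmetric])
qed

lemma sum_LambdaT_class:
  assumes "\<And>n. n \<in> A \<Longrightarrow> n > 0" "finite A"
  shows "(\<Sum>n\<in>A. if P n then LambdaT R (int n) else 0)
    = (\<Sum>e\<in>nle R. moebius e * ln (R / real e) * real (card {n \<in> A. P n \<and> int e dvd int n}))"
proof -
  have "(\<Sum>n\<in>A. if P n then LambdaT R (int n) else 0)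
     = (\<Sum>n\<in>A. \<Sum>e\<in>nle R. if P n \<and> int e dvd int n then moebius e * ln (R / real e) else 0)"
  proof (rule sum.cong[OF refl])
    fix n assume "n \<in> A"
    then have "int n > 0" using assms by simp
    then show "(if P n then LambdaT R (int n) else 0) = (\<Sum>e\<in>nle R. if P n \<and> int e dvd int n then moebius e * ln (R / real e) else 0)"
      by (simp only: LambdaT_eq) (cases "P n"; simp)
  qed
  also have "\<dots> = (\<Sum>e\<in>nle R. \<Sum>n\<in>A. if P n \<and> int e dvd int n then moebius e * ln (R / real e) else 0)"
    by (rule sum.swap)
  also have "\<dots> = (\<Sum>e\<in>nle R. moebius e * ln (R / real e) * real (card {n \<in> A. P n \<and> int e dvd int n}))"
  proof (rule sum.cong[OF refl])
    fix e
    have "(\<Sum>n\<in>A. if P n \<and> int e dvd int n then moebius e * ln (R / real e) else 0)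
       = (\<Sum>n | n \<in> A \<and> P n \<and> int e dvd int n. moebius e * ln (R / real e))"
      using assms(2) by (intro sum.inter_filter[symmetric])
    then show "(\<Sum>n\<in>A. if P n \<and> int e dvd int n then moebius e * ln (R / real e) else 0)
       = moebius e * ln (R / real e) * real (card {n \<in> A. P n \<and> int e dvd int n})"
      by (simp only: sum_constant mult.commute)
  qed
  finally show ?thesis .
qed

lemma no_solution_if_not_compatible:
  assumes "\<not> compatible_tuple k j d"
  shows "\<not> (\<forall>i\<in>{1..k-1}. int (d i) dvd n + j i)"
  using compatible_tupleI[of k d n j] assms by blast

lemma sum_abs_moebius_ln_le:
  assumes R: "R \<ge> 1"
  shows "(\<Sum>e\<in>nle R. \<bar>moebius e * ln (R / real e)\<bar>) \<le> R"
proof -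
  have "(\<Sum>e\<in>nle R. \<bar>moebius e * ln (R / real e)\<bar>) \<le> (\<Sum>e\<in>nle R. ln (R / real e))"
  proof (rule sum_mono)
    fix d assume "d \<in> nle R"
    then have "ln (R / real d) \<ge> 0" by (auto simp: nle_def intro!: ln_ge_zero)
    then show "\<bar>moebius d * ln (R / real d)\<bar> \<le> ln (R / real d)"
      unfolding abs_mult using abs_moebius_le[of d] by (simp add: mult_left_le_one_le)
  qed
  then show ?thesis using sum_ln_quotient_le[OF R] by linarith
qed

section \<open>Correlations of the truncated sums\<close>

context pnt_error
begin

text \<open>Counting a residue class costs an error of at most 1 for each pair of a tuple and e,
  with coefficients of total size R^(k-1) and R: this is R^k. The other error is that of
  \<open>tuple_main_term\<close>, with tau^3 on top of the k - 1 multiplicities.\<close>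

theorem correlation_truncated:
  assumes R: "R \<ge> 1" and JN: "J \<le> N" and k: "k \<ge> 1"
    and j: "\<And>i. i \<in> {1..k-1} \<Longrightarrow> j i \<noteq> 0 \<and> \<bar>j i\<bar> \<le> int J"
  shows "\<bar>(\<Sum>n\<in>{J<..N}. (\<Prod>i=1..k-1. LambdaT R (int n + j i)) * LambdaT R (int n)) - (real N - real J) * W k R j\<bar>
    \<le> R ^ k + real N * (K * Edec c (R / real J ^ (k - 1))) * (ln R ^ (k - 1) * (1 + real (k - 1) * ln R) ^ (2 ^ (k - 1 + 3)))"
proof -
  define KE where "KE = K * Edec c (R / real J ^ (k - 1))"
  have KE0: "KE \<ge> 0" unfolding KE_def using K Edec_pos[of c] by (simp add: less_imp_le)
  define inner where "inner d = (\<Sum>n\<in>{J<..N}. if \<forall>i\<in>{1..k-1}. int (d i) dvd int n + j i then LambdaT R (int n) else 0)" for d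
  define tgt where "tgt d = (if shift_coprime k j d \<and> compatible_tuple k j d then 1 / real (totient (tuple_lcm k d)) else 0)" for d
  define cf where "cf = tuple_coeff k R"
  have "(\<Sum>n\<in>{J<..N}. (\<Prod>i=1..k-1. LambdaT R (int n + j i)) * LambdaT R (int n)) = (\<Sum>d\<in>tuples k R. cf d * inner d)"
    unfolding inner_def cf_def
  proof (rule correlation_expand)
    fix n i assume "n \<in> {J<..N}" "i \<in> {1..k-1}"
    then show "int n + j i > 0" using j[of i] by auto
  qed
  moreover have "W k R j = (\<Sum>d\<in>tuples k R. cf d * tgt d)"
    unfolding W_eq cf_def tgt_def by (intro sum.cong) auto
  ultimately have e: "(\<Sum>n\<in>{J<..N}. (\<Prod>i=1..k-1. LambdaT R (int n + j i)) * LambdaT R (int n)) - (real N - real J) * W k R j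
     = (\<Sum>d\<in>tuples k R. cf d * (inner d - (real N - real J) * tgt d))"
    by (simp add: sum_distrib_left sum_subtractf sum.distrib algebra_simps)
  have per: "\<bar>cf d * (inner d - (real N - real J) * tgt d)\<bar>
     \<le> \<bar>cf d\<bar> * R + real N * KE * (\<bar>cf d\<bar> * (real (tau (tuple_lcm k d)) ^ 3 / real (tuple_lcm k d)))"
    if d: "d \<in> tuples k R" for d
  \<comment> \<open>Tuples with vanishing coefficient are set aside first, so that all entries of
    the remaining ones are squarefree.\<close>
  proof (cases "cf d = 0 \<or> \<not> compatible_tuple k j d")
    case True
    have "cf d = 0 \<or> inner d = 0 \<and> tgt d = 0"
    proof (cases "cf d = 0")
      case False
      then have nc: "\<not> compatible_tuple k j d" using True by blast
      then have "inner d = 0" unfolding inner_def using no_solution_if_not_compatible by (intro sum.neutral ballI if_not_P) blast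
      then show ?thesis using nc by (simp add: tgt_def)
    qed simp
    then show ?thesis using R KE0 by auto
  next
    case False
    then have co: "compatible_tuple k j d" and c0: "cf d \<noteq> 0" by auto
    have sqf: "squarefree (d i)" if "i \<in> {1..k-1}" for i
    proof (rule moebius_squarefreeD)
      show "moebius (d i) \<noteq> 0" using c0 that unfolding cf_def tuple_coeff_def by (auto simp: prod_zero_iff)
    qed
    define cond where "cond e \<longleftrightarrow> (\<forall>i\<in>{1..k-1}. int (gcd (d i) e) dvd j i)" for e
    define Q where "Q = (\<Sum>e\<in>nle R. if cond e then moebius e * ln (R / real e) / real (lcm (tuple_lcm k d) e) else 0)"
    have Q: "\<bar>Q - tgt d\<bar> \<le> KE * (real (tau (tuple_lcm k d)) ^ 3 / real (tuple_lcm k d))"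
      using tuple_main_term[OF d R sqf co j] co unfolding Q_def cond_def tgt_def KE_def by simp
    define cnt where "cnt e = real (card {n \<in> {int J<..int N}. (\<forall>i\<in>{1..k-1}. int (d i) dvd n + j i) \<and> int e dvd n})" for e
    have inner: "inner d = (\<Sum>e\<in>nle R. moebius e * ln (R / real e) * cnt e)"
      unfolding inner_def cnt_def card_nat_int_interval by (rule sum_LambdaT_class) auto
    have "inner d - (real N - real J) * Q = (\<Sum>e\<in>nle R. moebius e * ln (R / real e) * (cnt e - (if cond e then (real N - real J) / real (lcm (tuple_lcm k d) e) else 0)))"
      unfolding inner Q_def sum_distrib_left sum_subtractf[symmetric] by (rule sum.cong) (auto simp: algebra_simps diff_divide_distrib)
    also have "\<bar>\<dots>\<bar> \<le> (\<Sum>e\<in>nle R. \<bar>moebius e * ln (R / real e)\<bar> * 1)"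
    proof (rule order_trans[OF sum_abs sum_mono])
      fix e assume "e \<in> nle R"
      then have e1: "e \<ge> 1" by (simp add: nle_def)
      have "int J \<le> int N" using JN by simp
      from tuple_count[OF d co e1 this]
      have "\<bar>cnt e - (if cond e then (real N - real J) / real (lcm (tuple_lcm k d) e) else 0)\<bar> \<le> 1"
        unfolding cnt_def cond_def of_int_of_nat_eq .
      then show "\<bar>moebius e * ln (R / real e) * (cnt e - (if cond e then (real N - real J) / real (lcm (tuple_lcm k d) e) else 0))\<bar>
         \<le> \<bar>moebius e * ln (R / real e)\<bar> * 1"
        unfolding abs_mult[of "moebius e * ln (R / real e)"] by (intro mult_left_mono) auto
    qed
    also have "\<dots> \<le> R" using sum_abs_moebius_ln_le[OF R] by simp
    finally have i1: "\<bar>inner d - (real N - real J) * Q\<bar> \<le> R" .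
    have "\<bar>(real N - real J) * (Q - tgt d)\<bar> \<le> real N * (KE * (real (tau (tuple_lcm k d)) ^ 3 / real (tuple_lcm k d)))"
      unfolding abs_mult using Q JN by (intro mult_mono) auto
    moreover have "inner d - (real N - real J) * tgt d = (inner d - (real N - real J) * Q) + (real N - real J) * (Q - tgt d)"
      by (simp add: algebra_simps)
    ultimately have "\<bar>inner d - (real N - real J) * tgt d\<bar> \<le> R + real N * (KE * (real (tau (tuple_lcm k d)) ^ 3 / real (tuple_lcm k d)))"
      using i1 by linarith
    then have "\<bar>cf d\<bar> * \<bar>inner d - (real N - real J) * tgt d\<bar> \<le> \<bar>cf d\<bar> * (R + real N * (KE * (real (tau (tuple_lcm k d)) ^ 3 / real (tuple_lcm k d))))"
      by (rule mult_left_mono) simp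
    then show ?thesis unfolding abs_mult by (simp add: algebra_simps)
  qed
  have "\<bar>\<Sum>d\<in>tuples k R. cf d * (inner d - (real N - real J) * tgt d)\<bar>
    \<le> (\<Sum>d\<in>tuples k R. \<bar>cf d\<bar> * R + real N * KE * (\<bar>cf d\<bar> * (real (tau (tuple_lcm k d)) ^ 3 / real (tuple_lcm k d))))"
    by (rule order_trans[OF sum_abs sum_mono[OF per]])
  also have "\<dots> = (\<Sum>d\<in>tuples k R. \<bar>cf d\<bar>) * R + real N * KE * (\<Sum>d\<in>tuples k R. \<bar>cf d\<bar> * (real (tau (tuple_lcm k d)) ^ 3 / real (tuple_lcm k d)))"
    by (simp only: sum.distrib sum_distrib_left sum_distrib_right)
  also have "\<dots> \<le> R ^ (k - 1) * R + real N * KE * (ln R ^ (k - 1) * (1 + real (k - 1) * ln R) ^ (2 ^ (k - 1 + 3)))"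
    unfolding cf_def using R KE0
    by (intro add_mono mult_right_mono mult_left_mono sum_abs_tuple_coeff_le sum_tau_tuple_le) auto
  also have "R ^ (k - 1) * R = R ^ k" using k by (simp add: power_eq_if)
  finally show ?thesis unfolding e KE_def .
qed

end

section \<open>Crude bounds and the passage to the von Mangoldt function\<close>

lemma abs_W_le:
  assumes R: "R \<ge> 1"
  shows "\<bar>W k R j\<bar> \<le> ln R ^ (k - 1) * (1 + real (k - 1) * ln R) ^ (2 ^ (k - 1 + 1))"
proof -
  have "\<bar>W k R j\<bar> \<le> (\<Sum>d\<in>tuples k R. \<bar>tuple_coeff k R d\<bar> * (real (tau (tuple_lcm k d)) ^ 1 / real (tuple_lcm k d)))"
    unfolding W_eq
  proof (rule order_trans[OF sum_abs sum_mono])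
    fix d assume d: "d \<in> tuples k R"
    define D where "D = tuple_lcm k d"
    have D: "D \<ge> 1" using tuple_lcm_in_nle[OF d R] by (simp add: D_def nle_def)
    then have "real D \<le> real (totient D) * real (tau D)" "real (totient D) > 0"
      using le_totient_tau[of D] by (auto simp flip: of_nat_mult)
    then have "1 / real (totient D) \<le> real (tau D) / real D" using D by (simp add: field_simps)
    then have "\<bar>tuple_coeff k R d\<bar> * (1 / real (totient D)) \<le> \<bar>tuple_coeff k R d\<bar> * (real (tau D) / real D)"
      by (intro mult_left_mono) auto
    then show "\<bar>if shift_coprime k j d \<and> compatible_tuple k j d then tuple_coeff k R d / real (totient (tuple_lcm k d)) else 0\<bar>
      \<le> \<bar>tuple_coeff k R d\<bar> * (real (tau (tuple_lcm k d)) ^ 1 / real (tuple_lcm k d))"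
      unfolding D_def[symmetric] by auto
  qed
  also have "\<dots> \<le> ln R ^ (k - 1) * (1 + real (k - 1) * ln R) ^ (2 ^ (k - 1 + 1))"
    by (rule sum_tau_tuple_le[OF R])
  finally show ?thesis .
qed

text \<open>For n <= J every argument n + j_i is at most 2 J, and nonpositive ones contribute
  0.\<close>

lemma mixed_corr_head:
  assumes R: "R \<ge> 1" and JN: "J \<le> N" and j: "\<And>i. i \<in> {1..k-1} \<Longrightarrow> \<bar>j i\<bar> \<le> int J"
    and G: "\<And>n. 1 \<le> n \<Longrightarrow> n \<le> J \<Longrightarrow> \<bar>LambdaT P (int n)\<bar> \<le> G"
  shows "\<bar>mixed_corr k R P N j - (\<Sum>n\<in>{J<..N}. (\<Prod>i=1..k-1. LambdaT R (int n + j i)) * LambdaT P (int n))\<bar>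
    \<le> real J * ((2 * real J * ln R) ^ (k - 1) * G)"
proof -
  have "{1..N} = {1..J} \<union> {J<..N}" using JN by auto
  then have "mixed_corr k R P N j = (\<Sum>n\<in>{1..J}. (\<Prod>i=1..k-1. LambdaT R (int n + j i)) * LambdaT P (int n))
     + (\<Sum>n\<in>{J<..N}. (\<Prod>i=1..k-1. LambdaT R (int n + j i)) * LambdaT P (int n))"
    unfolding mixed_corr_def by (simp only:) (rule sum.union_disjoint, auto)
  moreover have "\<bar>\<Sum>n\<in>{1..J}. (\<Prod>i=1..k-1. LambdaT R (int n + j i)) * LambdaT P (int n)\<bar>
    \<le> (\<Sum>n\<in>{1..J}. (2 * real J * ln R) ^ (k - 1) * G)"
  proof (rule order_trans[OF sum_abs sum_mono])
    fix n assume n: "n \<in> {1..J}"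
    have "\<bar>LambdaT R (int n + j i)\<bar> \<le> 2 * real J * ln R" if i: "i \<in> {1..k-1}" for i
    proof (cases "int n + j i > 0")
      case True
      then have "\<bar>LambdaT R (int n + j i)\<bar> \<le> of_int (int n + j i) * ln R" by (rule abs_LambdaT_le[OF R])
      also have "\<dots> \<le> (2 * real J) * ln R"
      proof (rule mult_right_mono)
        have "int n + j i \<le> 2 * int J" using n j[OF i] by auto
        then have "real_of_int (int n + j i) \<le> real_of_int (2 * int J)" by (simp only: of_int_le_iff)
        then show "real_of_int (int n + j i) \<le> 2 * real J" by simp
      qed (use R in simp)
      finally show ?thesis .
    qed (use R in \<open>simp add: LambdaT_def\<close>)
    then have "(\<Prod>i=1..k-1. \<bar>LambdaT R (int n + j i)\<bar>) \<le> (\<Prod>i=1..k-1. 2 * real J * ln R)"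
      by (intro prod_mono) auto
    then have "\<bar>\<Prod>i=1..k-1. LambdaT R (int n + j i)\<bar> \<le> (2 * real J * ln R) ^ (k - 1)"
      by (simp add: abs_prod)
    then show "\<bar>(\<Prod>i=1..k-1. LambdaT R (int n + j i)) * LambdaT P (int n)\<bar> \<le> (2 * real J * ln R) ^ (k - 1) * G"
      unfolding abs_mult using G[of n] n R by (intro mult_mono) auto
  qed
  ultimately show ?thesis by simp
qed

text \<open>With log written as the divisor sum of the von Mangoldt function, interchanging the sums
  leaves the divisor sum of mu over n/e, which singles out e = n.\<close>

lemma moebius_inversion_mangoldt:
  assumes n: "n > 0"
  shows "(\<Sum>d | d dvd n. moebius d * ln (real n / real d)) = mangoldt n"
proof -
  define S where "S = {d. d dvd n}"
  have fS: "finite S" using n by (simp add: S_def)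
  have S0: "d > 0" if "d \<in> S" for d using that n by (auto simp: S_def intro: dvd_pos_nat)
  have sub: "{e. e dvd n div d} = {e \<in> S. d * e dvd n}" if "d \<in> S" for d
  proof -
    have "e dvd n div d \<longleftrightarrow> d * e dvd n" for e
      using dvd_div_iff_mult[of d n e] that S0[OF that] by (simp add: S_def mult.commute)
    then show ?thesis by (auto simp: S_def dest: dvd_mult_right)
  qed
  have "(\<Sum>d\<in>S. moebius d * ln (real n / real d)) = (\<Sum>d\<in>S. \<Sum>e\<in>S. if d * e dvd n then moebius d * mangoldt e else 0)"
  proof (rule sum.cong[OF refl])
    fix d assume d: "d \<in> S"
    have "n div d > 0" using d n dvd_div_ge_1[of n d] by (simp add: S_def)
    then have "ln (real (n div d)) = (\<Sum>e | e dvd n div d. mangoldt e)"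
      using mangoldt_sum[of "n div d", where 'a=real] by simp
    moreover have "real (n div d) = real n / real d" using d by (simp add: S_def real_of_nat_div)
    ultimately have "moebius d * ln (real n / real d) = (\<Sum>e | e \<in> S \<and> d * e dvd n. moebius d * mangoldt e)"
      unfolding sub[OF d] by (simp add: sum_distrib_left)
    also have "\<dots> = (\<Sum>e\<in>S. if d * e dvd n then moebius d * mangoldt e else 0)"
      by (rule sum.inter_filter[OF fS])
    finally show "moebius d * ln (real n / real d) = (\<Sum>e\<in>S. if d * e dvd n then moebius d * mangoldt e else 0)" .
  qed
  also have "\<dots> = (\<Sum>e\<in>S. \<Sum>d\<in>S. if e * d dvd n then mangoldt e * moebius d else 0)"
    by (subst sum.swap) (intro sum.cong refl, simp add: mult.commute)
  also have "\<dots> = (\<Sum>e\<in>S. if e = n then mangoldt e else 0)"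
  proof (rule sum.cong[OF refl])
    fix e assume e: "e \<in> S"
    have "(\<Sum>d\<in>S. if e * d dvd n then mangoldt e * moebius d else 0) = (\<Sum>d | d \<in> S \<and> e * d dvd n. mangoldt e * moebius d)"
      by (rule sum.inter_filter[OF fS, symmetric])
    also have "\<dots> = mangoldt e * (\<Sum>d | d dvd n div e. moebius d)"
      unfolding sub[OF e, symmetric] by (simp add: sum_distrib_left)
    also have "\<dots> = mangoldt e * (if n div e = 1 then 1 else 0)"
    proof -
      have "n div e > 0" using e n dvd_div_ge_1[of n e] by (simp add: S_def)
      then show ?thesis by (simp only: sum_moebius_divisors)
    qed
    also have "n div e = 1 \<longleftrightarrow> e = n"
      using e n dvd_div_ge_1(3)[of n e] by (auto simp: S_def)
    finally show "(\<Sum>d\<in>S. if e * d dvd n then mangoldt e * moebius d else 0) = (if e = n then mangoldt e else 0)"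
      by simp
  qed
  also have "\<dots> = mangoldt n" using fS by (simp add: S_def)
  finally show ?thesis by (simp add: S_def)
qed

text \<open>Splitting log(N/d) as log(n/d) + log(N/n), the second part multiplies the divisor sum of
  mu and survives only at n = 1.\<close>

lemma LambdaT_full:
  assumes n: "1 \<le> n" "n \<le> N"
  shows "LambdaT (real N) (int n) = mangoldt n + (if n = 1 then ln (real N) else 0)"
proof -
  have "{d. d dvd n \<and> real d \<le> real N} = {d. d dvd n}" using n dvd_imp_le[of _ n] by fastforce
  then have "LambdaT (real N) (int n) = (\<Sum>d | d dvd n. moebius d * ln (real N / real d))"
    using n by (simp add: LambdaT_def)
  also have "\<dots> = (\<Sum>d | d dvd n. moebius d * ln (real n / real d) + moebius d * ln (real N / real n))"
  proof (rule sum.cong[OF refl])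
    fix d assume "d \<in> {d. d dvd n}"
    then have "d > 0" using n by (auto intro: dvd_pos_nat)
    then show "moebius d * ln (real N / real d) = moebius d * ln (real n / real d) + moebius d * ln (real N / real n)"
      using n by (simp add: ln_div algebra_simps)
  qed
  also have "\<dots> = mangoldt n + (\<Sum>d | d dvd n. moebius d) * ln (real N / real n)"
    using moebius_inversion_mangoldt[of n] n by (simp add: sum.distrib sum_distrib_right)
  finally show ?thesis using sum_moebius_divisors[of n] n by auto
qed

section \<open>Averages over arithmetic progressions\<close>

text \<open>Only powers of p contribute, at most log N / log p of them with log p each. This
  disposes of residue classes that are not reduced.\<close>

lemma sum_mangoldt_multiples_le:
  assumes p: "prime p" and N: "N \<ge> 1"
  shows "(\<Sum>n | n \<in> {1..N} \<and> p dvd n. mangoldt n) \<le> ln (real N)"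
proof -
  define S where "S = {m. 1 \<le> m \<and> p ^ m \<le> N}"
  define M where "M = nat \<lfloor>ln (real N) / ln (real p)\<rfloor>"
  have p2: "p \<ge> 2" "ln (real p) > 0" using p prime_ge_2_nat[OF p] by auto
  have "S \<subseteq> {1..M}"
  proof
    fix m assume m: "m \<in> S"
    then have "real p ^ m \<le> real N" by (simp add: S_def flip: of_nat_power)
    then have "ln (real p ^ m) \<le> ln (real N)" using p2 by (intro ln_mono) auto
    then have "real m \<le> ln (real N) / ln (real p)" using p2 by (simp add: ln_realpow field_simps)
    then have "m \<le> M" unfolding M_def by linarith
    then show "m \<in> {1..M}" using m by (simp add: S_def)
  qed
  then have fS: "finite S" and cS: "card S \<le> M"
    using finite_subset[of S "{1..M}"] card_mono[of "{1..M}" S] by auto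
  have "(\<Sum>n | n \<in> {1..N} \<and> p dvd n. mangoldt n) = (\<Sum>n\<in>(\<lambda>m. p ^ m) ` S. mangoldt n :: real)"
  proof (rule sum.mono_neutral_right)
    show "(\<lambda>m. p ^ m) ` S \<subseteq> {n. n \<in> {1..N} \<and> p dvd n}"
      using p2 by (auto simp: S_def Suc_le_eq dvd_power)
    show "\<forall>n\<in>{n. n \<in> {1..N} \<and> p dvd n} - (\<lambda>m. p ^ m) ` S. mangoldt n = (0::real)"
    proof
      fix n assume n: "n \<in> {n. n \<in> {1..N} \<and> p dvd n} - (\<lambda>m. p ^ m) ` S"
      show "mangoldt n = (0::real)"
      proof (rule ccontr)
        assume "mangoldt n \<noteq> (0::real)"
        then have "primepow n" by (auto simp: mangoldt_def split: if_splits)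
        then obtain q m where q: "prime q" "m > 0" "n = q ^ m" unfolding primepow_def by blast
        have "p dvd q ^ m" using n q by simp
        then have "p = q" using p q by (metis prime_dvd_power primes_dvd_imp_eq)
        then have "m \<in> S" using n q by (simp add: S_def)
        then show False using n q \<open>p = q\<close> by blast
      qed
    qed
  qed simp
  also have "\<dots> \<le> (\<Sum>n\<in>(\<lambda>m. p ^ m) ` S. ln (real p))"
    using p by (intro sum_mono) (auto simp: S_def mangoldt_primepow)
  also have "\<dots> = real (card ((\<lambda>m. p ^ m) ` S)) * ln (real p)" by simp
  also have "\<dots> \<le> real M * ln (real p)"
    using p2 cS card_image_le[OF fS, of "\<lambda>m. p ^ m"] by (intro mult_right_mono) auto
  also have "\<dots> \<le> ln (real N) / ln (real p) * ln (real p)"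
    unfolding M_def using p2 N by (intro mult_right_mono) auto
  finally show ?thesis using p2 by simp
qed

definition E_max :: "real \<Rightarrow> nat \<Rightarrow> real" where
  "E_max x q = Max ((\<lambda>a. \<bar>E_ap x q a\<bar>) ` totatives q)"

lemma E_max_ge: "a \<in> totatives q \<Longrightarrow> \<bar>E_ap x q a\<bar> \<le> E_max x q"
  unfolding E_max_def by (intro Max_ge) auto

lemma E_max_nonneg: "q > 0 \<Longrightarrow> E_max x q \<ge> 0"
proof -
  assume "q > 0"
  then have "1 \<in> totatives q" by (auto simp: totatives_def Suc_le_eq)
  from E_max_ge[OF this, of x] show ?thesis by linarith
qed

lemma sum_mangoldt_class_le:
  assumes q: "q \<ge> 1" and N: "N \<ge> 1" "m \<le> N"
  shows "(\<Sum>n | n \<in> {1..m} \<and> int q dvd int n - x. mangoldt n) \<le> (real m / real q + 1) * ln (real N)"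
proof -
  have "(\<Sum>n | n \<in> {1..m} \<and> int q dvd int n - x. mangoldt n) \<le> (\<Sum>n | n \<in> {1..m} \<and> int q dvd int n - x. ln (real N))"
  proof (rule sum_mono)
    fix n assume n: "n \<in> {n. n \<in> {1..m} \<and> int q dvd int n - x}"
    then have "mangoldt n \<le> ln (real n)" by (intro mangoldt_le_ln) auto
    also have "\<dots> \<le> ln (real N)" using n N by (intro ln_mono) auto
    finally show "mangoldt n \<le> ln (real N)" .
  qed
  also have "\<dots> = real (card {n \<in> {0<..m}. int q dvd int n - x}) * ln (real N)"
  proof -
    have "{n. n \<in> {1..m} \<and> int q dvd int n - x} = {n \<in> {0<..m}. int q dvd int n - x}" by auto
    then show ?thesis by simp
  qed
  also have "\<dots> \<le> (real m / real q + 1) * ln (real N)"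
  proof (rule mult_right_mono)
    show "real (card {n \<in> {0<..m}. int q dvd int n - x}) \<le> real m / real q + 1"
      using count_residue_class(2)[of q "int 0" "int m" x] q
      unfolding card_nat_int_interval[of 0 m "\<lambda>n. int q dvd n - x"] by simp
  qed (use N in simp)
  finally show ?thesis .
qed

text \<open>An unsolvable system gives 0 on both sides. In a non-reduced class all n share a prime,
  which costs log N. A reduced class is estimated by \<open>E_max\<close>, and the terms n <= J of
  the class are taken off again, whence the summand with J.\<close>

lemma tuple_mangoldt_sum:
  assumes d: "d \<in> tuples k R" and R: "R \<ge> 1" and JN: "J \<le> N" and N: "N \<ge> 1"
  shows "\<bar>(\<Sum>n\<in>{J<..N}. if \<forall>i\<in>{1..k-1}. int (d i) dvd int n + j i then mangoldt n else 0)
     - (if shift_coprime k j d \<and> compatible_tuple k j d then real N / real (totient (tuple_lcm k d)) else 0)\<bar>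
    \<le> E_max (real N) (tuple_lcm k d) + (real J / real (tuple_lcm k d) + 2) * ln (real N)"
proof -
  define D where "D = tuple_lcm k d"
  have D1: "D \<ge> 1" using tuple_lcm_in_nle[OF d R] by (simp add: D_def nle_def)
  have lnN: "ln (real N) \<ge> 0" using N by simp
  have Em: "E_max (real N) D \<ge> 0" using E_max_nonneg D1 by simp
  have JD: "real J / real D \<ge> 0" by simp
  define inner where "inner = (\<Sum>n\<in>{J<..N}. if \<forall>i\<in>{1..k-1}. int (d i) dvd int n + j i then mangoldt n else (0::real))"
  have RHS: "E_max (real N) D + (real J / real D + 2) * ln (real N) \<ge> ln (real N)"
  proof -
    have "1 * ln (real N) \<le> (real J / real D + 2) * ln (real N)" using lnN JD by (intro mult_right_mono) auto
    then show ?thesis using Em by simp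
  qed
  have "\<bar>inner - (if shift_coprime k j d \<and> compatible_tuple k j d then real N / real (totient D) else 0)\<bar>
    \<le> E_max (real N) D + (real J / real D + 2) * ln (real N)"
  proof (cases "compatible_tuple k j d")
    case False
    have "inner = 0" unfolding inner_def using no_solution_if_not_compatible[OF False] by (intro sum.neutral ballI if_not_P) blast
    then show ?thesis using False RHS lnN by simp
  next
    case co: True
    show ?thesis
    proof (cases "shift_coprime k j d")
      case False
      then obtain i where i: "i \<in> {1..k-1}" "\<not> coprime (int (d i)) (j i)" by (auto simp: shift_coprime_def)
      then have "\<not> coprime (d i) (nat \<bar>j i\<bar>)" by (simp add: coprime_nat_abs_right_iff)
      then have "gcd (d i) (nat \<bar>j i\<bar>) \<noteq> 1" by (simp add: coprime_iff_gcd_eq_1)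
      then obtain p where "prime p" "p dvd gcd (d i) (nat \<bar>j i\<bar>)" using prime_factor_nat by blast
      then have p: "prime p" "p dvd d i" "p dvd nat \<bar>j i\<bar>" using gcd_dvd1 gcd_dvd2 dvd_trans by blast+
      have pj: "int p dvd j i" using p(3) by (simp only: dvd_nat_abs_iff)
      have pn: "p dvd n" if "\<forall>i\<in>{1..k-1}. int (d i) dvd int n + j i" for n
      proof -
        have "int p dvd int n + j i" using that i(1) p(2) by (meson dvd_trans of_nat_dvd_iff)
        then have "int p dvd int n" using pj by (simp add: dvd_add_left_iff)
        then show ?thesis by simp
      qed
      have "inner = (\<Sum>n | n \<in> {J<..N} \<and> (\<forall>i\<in>{1..k-1}. int (d i) dvd int n + j i). mangoldt n)"
        unfolding inner_def by (rule sum.inter_filter[symmetric]) simp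
      also have "\<dots> \<le> (\<Sum>n | n \<in> {1..N} \<and> p dvd n. mangoldt n)"
        using pn by (intro sum_mono2) (auto simp: mangoldt_nonneg)
      also have "\<dots> \<le> ln (real N)" by (rule sum_mangoldt_multiples_le[OF p(1) N])
      finally have "inner \<le> ln (real N)" .
      moreover have "inner \<ge> 0" unfolding inner_def by (intro sum_nonneg) (auto simp: mangoldt_nonneg)
      ultimately show ?thesis using False RHS by simp
    next
      case sc: True
      have "\<exists>x. \<forall>n. (\<forall>i\<in>{1..k-1}. int (d i) dvd n + j i) \<longleftrightarrow> int (Lcm (d ` {1..k-1})) dvd n - x"
        by (rule residue_class_of_system) (use compatible_tupleD[OF co] in auto)
      then obtain x where x: "\<And>n. (\<forall>i\<in>{1..k-1}. int (d i) dvd n + j i) \<longleftrightarrow> int D dvd n - x"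
        unfolding D_def tuple_lcm_def by blast
      \<comment> \<open>For modulus 1 the residue is 0, but the only element of
        \<open>totatives 1\<close> is 1.\<close>
      define a where "a = (if D = 1 then 1 else nat (x mod int D))"
      have ax: "int D dvd int a - x"
      proof (cases "D = 1")
        case False
        have "int a = x mod int D" using False D1 by (simp add: a_def)
        then show ?thesis by (metis dvd_diff_commute dvd_minus_mod)
      qed simp
      have cop: "coprime a D"
      proof (rule ccontr)
        assume "\<not> coprime a D"
        then have "gcd a D \<noteq> 1" using coprime_iff_gcd_eq_1[of a D] by blast
        then obtain p where "prime p" "p dvd gcd a D" using prime_factor_nat by blast
        then have p: "prime p" "p dvd a" "p dvd D" using gcd_dvd1 gcd_dvd2 dvd_trans by blast+
        then obtain i where i: "i \<in> {1..k-1}" "p dvd d i"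
          using prime_dvd_Lcm[of "{1..k-1}" p d] tuplesD[OF d] unfolding D_def tuple_lcm_def by auto
        have "int (d i) dvd int a + j i" using x[of "int a"] ax i(1) by blast
        then have "int p dvd int a + j i" using i(2) by (meson dvd_trans of_nat_dvd_iff)
        then have "int p dvd j i" using p(2) by (simp add: dvd_add_right_iff)
        then have "is_unit (int p)" using sc i coprime_common_divisor[of "int (d i)" "j i" "int p"] by (simp add: shift_coprime_def)
        then show False using p(1) by (auto simp: not_prime_1)
      qed
      have tot: "a \<in> totatives D"
      proof (cases "D = 1")
        case True
        then show ?thesis by (simp add: a_def totatives_def)
      next
        case False
        have "a \<noteq> 0" using cop False by (metis coprime_0_left_iff nat_dvd_1_iff_1)
        moreover have "a \<le> D" using False D1 by (simp add: a_def) (metis nat_le_iff of_nat_0_less_iff pos_mod_bound less_imp_le Suc_le_eq)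
        ultimately show ?thesis using cop by (simp add: totatives_def)
      qed
      define C where "C A = (\<Sum>n | n \<in> A \<and> int D dvd int n - x. mangoldt n :: real)" for A :: "nat set"
      have psi: "psi_ap (real N) D a = C {1..N}"
      proof -
        have "[n = a] (mod D) \<longleftrightarrow> int D dvd int n - x" for n
        proof -
          have "[n = a] (mod D) \<longleftrightarrow> int D dvd int n - int a"
            by (metis cong_iff_dvd_diff cong_int_iff)
          also have "\<dots> \<longleftrightarrow> int D dvd (int n - int a) + (int a - x)"
            using dvd_add_left_iff[OF ax] by blast
          finally show ?thesis by simp
        qed
        then show ?thesis unfolding psi_ap_def C_def by (intro sum.cong) auto
      qed
      have inner: "inner = C {J<..N}"
      proof -
        have "inner = (\<Sum>n\<in>{J<..N}. if int D dvd int n - x then mangoldt n else 0)"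
          unfolding inner_def x ..
        also have "\<dots> = C {J<..N}" unfolding C_def by (rule sum.inter_filter[symmetric]) simp
        finally show ?thesis .
      qed
      have split: "C {1..N} = C {1..J} + C {J<..N}"
      proof -
        have "{n. n \<in> {1..N} \<and> int D dvd int n - x} = {n. n \<in> {1..J} \<and> int D dvd int n - x} \<union> {n. n \<in> {J<..N} \<and> int D dvd int n - x}"
          using JN by auto
        then show ?thesis unfolding C_def by (simp only:) (rule sum.union_disjoint, auto)
      qed
      have E: "\<bar>C {1..N} - real N / real (totient D)\<bar> \<le> E_max (real N) D"
        using E_max_ge[OF tot, of "real N"] cop by (simp add: E_ap_def psi)
      have CJ: "0 \<le> C {1..J}" "C {1..J} \<le> (real J / real D + 1) * ln (real N)"
        unfolding C_def using sum_mangoldt_class_le[OF D1 N JN] by (auto intro!: sum_nonneg simp: mangoldt_nonneg)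
      have "(real J / real D + 1) * ln (real N) \<le> (real J / real D + 2) * ln (real N)"
        using lnN by (intro mult_right_mono) auto
      then have "\<bar>inner - real N / real (totient D)\<bar> \<le> E_max (real N) D + (real J / real D + 2) * ln (real N)"
        using E CJ split unfolding inner by linarith
      then show ?thesis using sc co by simp
    qed
  qed
  then show ?thesis unfolding inner_def D_def .
qed

theorem correlation_mangoldt:
  assumes R: "R \<ge> 1" and JN: "J \<le> N" and N: "N \<ge> 1"
    and j: "\<And>i. i \<in> {1..k-1} \<Longrightarrow> \<bar>j i\<bar> \<le> int J"
  shows "\<bar>(\<Sum>n\<in>{J<..N}. (\<Prod>i=1..k-1. LambdaT R (int n + j i)) * mangoldt n) - real N * W k R j\<bar>
    \<le> ln R ^ (k - 1) * (\<Sum>q\<in>nle (R ^ (k - 1)). real (tau q) ^ (k - 1) * E_max (real N) q)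
      + real J * ln (real N) * (ln R ^ (k - 1) * (1 + real (k - 1) * ln R) ^ (2 ^ (k - 1 + 0))) + 2 * ln (real N) * R ^ (k - 1)"
proof -
  define inner where "inner d = (\<Sum>n\<in>{J<..N}. if \<forall>i\<in>{1..k-1}. int (d i) dvd int n + j i then mangoldt n else (0::real))" for d
  define tgt where "tgt d = (if shift_coprime k j d \<and> compatible_tuple k j d then real N / real (totient (tuple_lcm k d)) else 0)" for d
  define cf where "cf = tuple_coeff k R"
  have lR: "ln R \<ge> 0" using R by simp
  have lN: "ln (real N) \<ge> 0" using N by simp
  have "(\<Sum>n\<in>{J<..N}. (\<Prod>i=1..k-1. LambdaT R (int n + j i)) * mangoldt n) = (\<Sum>d\<in>tuples k R. cf d * inner d)"
    unfolding inner_def cf_def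
  proof (rule correlation_expand)
    fix n i assume "n \<in> {J<..N}" "i \<in> {1..k-1}"
    then show "int n + j i > 0" using j[of i] by auto
  qed
  moreover have "real N * W k R j = (\<Sum>d\<in>tuples k R. cf d * tgt d)"
    unfolding W_eq cf_def tgt_def sum_distrib_left by (intro sum.cong) auto
  ultimately have e: "(\<Sum>n\<in>{J<..N}. (\<Prod>i=1..k-1. LambdaT R (int n + j i)) * mangoldt n) - real N * W k R j
     = (\<Sum>d\<in>tuples k R. cf d * (inner d - tgt d))"
    by (simp add: sum_subtractf algebra_simps)
  have "\<bar>\<Sum>d\<in>tuples k R. cf d * (inner d - tgt d)\<bar>
     \<le> (\<Sum>d\<in>tuples k R. ln R ^ (k - 1) * \<bar>E_max (real N) (tuple_lcm k d)\<bar>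
        + real J * ln (real N) * (\<bar>cf d\<bar> * (real (tau (tuple_lcm k d)) ^ 0 / real (tuple_lcm k d))) + 2 * ln (real N) * \<bar>cf d\<bar>)"
  proof (rule order_trans[OF sum_abs sum_mono])
    fix d assume d: "d \<in> tuples k R"
    have D1: "tuple_lcm k d \<ge> 1" using tuple_lcm_in_nle[OF d R] by (simp add: nle_def)
    have "\<bar>cf d * (inner d - tgt d)\<bar> \<le> \<bar>cf d\<bar> * (E_max (real N) (tuple_lcm k d) + (real J / real (tuple_lcm k d) + 2) * ln (real N))"
      unfolding abs_mult inner_def tgt_def using tuple_mangoldt_sum[OF d R JN N] by (intro mult_left_mono) auto
    also have "\<dots> = \<bar>cf d\<bar> * E_max (real N) (tuple_lcm k d) + real J * ln (real N) * (\<bar>cf d\<bar> * (1 / real (tuple_lcm k d))) + 2 * ln (real N) * \<bar>cf d\<bar>"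
      by (simp add: algebra_simps)
    also have "\<bar>cf d\<bar> * E_max (real N) (tuple_lcm k d) \<le> ln R ^ (k - 1) * \<bar>E_max (real N) (tuple_lcm k d)\<bar>"
      unfolding cf_def using abs_tuple_coeff_le[OF d] E_max_nonneg[of "tuple_lcm k d"] D1 lR by (intro mult_mono) auto
    finally show "\<bar>cf d * (inner d - tgt d)\<bar> \<le> ln R ^ (k - 1) * \<bar>E_max (real N) (tuple_lcm k d)\<bar>
        + real J * ln (real N) * (\<bar>cf d\<bar> * (real (tau (tuple_lcm k d)) ^ 0 / real (tuple_lcm k d))) + 2 * ln (real N) * \<bar>cf d\<bar>"
      by simp
  qed
  also have "\<dots> = ln R ^ (k - 1) * (\<Sum>d\<in>tuples k R. \<bar>E_max (real N) (tuple_lcm k d)\<bar>)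
      + real J * ln (real N) * (\<Sum>d\<in>tuples k R. \<bar>cf d\<bar> * (real (tau (tuple_lcm k d)) ^ 0 / real (tuple_lcm k d)))
      + 2 * ln (real N) * (\<Sum>d\<in>tuples k R. \<bar>cf d\<bar>)"
    by (simp only: sum.distrib sum_distrib_left)
  also have "\<dots> \<le> ln R ^ (k - 1) * (\<Sum>q\<in>nle (R ^ (k - 1)). real (tau q) ^ (k - 1) * \<bar>E_max (real N) q\<bar>)
      + real J * ln (real N) * (ln R ^ (k - 1) * (1 + real (k - 1) * ln R) ^ (2 ^ (k - 1 + 0))) + 2 * ln (real N) * R ^ (k - 1)"
    unfolding cf_def using lR lN R
    by (intro add_mono mult_left_mono sum_tuple_lcm_le sum_tau_tuple_le sum_abs_tuple_coeff_le) auto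
  also have "(\<Sum>q\<in>nle (R ^ (k - 1)). real (tau q) ^ (k - 1) * \<bar>E_max (real N) q\<bar>) = (\<Sum>q\<in>nle (R ^ (k - 1)). real (tau q) ^ (k - 1) * E_max (real N) q)"
    by (intro sum.cong) (auto simp: nle_def E_max_nonneg)
  finally show ?thesis unfolding e .
qed

text \<open>The number of terms times log N for the sum, and N/phi(q) <= N tau(q)/q for the main
  term. The factor tau(q)/q has the form that \<open>sum_tau_power_le\<close> can sum.\<close>

lemma E_max_trivial:
  assumes q: "q \<ge> 1" "q \<le> N" and N: "N \<ge> 3"
  shows "E_max (real N) q \<le> 3 * real N * ln (real N) * (real (tau q) / real q)"
proof -
  have lN: "ln (real N) \<ge> 1"
  proof -
    have "exp 1 \<le> real N" using exp_le N by linarith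
    then show ?thesis by (subst ln_ge_iff) (use N in auto)
  qed
  have t1: "real (tau q) \<ge> 1" using tau_pos[of q] q by simp
  have NE: "real N / real q \<ge> 1" using q by (simp add: field_simps)
  have "\<bar>E_ap (real N) q a\<bar> \<le> 3 * real N * ln (real N) * (real (tau q) / real q)" for a
  proof -
    have "[n = a] (mod q) \<longleftrightarrow> int q dvd int n - int a" for n by (metis cong_iff_dvd_diff cong_int_iff)
    then have "psi_ap (real N) q a = (\<Sum>n | n \<in> {1..N} \<and> int q dvd int n - int a. mangoldt n)"
      unfolding psi_ap_def by (intro sum.cong) auto
    also have "\<dots> \<le> (real N / real q + 1) * ln (real N)"
      by (rule sum_mangoldt_class_le) (use q N in auto)
    also have "\<dots> \<le> (2 * (real N / real q)) * ln (real N)" using NE lN by (intro mult_right_mono) auto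
    also have "\<dots> = 2 * real N * ln (real N) * (1 / real q)" by simp
    also have "\<dots> \<le> 2 * real N * ln (real N) * (real (tau q) / real q)"
      using t1 lN by (intro mult_left_mono divide_right_mono) auto
    finally have p: "psi_ap (real N) q a \<le> 2 * real N * ln (real N) * (real (tau q) / real q)" .
    have p0: "psi_ap (real N) q a \<ge> 0" unfolding psi_ap_def by (intro sum_nonneg) (simp add: mangoldt_nonneg)
    have "real q \<le> real (totient q) * real (tau q)" "real (totient q) > 0"
      using le_totient_tau[of q] q by (auto simp flip: of_nat_mult)
    then have "1 / real (totient q) \<le> real (tau q) / real q" using q by (simp add: field_simps)
    moreover have "real N * 1 \<le> real N * ln (real N)" using lN by (intro mult_left_mono) auto
    ultimately have "real N * 1 * (1 / real (totient q)) \<le> real N * ln (real N) * (real (tau q) / real q)"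
      using lN by (intro mult_mono) auto
    then have "real N * (1 / real (totient q)) \<le> real N * ln (real N) * (real (tau q) / real q)" by simp
    moreover have "real N * (1 / real (totient q)) \<ge> 0" by simp
    moreover define Y where "Y = real N * ln (real N) * (real (tau q) / real q)"
    moreover have "2 * real N * ln (real N) * (real (tau q) / real q) = 2 * Y"
      "3 * real N * ln (real N) * (real (tau q) / real q) = 3 * Y" by (simp_all add: Y_def)
    moreover have "E_ap (real N) q a = psi_ap (real N) q a - (if coprime a q then real N * (1 / real (totient q)) else 0)"
      by (simp add: E_ap_def)
    ultimately show ?thesis using p p0 by (auto simp only: abs_le_iff split: if_splits)
  qed
  moreover have "1 \<in> totatives q" using q by (auto simp: totatives_def Suc_le_eq)
  ultimately show ?thesis unfolding E_max_def using q by (subst Max_le_iff) auto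
qed

text \<open>Since t <= T + t^2/T for t = tau(q)^m, the multiplicity is replaced by the constant T at
  the price of a term of higher order in tau, where the trivial bound on \<open>E_max\<close>
  suffices because of the 1/T. The parameter T stays free for later balancing.\<close>

lemma sum_tau_E_max_le:
  assumes X: "X \<ge> 1" "X \<le> real N" and N: "N \<ge> 3" and T: "T > 0"
  shows "(\<Sum>q\<in>nle X. real (tau q) ^ m * E_max (real N) q)
    \<le> T * (\<Sum>q\<in>nle X. E_max (real N) q) + 3 * real N * ln (real N) * (1 + ln X) ^ (2 ^ (2 * m + 1)) / T"
proof -
  have lN: "ln (real N) \<ge> 0" using N by simp
  have "(\<Sum>q\<in>nle X. real (tau q) ^ m * E_max (real N) q)
     \<le> (\<Sum>q\<in>nle X. T * E_max (real N) q + 3 * real N * ln (real N) / T * (real (tau q) ^ (2 * m + 1) / real q))"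
  proof (rule sum_mono)
    fix q assume "q \<in> nle X"
    then have q: "q \<ge> 1" "q \<le> N" using X by (auto simp: nle_def)
    have E0: "E_max (real N) q \<ge> 0" using E_max_nonneg q by simp
    have E1: "E_max (real N) q \<le> 3 * real N * ln (real N) * (real (tau q) / real q)" by (rule E_max_trivial[OF q N])
    define t where "t = real (tau q) ^ m"
    have t0: "t \<ge> 0" by (simp add: t_def)
    have "t \<le> T + t ^ 2 / T"
    proof (cases "t \<le> T")
      case False
      then have "t * T \<le> t * t" using t0 by (intro mult_left_mono) auto
      then have "t \<le> t ^ 2 / T" using T by (simp add: pos_le_divide_eq power2_eq_square)
      then show ?thesis using T by simp
    qed (use T t0 in \<open>simp add: add_increasing2\<close>)
    then have "t * E_max (real N) q \<le> (T + t ^ 2 / T) * E_max (real N) q" using E0 by (rule mult_right_mono)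
    also have "\<dots> = T * E_max (real N) q + t ^ 2 / T * E_max (real N) q" by (simp add: algebra_simps)
    also have "t ^ 2 / T * E_max (real N) q \<le> t ^ 2 / T * (3 * real N * ln (real N) * (real (tau q) / real q))"
      using E1 T by (intro mult_left_mono) auto
    also have "\<dots> = 3 * real N * ln (real N) / T * (real (tau q) ^ (2 * m + 1) / real q)"
    proof -
      have e: "real (tau q) ^ (2 * m + 1) = t ^ 2 * real (tau q)"
        unfolding t_def power_mult[symmetric] by (simp add: mult.commute[of m 2])
      show ?thesis unfolding e by simp
    qed
    finally show "real (tau q) ^ m * E_max (real N) q \<le> T * E_max (real N) q + 3 * real N * ln (real N) / T * (real (tau q) ^ (2 * m + 1) / real q)"
      by (simp add: t_def)
  qed
  also have "\<dots> = T * (\<Sum>q\<in>nle X. E_max (real N) q) + 3 * real N * ln (real N) / T * (\<Sum>q\<in>nle X. real (tau q) ^ (2 * m + 1) / real q)"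
    by (simp only: sum.distrib sum_distrib_left)
  also have "\<dots> \<le> T * (\<Sum>q\<in>nle X. E_max (real N) q) + 3 * real N * ln (real N) / T * (1 + ln X) ^ (2 ^ (2 * m + 1))"
    using T lN X by (intro add_left_mono mult_left_mono sum_tau_power_le) auto
  finally show ?thesis by simp
qed

section \<open>Asymptotics\<close>

lemma poly_exp_sqrt_le:
  assumes g: "\<gamma> > 0" and B: "B > 0" and A: "A \<ge> 0"
  shows "\<exists>l0. \<forall>l\<ge>l0. A * (1 + B * l) ^ m * exp (- \<gamma> * sqrt l) \<le> 1"
proof -
  \<comment> \<open>The decay is distributed equally over the linear factors, which reduces the
    limit to degree 1; the successor keeps the division valid for m = 0.\<close>
  define \<delta> where "\<delta> = \<gamma> / real (Suc m)"
  have d: "\<delta> > 0" using g by (simp add: \<delta>_def)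
  have "((\<lambda>l. (1 + B * l) * exp (- \<delta> * sqrt l)) \<longlongrightarrow> 0) at_top"
    using d B by real_asymp
  then have "((\<lambda>l. A * ((1 + B * l) * exp (- \<delta> * sqrt l)) ^ Suc m) \<longlongrightarrow> A * 0 ^ Suc m) at_top"
    by (intro tendsto_intros)
  then have "\<forall>\<^sub>F l in at_top. A * ((1 + B * l) * exp (- \<delta> * sqrt l)) ^ Suc m < 1"
    by (rule order_tendstoD) simp
  then obtain l0 where l0: "\<And>l. l \<ge> l0 \<Longrightarrow> A * ((1 + B * l) * exp (- \<delta> * sqrt l)) ^ Suc m < 1"
    by (auto simp: eventually_at_top_linorder)
  have "A * (1 + B * l) ^ m * exp (- \<gamma> * sqrt l) \<le> 1" if l: "l \<ge> max 0 l0" for l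
  proof -
    have u: "1 + B * l \<ge> 1" using l B by simp
    have "exp (- \<delta> * sqrt l) ^ Suc m = exp (real (Suc m) * (- \<delta> * sqrt l))"
      by (rule exp_of_nat_mult[symmetric])
    also have "real (Suc m) * (- \<delta> * sqrt l) = - \<gamma> * sqrt l" by (simp add: \<delta>_def del: of_nat_Suc)
    finally have e: "exp (- \<delta> * sqrt l) ^ Suc m = exp (- \<gamma> * sqrt l)" .
    have "(1 + B * l) ^ m \<le> (1 + B * l) ^ Suc m" using u by (intro power_increasing) auto
    then have "A * (1 + B * l) ^ m * exp (- \<gamma> * sqrt l) \<le> A * (1 + B * l) ^ Suc m * exp (- \<gamma> * sqrt l)"
      using A by (intro mult_right_mono mult_left_mono) auto
    also have "\<dots> = A * ((1 + B * l) * exp (- \<delta> * sqrt l)) ^ Suc m"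
      unfolding power_mult_distrib e by (simp only: mult.assoc)
    also have "\<dots> \<le> 1" using l0[of l] l by simp
    finally show ?thesis .
  qed
  then show ?thesis by blast
qed

lemma max_abs_props:
  assumes k: "k \<ge> 2" and j: "\<forall>i\<in>{1..k-1}. j i \<noteq> 0"
  shows "max_abs k j \<ge> 1" "\<And>i. i \<in> {1..k-1} \<Longrightarrow> \<bar>j i\<bar> \<le> max_abs k j"
proof -
  have b: "\<bar>j i\<bar> \<le> max_abs k j" if "i \<in> {1..k-1}" for i
    unfolding max_abs_def using that by (intro Max_ge) auto
  show "\<And>i. i \<in> {1..k-1} \<Longrightarrow> \<bar>j i\<bar> \<le> max_abs k j" by (rule b)
  have "1 \<in> {1..k-1}" using k by simp
  then show "max_abs k j \<ge> 1" using b[of 1] j by force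
qed

text \<open>The short range n <= J contributes about J^(k+1), where J is at most of order R^(1/k).
  Since R <= N^(1/k), the exponent of N is (k + 1)/k^2, which is largest at k = 2, namely
  3/4.\<close>

lemma powr_third_quarter:
  assumes k: "k \<ge> (2::nat)" and R: "R \<ge> 1" "R \<le> real N powr (1 / real k)" and N: "N \<ge> 1"
  shows "R powr (real (k + 1) / real k) \<le> real N powr (3/4)"
proof -
  have "R powr (real (k + 1) / real k) \<le> (real N powr (1 / real k)) powr (real (k + 1) / real k)"
    using R by (intro powr_mono2) auto
  also have "\<dots> = real N powr (real (k + 1) / real k ^ 2)" by (simp add: powr_powr power2_eq_square)
  also have "\<dots> \<le> real N powr (3/4)"
  proof (intro powr_mono)
    have "real k * real k \<ge> 2 * real k" using k by (intro mult_right_mono) auto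
    moreover have "real k \<ge> 2" using k by simp
    moreover have "2 * a \<le> q \<Longrightarrow> 2 \<le> a \<Longrightarrow> 4 * (a + 1) \<le> 3 * q" for a q :: real by argo
    ultimately have "4 * (real k + 1) \<le> 3 * (real k * real k)" by blast
    then have "4 * real (k + 1) \<le> 3 * (real k)^2" by (simp add: power2_eq_square)
    then show "real (k + 1) / (real k)^2 \<le> 3/4" using k by (simp add: field_simps)
  qed (use N in simp)
  finally show ?thesis .
qed

context pnt_error
begin

theorem truncated_asymptotics:
  assumes k: "k \<ge> 2" and eps: "\<epsilon> > 0" and C: "C > 0"
  shows "\<exists>N0::nat. \<forall>N\<ge>N0. \<forall>(R::real) (j::nat \<Rightarrow> int).
         (\<forall>i\<in>{1..k-1}. j i \<noteq> 0) \<longrightarrow>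
         real_of_int (max_abs k j) \<le> C * R powr (1 / real k) \<longrightarrow>
         real N powr \<epsilon> \<le> R \<longrightarrow> R \<le> real N powr (1 / real k) \<longrightarrow>
         \<bar>mixed_corr k R R N j - real N * W k R j\<bar>
           \<le> R ^ k + real N * exp (- (c / 2) * sqrt (ln (R / real_of_int (max_abs k j) ^ (k - 1))))"
proof -
  \<comment> \<open>R / J^(k-1) is at least R^(1/k) >= N^(epsilon/k) up to a power of C; half of
    this exponent is kept and the other half absorbs C.\<close>
  define \<beta> where "\<beta> = \<epsilon> / (2 * real k)"
  have beta: "\<beta> > 0" using eps k by (simp add: \<beta>_def)
  \<comment> \<open>Large enough for every power of log that occurs: k from the coefficients and
    2^(k-1+3) from the moment of tau.\<close>
  define m where "m = k + 2 ^ (k + 2)"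
  \<comment> \<open>Four times the total coefficient of N^(3/4) in the two contributions of n <= J,
    so that they amount to a quarter of the allowed error.\<close>
  define A1 where "A1 = 4 * (2 ^ (k - 1) * C ^ (k + 1) + C)"
  have A1: "A1 \<ge> 0" using C by (simp add: A1_def)
  have k0: "real k > 0" using k by simp
  obtain l1 where l1: "\<And>l. l \<ge> l1 \<Longrightarrow> A1 * (1 + real k * l) ^ m * exp (- 1 * sqrt l) \<le> 1"
    using poly_exp_sqrt_le[of 1 "real k" A1 m] A1 k0 by auto
  \<comment> \<open>The available decay has rate c. One half is kept for the conclusion; the other,
    with log y >= beta log N, pays for K and for the powers of log N.\<close>
  have g2: "c / 2 * sqrt \<beta> > 0" using c beta by simp
  have K2: "2 * K \<ge> 0" using K by simp
  obtain l2 where l2: "\<And>l. l \<ge> l2 \<Longrightarrow> 2 * K * (1 + real k * l) ^ m * exp (- (c / 2 * sqrt \<beta>) * sqrt l) \<le> 1"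
    using poly_exp_sqrt_le[OF g2 k0 K2, of m] by blast
  \<comment> \<open>The entry 64 gives 2 sqrt(l) <= l/4; the entries with ln C give log y >= beta l
    and J <= N, in this order.\<close>
  define l0 where "l0 = Max {64, l1, l2, 2 * real k * (real k - 1) * \<bar>ln C\<bar> / \<epsilon>, 4 * \<bar>ln C\<bar>}"
  define N0 where "N0 = max 1 (nat \<lceil>exp l0\<rceil>)"
  have main: "\<bar>mixed_corr k R R N j - real N * W k R j\<bar>
           \<le> R ^ k + real N * exp (- (c / 2) * sqrt (ln (R / real_of_int (max_abs k j) ^ (k - 1))))"
    if NN: "N \<ge> N0" and j: "\<forall>i\<in>{1..k-1}. j i \<noteq> 0"
      and mj: "real_of_int (max_abs k j) \<le> C * R powr (1 / real k)"
      and R1: "real N powr \<epsilon> \<le> R" and R2: "R \<le> real N powr (1 / real k)" for N R j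
  proof -
    define l where "l = ln (real N)"
    have N1: "N \<ge> 1" using NN by (simp add: N0_def)
    have "exp l0 \<le> real N" using NN unfolding N0_def by linarith
    then have ll: "l \<ge> l0" unfolding l_def using N1 by (subst ln_ge_iff) auto
    have l: "l \<ge> 64" "l \<ge> l1" "l \<ge> l2" "l \<ge> 2 * real k * (real k - 1) * \<bar>ln C\<bar> / \<epsilon>" "l \<ge> 4 * \<bar>ln C\<bar>"
      using ll unfolding l0_def by auto
    have Nl: "real N = exp l" using N1 by (simp add: l_def)
    have R_ge: "R \<ge> 1"
    proof -
      have "1 \<le> real N powr \<epsilon>" using N1 eps by (intro ge_one_powr_ge_zero) auto
      then show ?thesis using R1 by linarith
    qed
    define J where "J = nat (max_abs k j)"
    note mp = max_abs_props[OF k j]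
    have J: "real_of_int (max_abs k j) = real J" "J \<ge> 1" using mp(1) by (auto simp: J_def)
    have jJ: "j i \<noteq> 0 \<and> \<bar>j i\<bar> \<le> int J" if "i \<in> {1..k-1}" for i
      using j mp(2)[OF that] mp(1) that by (simp add: J_def)
    have JC: "real J \<le> C * R powr (1 / real k)" using mj J by simp
    have RN: "R \<le> real N"
    proof -
      have "real N powr (1 / real k) \<le> real N powr 1" using N1 k by (intro powr_mono) auto
      then show ?thesis using R2 N1 by simp
    qed
    have lnR: "0 \<le> ln R" "ln R \<le> l" "ln R \<ge> \<epsilon> * l"
    proof -
      show "0 \<le> ln R" using R_ge by simp
      show "ln R \<le> l" unfolding l_def using RN R_ge by (intro ln_mono) auto
      have "ln (real N powr \<epsilon>) \<le> ln R" using R1 R_ge N1 by (intro ln_mono) auto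
      then show "ln R \<ge> \<epsilon> * l" using N1 by (simp add: l_def ln_powr)
    qed
    have J_34: "real J ^ (k + 1) \<le> C ^ (k + 1) * real N powr (3/4)"
    proof -
      have "real J ^ (k + 1) \<le> (C * R powr (1 / real k)) ^ (k + 1)" using JC by (intro power_mono) auto
      also have "\<dots> = C ^ (k + 1) * (R powr (1 / real k)) powr real (k + 1)"
        using R_ge by (simp only: power_mult_distrib powr_realpow powr_gt_zero)
      also have "(R powr (1 / real k)) powr real (k + 1) = R powr (real (k + 1) / real k)" by (simp add: powr_powr)
      also have "C ^ (k + 1) * R powr (real (k + 1) / real k) \<le> C ^ (k + 1) * real N powr (3/4)"
        using powr_third_quarter[OF k R_ge R2 N1] C by (intro mult_left_mono) auto
      finally show ?thesis .
    qed
    have J_1: "real J \<le> C * real N powr (3/4)"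
    proof -
      have "R powr (1 / real k) \<le> R powr (real (k + 1) / real k)"
        using R_ge k by (intro powr_mono divide_right_mono) auto
      also note powr_third_quarter[OF k R_ge R2 N1]
      finally have "C * R powr (1 / real k) \<le> C * real N powr (3/4)" using C by simp
      then show ?thesis using JC by linarith
    qed
    have N34: "real N powr (3/4) = real N * exp (- l / 4)"
      using N1 by (simp add: powr_def Nl mult_exp_exp)
    have JN: "J \<le> N"
    proof -
      have "C * exp (- l / 4) \<le> exp \<bar>ln C\<bar> * exp (- l / 4)"
      proof (intro mult_right_mono)
        have "C = exp (ln C)" using C by simp
        also have "\<dots> \<le> exp \<bar>ln C\<bar>" by simp
        finally show "C \<le> exp \<bar>ln C\<bar>" .
      qed simp
      also have "\<dots> = exp (\<bar>ln C\<bar> - l / 4)" by (simp add: mult_exp_exp)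
      also have "\<dots> \<le> 1" using l(5) by simp
      finally have "real N * (C * exp (- l / 4)) \<le> real N * 1" by (intro mult_left_mono) auto
      then have "real J \<le> real N" using J_1 unfolding N34 by (simp add: mult_ac)
      then show ?thesis by simp
    qed
    define u where "u = 1 + real k * l"
    have u: "u \<ge> 1" "l \<le> u" "ln R \<le> u" "1 + real (k - 1) * ln R \<le> u"
    proof -
      show "u \<ge> 1" using l by (simp add: u_def)
      have "1 * l \<le> real k * l" using k l by (intro mult_right_mono) auto
      then show lu: "l \<le> u" by (simp add: u_def)
      then show "ln R \<le> u" using lnR by linarith
      have "real (k - 1) * ln R \<le> real k * l" using lnR by (intro mult_mono) auto
      then show "1 + real (k - 1) * ln R \<le> u" by (simp add: u_def)
    qed
    have upow: "ln R ^ (k - 1) * (1 + real (k - 1) * ln R) ^ (2 ^ (k - 1 + i)) \<le> u ^ m" if "i \<le> 3" for i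
    proof -
      have "ln R ^ (k - 1) * (1 + real (k - 1) * ln R) ^ (2 ^ (k - 1 + i)) \<le> u ^ (k - 1) * u ^ (2 ^ (k - 1 + i))"
        using u lnR by (intro mult_mono power_mono) auto
      also have "\<dots> = u ^ (k - 1 + 2 ^ (k - 1 + i))" by (simp add: power_add)
      also have "\<dots> \<le> u ^ m"
      proof (rule power_increasing)
        have "(2::nat) ^ (k - 1 + i) \<le> 2 ^ (k + 2)" using k that by (intro power_increasing) auto
        then show "k - 1 + 2 ^ (k - 1 + i) \<le> m" by (simp add: m_def)
      qed (use u in simp)
      finally show ?thesis .
    qed
    define y where "y = R / real J ^ (k - 1)"
    have lny: "ln y \<ge> \<beta> * l" "ln y \<le> l"
    proof -
      have e: "ln y = ln R - real (k - 1) * ln (real J)"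
        unfolding y_def using R_ge J by (simp add: ln_div ln_realpow)
      have "ln (real J) \<le> ln (C * R powr (1 / real k))" using JC J by (intro ln_mono) auto
      also have "\<dots> = ln C + ln R / real k" using C R_ge by (simp add: ln_mult ln_powr)
      finally have "real (k - 1) * ln (real J) \<le> real (k - 1) * (\<bar>ln C\<bar> + ln R / real k)"
        by (intro mult_left_mono) auto
      also have "\<dots> = (real k - 1) * \<bar>ln C\<bar> + (ln R - ln R / real k)"
        using k by (simp add: of_nat_diff field_simps)
      finally have "ln y \<ge> ln R / real k - (real k - 1) * \<bar>ln C\<bar>" using e by linarith
      moreover have "ln R / real k \<ge> \<epsilon> * l / real k" using lnR k0 by (intro divide_right_mono) auto
      moreover have "(real k - 1) * \<bar>ln C\<bar> \<le> \<beta> * l"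
        using l(4) eps k0 unfolding \<beta>_def by (simp add: field_simps)
      moreover have "\<epsilon> * l / real k = \<beta> * l + \<beta> * l" using k0 by (simp add: \<beta>_def field_simps)
      ultimately show "ln y \<ge> \<beta> * l" by linarith
      have "real (k - 1) * ln (real J) \<ge> 0" using J by simp
      then show "ln y \<le> l" using e lnR by linarith
    qed
    have ly0: "ln y \<ge> 0" using lny(1) beta l(1) by (meson mult_nonneg_nonneg less_imp_le order_trans zero_le_numeral)
    define E where "E = exp (- (c / 2) * sqrt (ln y))"
    have E0: "E > 0" by (simp add: E_def)
    have E_lower: "exp (- 1 * sqrt l) \<le> E"
    proof -
      have "c / 2 * sqrt (ln y) \<le> 1 * sqrt l" using c lny ly0 by (intro mult_mono) auto
      then show ?thesis by (simp add: E_def)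
    qed
    have Edec_y: "Edec c y \<le> E * exp (- (c / 2 * sqrt \<beta>) * sqrt l)"
    proof -
      have "Edec c y = E * exp (- (c / 2) * sqrt (ln y))"
        unfolding Edec_def E_def using ly0 by (simp add: mult_exp_exp)
      also have "\<dots> \<le> E * exp (- (c / 2 * sqrt \<beta>) * sqrt l)"
      proof (intro mult_left_mono)
        have "sqrt \<beta> * sqrt l \<le> sqrt (ln y)" using lny(1) by (simp add: real_sqrt_mult[symmetric])
        then have "c / 2 * (sqrt \<beta> * sqrt l) \<le> c / 2 * sqrt (ln y)" using c by (intro mult_left_mono) auto
        then show "exp (- (c / 2) * sqrt (ln y)) \<le> exp (- (c / 2 * sqrt \<beta>) * sqrt l)" by (simp add: mult.assoc)
      qed (use E0 in simp)
      finally show ?thesis .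
    qed
    define S where "S = (\<Sum>n\<in>{J<..N}. (\<Prod>i=1..k-1. LambdaT R (int n + j i)) * LambdaT R (int n))"
    have b1: "\<bar>mixed_corr k R R N j - S\<bar> \<le> 2 ^ (k - 1) * C ^ (k + 1) * real N powr (3/4) * u ^ m"
    proof -
      have "\<bar>mixed_corr k R R N j - S\<bar> \<le> real J * ((2 * real J * ln R) ^ (k - 1) * (real J * ln R))"
        unfolding S_def
      proof (rule mixed_corr_head[OF R_ge JN])
        fix n :: nat assume n: "1 \<le> n" "n \<le> J"
        have "\<bar>LambdaT R (int n)\<bar> \<le> of_int (int n) * ln R" using n by (intro abs_LambdaT_le R_ge) auto
        also have "\<dots> \<le> real J * ln R" using n lnR by (intro mult_right_mono) auto
        finally show "\<bar>LambdaT R (int n)\<bar> \<le> real J * ln R" .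
      qed (use jJ in auto)
      also have "\<dots> = 2 ^ (k - 1) * (real J * real J * real J ^ (k - 1)) * (ln R * ln R ^ (k - 1))"
        by (simp add: power_mult_distrib mult_ac)
      also have "real J * real J * real J ^ (k - 1) = real J ^ (k + 1)"
        using k by (simp add: power_eq_if)
      also have "ln R * ln R ^ (k - 1) = ln R ^ k" using k by (simp add: power_eq_if)
      also have "2 ^ (k - 1) * real J ^ (k + 1) * ln R ^ k \<le> 2 ^ (k - 1) * (C ^ (k + 1) * real N powr (3/4)) * u ^ m"
      proof (intro mult_mono mult_left_mono J_34)
        have "ln R ^ k \<le> u ^ k" using u lnR by (intro power_mono) auto
        also have "\<dots> \<le> u ^ m" using u by (intro power_increasing) (auto simp: m_def)
        finally show "ln R ^ k \<le> u ^ m" .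
      qed (use C lnR in auto)
      finally show ?thesis by (simp add: mult_ac)
    qed
    have b2: "\<bar>real J * W k R j\<bar> \<le> C * real N powr (3/4) * u ^ m"
      unfolding abs_mult using J_1 order_trans[OF abs_W_le[OF R_ge] upow[of 1]] C by (intro mult_mono) auto
    have b3: "\<bar>S - (real N - real J) * W k R j\<bar> \<le> R ^ k + real N * (K * Edec c y) * u ^ m"
    proof -
      have "\<bar>S - (real N - real J) * W k R j\<bar> \<le> R ^ k + real N * (K * Edec c y) * (ln R ^ (k - 1) * (1 + real (k - 1) * ln R) ^ (2 ^ (k - 1 + 3)))"
        unfolding S_def y_def using k jJ by (intro correlation_truncated R_ge JN) auto
      also have "\<dots> \<le> R ^ k + real N * (K * Edec c y) * u ^ m"
        using upow[of 3] K Edec_pos[of c y] by (intro add_left_mono mult_left_mono) auto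
      finally show ?thesis .
    qed
    have s1: "2 ^ (k - 1) * C ^ (k + 1) * real N powr (3/4) * u ^ m + C * real N powr (3/4) * u ^ m \<le> real N * E / 4"
    proof -
      have "2 ^ (k - 1) * C ^ (k + 1) * real N powr (3/4) * u ^ m + C * real N powr (3/4) * u ^ m = real N * (exp (- l / 4) * (A1 * u ^ m)) / 4"
        unfolding N34 A1_def by (simp add: algebra_simps)
      also have "exp (- l / 4) * (A1 * u ^ m) \<le> (exp (- 1 * sqrt l) * exp (- 1 * sqrt l)) * (A1 * u ^ m)"
      proof (intro mult_right_mono)
        have "8 \<le> sqrt l" using l(1) by (intro real_le_rsqrt) auto
        then have "8 * sqrt l \<le> sqrt l * sqrt l" using l(1) by (intro mult_right_mono) auto
        then have "2 * sqrt l \<le> l / 4" using l(1) by simp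
        then show "exp (- l / 4) \<le> exp (- 1 * sqrt l) * exp (- 1 * sqrt l)" by (simp add: mult_exp_exp)
      qed (use A1 u in auto)
      also have "\<dots> = exp (- 1 * sqrt l) * (A1 * u ^ m * exp (- 1 * sqrt l))" by (simp only: mult_ac)
      also have "\<dots> \<le> E * 1"
        using E_lower l1[OF l(2)] E0 A1 u unfolding u_def by (intro mult_mono) auto
      finally show ?thesis by (simp add: divide_right_mono mult_left_mono)
    qed
    have s2: "real N * (K * Edec c y) * u ^ m \<le> real N * E / 2"
    proof -
      have "K * Edec c y * u ^ m \<le> K * (E * exp (- (c / 2 * sqrt \<beta>) * sqrt l)) * u ^ m"
        using Edec_y K u by (intro mult_right_mono mult_left_mono) auto
      also have "\<dots> = E / 2 * (2 * K * u ^ m * exp (- (c / 2 * sqrt \<beta>) * sqrt l))" by simp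
      also have "\<dots> \<le> E / 2 * 1" using l2[OF l(3)] E0 unfolding u_def by (intro mult_left_mono) auto
      finally have "real N * (K * Edec c y * u ^ m) \<le> real N * (E / 2 * 1)" by (intro mult_left_mono) auto
      then show ?thesis by (simp add: mult.assoc)
    qed
    have NE: "real N * E \<ge> 0" using E0 by simp
    have "\<bar>mixed_corr k R R N j - real N * W k R j\<bar> \<le> R ^ k + real N * E"
    proof -
      have "mixed_corr k R R N j - real N * W k R j = (mixed_corr k R R N j - S) + (S - (real N - real J) * W k R j) - real J * W k R j"
        by (simp add: algebra_simps)
      then show ?thesis using b1 b2 b3 s1 s2 NE by linarith
    qed
    then show ?thesis unfolding E_def y_def J(1) .
  qed
  show ?thesis by (intro exI[of _ N0] allI impI main)
qed

end

text \<open>The hypothesis provides every power of the logarithm, so Y can be prescribed: first the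
  cut-off T for the multiplicity is fixed as a power of log N, then the power demanded of the
  hypothesis. The threshold N0 depends on Y and absorbs all constants.\<close>

theorem mangoldt_asymptotics:
  assumes k: "k \<ge> 2" and theta: "0 < \<theta>" "\<theta> \<le> 1" "distribution_level \<theta>" and eps: "\<epsilon> > 0" and C: "C > 0"
  shows "\<exists>N0::nat. \<forall>N\<ge>N0. \<forall>(R::real) (j::nat \<Rightarrow> int).
         (\<forall>i\<in>{1..k-1}. j i \<noteq> 0) \<longrightarrow>
         real_of_int (max_abs k j) \<le> C * R powr (1 / real k) \<longrightarrow>
         real N powr \<epsilon> \<le> R \<longrightarrow> R \<le> real N powr (\<theta> / (real k - 1) - \<epsilon>) \<longrightarrow>
         \<bar>mixed_corr k R (real N) N j - real N * W k R j\<bar> \<le> real N / ln (real N) powr Y"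
proof -
  obtain B :: nat where B: "Y \<le> real B" using real_arch_simple by blast
  define m0 :: nat where "m0 = 2 ^ (2 * (k - 1) + 1)"
  \<comment> \<open>The cut-off is T = u^t with u = 1 + k log N. The term with T in the denominator
    has size N u^(k+m0-t) = N / u^(B+1). Then A' is chosen so that u^(k-1+t) N / l^A' is at most a
    constant times N / l^(B+1).\<close>
  define t where "t = k + m0 + B + 1"
  define A' where "A' = k - 1 + t + B + 1"
  \<comment> \<open>The moduli run up to R^(k-1), which is at most N^(theta - epsilon').\<close>
  define \<epsilon>' where "\<epsilon>' = \<epsilon> * real (k - 1)"
  have eps': "\<epsilon>' > 0" "\<epsilon>' \<ge> \<epsilon>" using eps k by (auto simp: \<epsilon>'_def mult_le_cancel_left1)
  have A'0: "real A' > 0" by (simp add: A'_def)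
  obtain Kd x0 where Kd: "\<And>x. x \<ge> x0 \<Longrightarrow> (\<Sum>q | 1 \<le> q \<and> real q \<le> x powr (\<theta> - \<epsilon>'). Max ((\<lambda>a. \<bar>E_ap x q a\<bar>) ` totatives q)) \<le> Kd * (x / ln x powr real A')"
    using theta(3) eps'(1) A'0 unfolding distribution_level_def by meson
  \<comment> \<open>Every term other than the average over moduli saves a factor N^(-sigma) up to
    logarithms: epsilon comes from R and R^(k-1), and 1/2 from J <= C N^(1/2).\<close>
  define \<sigma> where "\<sigma> = min (1/2) \<epsilon>"
  have sg: "\<sigma> > 0" "\<sigma> \<le> 1/2" "\<sigma> \<le> \<epsilon>" using eps by (auto simp: \<sigma>_def)
  define m where "m = k + 2 ^ (k - 1)"
  define Ak where "Ak = C + 2 + 2 ^ (k - 1) * C ^ k"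
  have Ak: "Ak \<ge> 0" using C by (simp add: Ak_def)
  have k0: "real k > 0" using k by simp
  obtain l1 where l1: "\<And>l. l \<ge> l1 \<Longrightarrow> 2 * Ak * (1 + real k * l) ^ (m + B) * exp (- \<sigma> * sqrt l) \<le> 1"
    using poly_exp_sqrt_le[OF sg(1) k0, of "2 * Ak" "m + B"] Ak by auto
  \<comment> \<open>The spare factor l = log N absorbs the constants: l >= c1 and l >= 15 = 3 * 5
    make each of the two parts of the average at most N / (5 l^B). With one half for the remaining
    terms the total stays below N / l^B.\<close>
  define c1 where "c1 = 5 * \<bar>Kd\<bar> * (real k + 1) ^ (k - 1 + t)"
  define l0 where "l0 = Max {15, l1, c1, 2 * \<bar>ln C\<bar>}"
  define N0 where "N0 = max 3 (max (nat \<lceil>x0\<rceil>) (nat \<lceil>exp l0\<rceil>))"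
  have main: "\<bar>mixed_corr k R (real N) N j - real N * W k R j\<bar> \<le> real N / ln (real N) powr Y"
    if NN: "N \<ge> N0" and j: "\<forall>i\<in>{1..k-1}. j i \<noteq> 0"
      and mj: "real_of_int (max_abs k j) \<le> C * R powr (1 / real k)"
      and R1: "real N powr \<epsilon> \<le> R" and R2: "R \<le> real N powr (\<theta> / (real k - 1) - \<epsilon>)" for N R j
  proof -
    define l where "l = ln (real N)"
    have N3: "N \<ge> 3" and Nx0: "real N \<ge> x0" and Nl0: "exp l0 \<le> real N"
      using NN unfolding N0_def by linarith+
    then have N1: "N \<ge> 1" by simp
    have ll: "l \<ge> l0" unfolding l_def using N1 Nl0 by (subst ln_ge_iff) auto
    have l: "l \<ge> 15" "l \<ge> l1" "l \<ge> c1" "l \<ge> 2 * \<bar>ln C\<bar>"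
      using ll unfolding l0_def by auto
    have Nl: "real N = exp l" using N1 by (simp add: l_def)
    have k1: "real k - 1 = real (k - 1)" "real (k - 1) \<ge> 1" using k by (auto simp: of_nat_diff)
    have R_ge: "R \<ge> 1"
    proof -
      have "1 \<le> real N powr \<epsilon>" using N1 eps by (intro ge_one_powr_ge_zero) auto
      then show ?thesis using R1 by linarith
    qed
    have th1: "\<theta> / (real k - 1) \<le> 1"
    proof -
      have "\<theta> / real (k - 1) \<le> \<theta> / 1" using k1 theta by (intro divide_left_mono) auto
      then show ?thesis using theta(2) unfolding k1(1) by simp
    qed
    have R_le: "R \<le> real N * exp (- \<sigma> * l)"
    proof -
      have "R \<le> real N powr (1 + (- \<sigma>))"
        using th1 sg N1 by (intro order_trans[OF R2] powr_mono) auto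
      also have "\<dots> = real N * real N powr (- \<sigma>)" using N1 by (simp only: powr_add) simp
      also have "real N powr (- \<sigma>) = exp (- \<sigma> * l)" using N1 by (simp add: powr_def l_def)
      finally show ?thesis .
    qed
    have RN: "R \<le> real N"
    proof -
      have "exp (- \<sigma> * l) \<le> 1" using sg l by simp
      then have "real N * exp (- \<sigma> * l) \<le> real N * 1" by (intro mult_left_mono) auto
      then show ?thesis using R_le by simp
    qed
    define X where "X = R ^ (k - 1)"
    have X_le: "X \<le> real N powr (\<theta> - \<epsilon>')"
    proof -
      have "X \<le> (real N powr (\<theta> / (real k - 1) - \<epsilon>)) ^ (k - 1)"
        unfolding X_def using R2 R_ge by (intro power_mono) auto
      also have "\<dots> = (real N powr (\<theta> / (real k - 1) - \<epsilon>)) powr real (k - 1)"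
        using N1 by (simp add: powr_realpow)
      also have "\<dots> = real N powr ((\<theta> / (real k - 1) - \<epsilon>) * real (k - 1))" by (simp add: powr_powr)
      also have "(\<theta> / (real k - 1) - \<epsilon>) * real (k - 1) = \<theta> - \<epsilon>'"
        unfolding k1(1) \<epsilon>'_def using k1(2) by (simp add: left_diff_distrib)
      finally show ?thesis .
    qed
    have X_N: "X \<le> real N * exp (- \<sigma> * l)"
    proof -
      have "X \<le> real N powr (1 + (- \<sigma>))"
        using theta eps' sg N1 by (intro order_trans[OF X_le] powr_mono) auto
      also have "\<dots> = real N * real N powr (- \<sigma>)" using N1 by (simp only: powr_add) simp
      also have "real N powr (- \<sigma>) = exp (- \<sigma> * l)" using N1 by (simp add: powr_def l_def)
      finally show ?thesis .
    qed
    have X1: "X \<ge> 1" unfolding X_def using R_ge by (rule one_le_power)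
    have XN: "X \<le> real N"
    proof -
      have "exp (- \<sigma> * l) \<le> 1" using sg l by simp
      then have "real N * exp (- \<sigma> * l) \<le> real N * 1" by (intro mult_left_mono) auto
      then show ?thesis using X_N by simp
    qed
    define J where "J = nat (max_abs k j)"
    note mp = max_abs_props[OF k j]
    have J: "real_of_int (max_abs k j) = real J" "J \<ge> 1" using mp(1) by (auto simp: J_def)
    have jJ: "\<bar>j i\<bar> \<le> int J" if "i \<in> {1..k-1}" for i
      using mp(2)[OF that] mp(1) by (simp add: J_def)
    have JC: "real J \<le> C * R powr (1 / real k)" using mj J by simp
    have J_half: "real J \<le> C * (real N * exp (- l / 2))"
    proof -
      have "R powr (1 / real k) \<le> real N powr (1 / real k)" using R_ge RN by (intro powr_mono2) auto
      also have "\<dots> \<le> real N powr (1/2)" using N1 k by (intro powr_mono) (auto simp: field_simps)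
      also have "\<dots> = real N * exp (- l / 2)" using N1 by (simp add: powr_def Nl mult_exp_exp)
      finally have "C * R powr (1 / real k) \<le> C * (real N * exp (- l / 2))" using C by simp
      then show ?thesis using JC by linarith
    qed
    have JN: "J \<le> N"
    proof -
      have "C * exp (- l / 2) \<le> exp \<bar>ln C\<bar> * exp (- l / 2)"
      proof (intro mult_right_mono)
        have "C = exp (ln C)" using C by simp
        also have "\<dots> \<le> exp \<bar>ln C\<bar>" by simp
        finally show "C \<le> exp \<bar>ln C\<bar>" .
      qed simp
      also have "\<dots> = exp (\<bar>ln C\<bar> - l / 2)" by (simp add: mult_exp_exp)
      also have "\<dots> \<le> 1" using l(4) by simp
      finally have "real N * (C * exp (- l / 2)) \<le> real N * 1" by (intro mult_left_mono) auto
      then have "real J \<le> real N" using J_half by (simp add: mult_ac)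
      then show ?thesis by simp
    qed
    have J_pow: "real J ^ k \<le> C ^ k * R"
    proof -
      have "real J ^ k \<le> (C * R powr (1 / real k)) ^ k" using JC by (intro power_mono) auto
      also have "\<dots> = C ^ k * (R powr (1 / real k)) powr real k"
        using R_ge by (simp only: power_mult_distrib powr_realpow powr_gt_zero)
      also have "(R powr (1 / real k)) powr real k = R" using k R_ge by (simp add: powr_powr)
      finally show ?thesis .
    qed
    have lnR: "0 \<le> ln R" "ln R \<le> l"
      using RN R_ge unfolding l_def by auto
    define u where "u = 1 + real k * l"
    have u: "u \<ge> 1" "l \<le> u" "ln R \<le> u" "1 + real (k - 1) * ln R \<le> u" "u \<le> (real k + 1) * l"
    proof -
      show "u \<ge> 1" using l by (simp add: u_def)
      have "1 * l \<le> real k * l" using k l by (intro mult_right_mono) auto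
      then show lu: "l \<le> u" by (simp add: u_def)
      then show "ln R \<le> u" using lnR by linarith
      have "real (k - 1) * ln R \<le> real k * l" using lnR by (intro mult_mono) auto
      then show "1 + real (k - 1) * ln R \<le> u" by (simp add: u_def)
      show "u \<le> (real k + 1) * l" using l by (simp add: u_def distrib_right)
    qed
    have lnX: "1 + ln X \<le> u" "0 \<le> ln X" unfolding X_def using u R_ge by (auto simp: ln_realpow)
    have l0': "l > 0" using l by simp
    have u0: "u > 0" using u by linarith
    define S where "S = (\<Sum>n\<in>{J<..N}. (\<Prod>i=1..k-1. LambdaT R (int n + j i)) * LambdaT (real N) (int n))"
    \<comment> \<open>The sum starts beyond J >= 1, so the exceptional value at n = 1 does not
      occur.\<close>
    have S_eq: "S = (\<Sum>n\<in>{J<..N}. (\<Prod>i=1..k-1. LambdaT R (int n + j i)) * mangoldt n)"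
      unfolding S_def using J(2) by (intro sum.cong refl) (auto simp: LambdaT_full)
    define V where "V = real N * exp (- \<sigma> * l) * u ^ m"
    have b5: "\<bar>mixed_corr k R (real N) N j - S\<bar> \<le> 2 ^ (k - 1) * C ^ k * V"
    proof -
      have "\<bar>mixed_corr k R (real N) N j - S\<bar> \<le> real J * ((2 * real J * ln R) ^ (k - 1) * l)"
        unfolding S_def
      proof (rule mixed_corr_head[OF R_ge JN])
        fix n :: nat assume n: "1 \<le> n" "n \<le> J"
        have "LambdaT (real N) (int n) = mangoldt n + (if n = 1 then l else 0)"
          unfolding l_def using n JN by (intro LambdaT_full) auto
        moreover have "mangoldt n \<le> l"
        proof -
          have "mangoldt n \<le> ln (real n)" using n by (intro mangoldt_le_ln) auto
          also have "\<dots> \<le> l" unfolding l_def using n JN by (intro ln_mono) auto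
          finally show ?thesis .
        qed
        ultimately show "\<bar>LambdaT (real N) (int n)\<bar> \<le> l" using l0' mangoldt_nonneg[of n] by auto
      qed (use jJ in auto)
      also have "\<dots> = 2 ^ (k - 1) * (real J * real J ^ (k - 1)) * (l * ln R ^ (k - 1))"
        by (simp add: power_mult_distrib mult_ac)
      also have "real J * real J ^ (k - 1) = real J ^ k" using k by (simp add: power_eq_if)
      also have "2 ^ (k - 1) * real J ^ k * (l * ln R ^ (k - 1)) \<le> 2 ^ (k - 1) * (C ^ k * (real N * exp (- \<sigma> * l))) * u ^ m"
      proof (intro mult_mono mult_left_mono)
        show "real J ^ k \<le> C ^ k * (real N * exp (- \<sigma> * l))"
          using J_pow R_le C by (meson mult_left_mono order_trans zero_le_power less_imp_le)
        have "l * ln R ^ (k - 1) \<le> u * u ^ (k - 1)" using u lnR l0' by (intro mult_mono power_mono) auto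
        also have "\<dots> = u ^ k" using k by (simp add: power_eq_if)
        also have "\<dots> \<le> u ^ m" using u by (intro power_increasing) (auto simp: m_def)
        finally show "l * ln R ^ (k - 1) \<le> u ^ m" .
      qed (use C lnR l0' in auto)
      finally show ?thesis by (simp add: V_def mult_ac)
    qed
    have b3: "real J * l * (ln R ^ (k - 1) * (1 + real (k - 1) * ln R) ^ (2 ^ (k - 1 + 0))) \<le> C * V"
    proof -
      have "real J * (l * (ln R ^ (k - 1) * (1 + real (k - 1) * ln R) ^ (2 ^ (k - 1 + 0)))) \<le> (C * (real N * exp (- \<sigma> * l))) * u ^ m"
      proof (intro mult_mono)
        have "\<sigma> * l \<le> (1/2) * l" using sg l0' by (intro mult_right_mono) auto
        then have "exp (- l / 2) \<le> exp (- \<sigma> * l)" by simp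
        then have "C * (real N * exp (- l / 2)) \<le> C * (real N * exp (- \<sigma> * l))" using C by (intro mult_left_mono) auto
        then show "real J \<le> C * (real N * exp (- \<sigma> * l))" using J_half by linarith
        have "l * (ln R ^ (k - 1) * (1 + real (k - 1) * ln R) ^ (2 ^ (k - 1 + 0))) \<le> u * (u ^ (k - 1) * u ^ (2 ^ (k - 1 + 0)))"
          using u lnR l0' by (intro mult_mono power_mono) auto
        also have "\<dots> = u ^ (1 + (k - 1) + 2 ^ (k - 1))" by (simp add: power_add)
        also have "1 + (k - 1) + 2 ^ (k - 1) = m" using k by (simp add: m_def)
        finally show "l * (ln R ^ (k - 1) * (1 + real (k - 1) * ln R) ^ (2 ^ (k - 1 + 0))) \<le> u ^ m" .
      qed (use C lnR l0' in auto)
      then show ?thesis by (simp add: V_def mult_ac)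
    qed
    have b4: "2 * l * R ^ (k - 1) \<le> 2 * V"
    proof -
      have "l * X \<le> u ^ m * (real N * exp (- \<sigma> * l))"
      proof (intro mult_mono X_N)
        have "u ^ 1 \<le> u ^ m" using u k by (intro power_increasing) (auto simp: m_def)
        then show "l \<le> u ^ m" using u by simp
      qed (use u X1 in auto)
      then show ?thesis by (simp add: V_def X_def mult_ac)
    qed
    have lB: "l ^ B > 0" using l0' by simp
    have V_le: "Ak * V \<le> real N / l ^ B / 2"
    proof -
      have "sqrt l \<le> l" using l by (intro real_le_lsqrt) (auto simp: power2_eq_square mult_le_cancel_left1)
      then have "exp (- \<sigma> * l) \<le> exp (- \<sigma> * sqrt l)" using sg by simp
      then have "2 * Ak * u ^ (m + B) * exp (- \<sigma> * l) \<le> 2 * Ak * u ^ (m + B) * exp (- \<sigma> * sqrt l)"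
        using Ak u0 by (intro mult_left_mono) auto
      also have "\<dots> \<le> 1" using l1[OF l(2)] by (simp add: u_def)
      finally have 1: "2 * Ak * (u ^ m * u ^ B) * exp (- \<sigma> * l) \<le> 1" by (simp add: power_add)
      have "2 * Ak * (u ^ m * l ^ B) * exp (- \<sigma> * l) \<le> 2 * Ak * (u ^ m * u ^ B) * exp (- \<sigma> * l)"
        using u l0' Ak u0 by (intro mult_right_mono mult_left_mono power_mono) auto
      then have "2 * Ak * (u ^ m * l ^ B) * exp (- \<sigma> * l) \<le> 1" using 1 by linarith
      then have "real N * (2 * Ak * (u ^ m * l ^ B) * exp (- \<sigma> * l)) \<le> real N * 1" by (intro mult_left_mono) auto
      then have "(2 * (Ak * V)) * l ^ B \<le> real N" by (simp add: V_def mult_ac)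
      then show ?thesis using lB by (simp add: pos_le_divide_eq mult_ac)
    qed
    have b12: "ln R ^ (k - 1) * (\<Sum>q\<in>nle (R ^ (k - 1)). real (tau q) ^ (k - 1) * E_max (real N) q) \<le> 2 * (real N / l ^ B / 5)"
    proof -
      have ut: "u ^ t > 0" using u0 by simp
      have SE: "(\<Sum>q\<in>nle X. E_max (real N) q) \<le> \<bar>Kd\<bar> * (real N / l ^ A')"
      proof -
        have "(\<Sum>q\<in>nle X. E_max (real N) q) \<le> (\<Sum>q\<in>nle (real N powr (\<theta> - \<epsilon>')). E_max (real N) q)"
          using X_le by (intro sum_mono2[OF finite_nle]) (auto simp: nle_def E_max_nonneg)
        also have "\<dots> \<le> Kd * (real N / ln (real N) powr real A')"
          using Kd[OF Nx0] unfolding nle_def E_max_def .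
        also have "ln (real N) powr real A' = l ^ A'" using l0' by (simp add: l_def powr_realpow)
        also have "Kd * (real N / l ^ A') \<le> \<bar>Kd\<bar> * (real N / l ^ A')" using l0' by (intro mult_right_mono) auto
        finally show ?thesis .
      qed
      have "(\<Sum>q\<in>nle X. real (tau q) ^ (k - 1) * E_max (real N) q)
        \<le> u ^ t * (\<Sum>q\<in>nle X. E_max (real N) q) + 3 * real N * ln (real N) * (1 + ln X) ^ (2 ^ (2 * (k - 1) + 1)) / u ^ t"
        by (rule sum_tau_E_max_le[OF X1 XN N3 ut])
      also have "\<dots> \<le> u ^ t * (\<bar>Kd\<bar> * (real N / l ^ A')) + 3 * real N * u * u ^ m0 / u ^ t"
        unfolding m0_def l_def[symmetric] using SE ut u lnX l0'
        by (intro add_mono mult_left_mono divide_right_mono mult_mono power_mono) auto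
      finally have sum: "(\<Sum>q\<in>nle X. real (tau q) ^ (k - 1) * E_max (real N) q) \<le> u ^ t * (\<bar>Kd\<bar> * (real N / l ^ A')) + 3 * real N * u * u ^ m0 / u ^ t" .
      have sum0: "(\<Sum>q\<in>nle X. real (tau q) ^ (k - 1) * E_max (real N) q) \<ge> 0"
        by (intro sum_nonneg mult_nonneg_nonneg E_max_nonneg) (auto simp: nle_def)
      have "ln R ^ (k - 1) * (\<Sum>q\<in>nle X. real (tau q) ^ (k - 1) * E_max (real N) q)
        \<le> u ^ (k - 1) * (u ^ t * (\<bar>Kd\<bar> * (real N / l ^ A')) + 3 * real N * u * u ^ m0 / u ^ t)"
        using sum sum0 u lnR by (intro mult_mono power_mono) auto
      also have "\<dots> = u ^ (k - 1 + t) * (\<bar>Kd\<bar> * (real N / l ^ A')) + 3 * real N * (u ^ (k - 1) * u * u ^ m0 / u ^ t)"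
        by (simp add: power_add algebra_simps)
      also have "u ^ (k - 1) * u * u ^ m0 / u ^ t = 1 / u ^ (B + 1)"
      proof -
        have "u ^ (k - 1) * u * u ^ m0 = u ^ (k + m0)" using power_minus_mult[of k u] k by (simp add: power_add)
        moreover have "u ^ t = u ^ (k + m0) * u ^ (B + 1)" by (simp add: t_def power_add[symmetric])
        ultimately show ?thesis using u0 by simp
      qed
      finally have f: "ln R ^ (k - 1) * (\<Sum>q\<in>nle X. real (tau q) ^ (k - 1) * E_max (real N) q)
        \<le> u ^ (k - 1 + t) * (\<bar>Kd\<bar> * (real N / l ^ A')) + 3 * real N * (1 / u ^ (B + 1))" .
      have g1: "u ^ (k - 1 + t) * (\<bar>Kd\<bar> * (real N / l ^ A')) \<le> real N / l ^ B / 5"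
      proof -
        have "u ^ (k - 1 + t) * (\<bar>Kd\<bar> * (real N / l ^ A')) \<le> ((real k + 1) * l) ^ (k - 1 + t) * (\<bar>Kd\<bar> * (real N / l ^ A'))"
          using u u0 l0' by (intro mult_right_mono power_mono) auto
        also have "\<dots> = c1 / 5 * real N * (l ^ (k - 1 + t) / l ^ A')"
          by (simp add: c1_def power_mult_distrib)
        also have "l ^ (k - 1 + t) / l ^ A' = 1 / (l ^ B * l)"
        proof -
          have "l ^ A' = l ^ (k - 1 + t) * (l ^ B * l)" unfolding A'_def by (simp only: power_add power_one_right mult.assoc)
          then show ?thesis using l0' by simp
        qed
        also have "c1 / 5 * real N * (1 / (l ^ B * l)) = (c1 / l) * (real N / l ^ B / 5)" by simp
        also have "\<dots> \<le> 1 * (real N / l ^ B / 5)"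
          using l(3) l0' lB by (intro mult_right_mono) (auto simp: field_simps)
        finally show ?thesis by simp
      qed
      have g2: "3 * real N * (1 / u ^ (B + 1)) \<le> real N / l ^ B / 5"
      proof -
        have "1 / u ^ (B + 1) \<le> 1 / l ^ (B + 1)"
          using u l0' by (intro divide_left_mono power_mono mult_pos_pos) auto
        then have "3 * real N * (1 / u ^ (B + 1)) \<le> 3 * real N * (1 / l ^ (B + 1))" by (intro mult_left_mono) auto
        also have "\<dots> = (15 / l) * (real N / l ^ B / 5)" by simp
        also have "\<dots> \<le> 1 * (real N / l ^ B / 5)"
          using l(1) l0' lB by (intro mult_right_mono) (auto simp: field_simps)
        finally show ?thesis by simp
      qed
      show ?thesis
        using order_trans[OF f add_mono[OF g1 g2]] unfolding X_def mult_2[of "real N / l ^ B / 5"] .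
    qed
    have corr: "\<bar>S - real N * W k R j\<bar> \<le> 2 * (real N / l ^ B / 5) + C * V + 2 * V"
    proof -
      have "\<bar>S - real N * W k R j\<bar> \<le> ln R ^ (k - 1) * (\<Sum>q\<in>nle (R ^ (k - 1)). real (tau q) ^ (k - 1) * E_max (real N) q)
      + real J * ln (real N) * (ln R ^ (k - 1) * (1 + real (k - 1) * ln R) ^ (2 ^ (k - 1 + 0))) + 2 * ln (real N) * R ^ (k - 1)"
        unfolding S_eq by (rule correlation_mangoldt[OF R_ge JN N1 jJ])
      from order_trans[OF this[folded l_def] add_mono[OF add_mono[OF b12 b3] b4]] show ?thesis .
    qed
    have AkV: "Ak * V = C * V + 2 * V + 2 ^ (k - 1) * C ^ k * V" by (simp add: Ak_def distrib_right)
    have NB0: "real N / l ^ B \<ge> 0" using lB by simp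
    have "\<bar>mixed_corr k R (real N) N j - real N * W k R j\<bar> \<le> \<bar>mixed_corr k R (real N) N j - S\<bar> + \<bar>S - real N * W k R j\<bar>"
      by linarith
    also have "\<dots> \<le> 2 * (real N / l ^ B / 5) + real N / l ^ B / 2"
      using b5 corr V_le AkV by linarith
    also have "\<dots> \<le> real N / l ^ B"
    proof -
      have "2 * (x / 5) + x / 2 \<le> x" if "x \<ge> 0" for x :: real using that by argo
      from this[OF NB0] show ?thesis .
    qed
    also have "\<dots> \<le> real N / l powr Y"
    proof (rule divide_left_mono)
      have "l powr Y \<le> l powr real B" using B l by (intro powr_mono) auto
      then show "l powr Y \<le> l ^ B" using l0' by (simp add: powr_realpow)
    qed (use l0' in auto)
    finally show ?thesis by (simp add: l_def)
  qed
  show ?thesis by (intro exI[of _ N0] allI impI main)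
qed

theorem theorem6:
  shows "\<exists>c1>0::real. \<exists>C0>0::real. \<forall>k::nat. k \<ge> 2 \<longrightarrow>
    (\<exists>K>0::real. \<forall>\<epsilon>>0::real. \<forall>C>0::real. \<exists>N0::nat.
       \<forall>N\<ge>N0. \<forall>(R::real) (j::nat \<Rightarrow> int).
         (\<forall>i\<in>{1..k-1}. j i \<noteq> 0) \<longrightarrow>
         real_of_int (max_abs k j) \<le> C * R powr (1 / real k) \<longrightarrow>
         real N powr \<epsilon> \<le> R \<longrightarrow> R \<le> real N powr (1 / real k) \<longrightarrow>
         \<bar>mixed_corr k R R N j - real N * W k R j\<bar>
           \<le> C0 * R ^ k
             + K * (real N * ln (real N) ^ (4 ^ (k - 1) + k - 2)
                 * exp (- c1 * sqrt (ln (R / real_of_int (max_abs k j) ^ (k - 1)))))) \<and>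
    (\<exists>K>0::real. \<forall>\<theta>::real. 0 < \<theta> \<longrightarrow> \<theta> \<le> 1 \<longrightarrow> distribution_level \<theta> \<longrightarrow>
       (\<forall>A>0::real. \<forall>\<epsilon>>0::real. \<forall>C>0::real. \<exists>N0::nat.
          \<forall>N\<ge>N0. \<forall>(R::real) (j::nat \<Rightarrow> int).
            (\<forall>i\<in>{1..k-1}. j i \<noteq> 0) \<longrightarrow>
            real_of_int (max_abs k j) \<le> C * R powr (1 / real k) \<longrightarrow>
            real N powr \<epsilon> \<le> R \<longrightarrow> R \<le> real N powr (\<theta> / (real k - 1) - \<epsilon>) \<longrightarrow>
            \<bar>mixed_corr k R (real N) N j - real N * W k R j\<bar>
              \<le> K * (real N / ln (real N) powr
                  (A / 2 - 4 powr (real k - 3 / 2) + 2 powr (real k - 1) - 1))))"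
proof -
  obtain c K where c: "c > 0" "K \<ge> 1" "c \<le> 1/5" "\<And>x. x \<ge> 1 \<Longrightarrow> \<bar>hsum x - 1\<bar> \<le> K * Edec c x"
    using hsum_bound by blast
  interpret pnt_error c K by unfold_locales (use c in auto)
  show ?thesis
  \<comment> \<open>All implied constants are 1, since the threshold N0 may depend on k, epsilon, C
    and, in the second part, on theta and A as well. The rate c/2 is the half of the decay that was
    kept.\<close>
  proof (rule exI[of _ "c / 2"], intro conjI exI[of _ "1::real"] allI impI)
    fix k :: nat and \<epsilon> C :: real
    assume k: "k \<ge> 2" and eps: "\<epsilon> > 0" and C: "C > 0"
    obtain N0 where N0: "\<And>N R j. N \<ge> N0 \<Longrightarrow> (\<forall>i\<in>{1..k-1}. j i \<noteq> 0) \<Longrightarrow>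
         real_of_int (max_abs k j) \<le> C * R powr (1 / real k) \<Longrightarrow>
         real N powr \<epsilon> \<le> R \<Longrightarrow> R \<le> real N powr (1 / real k) \<Longrightarrow>
         \<bar>mixed_corr k R R N j - real N * W k R j\<bar>
           \<le> R ^ k + real N * exp (- (c / 2) * sqrt (ln (R / real_of_int (max_abs k j) ^ (k - 1))))"
      using truncated_asymptotics[OF k eps C] by blast
    show "\<exists>N0. \<forall>N\<ge>N0. \<forall>(R::real) (j::nat \<Rightarrow> int).
         (\<forall>i\<in>{1..k-1}. j i \<noteq> 0) \<longrightarrow>
         real_of_int (max_abs k j) \<le> C * R powr (1 / real k) \<longrightarrow>
         real N powr \<epsilon> \<le> R \<longrightarrow> R \<le> real N powr (1 / real k) \<longrightarrow>
         \<bar>mixed_corr k R R N j - real N * W k R j\<bar>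
           \<le> 1 * R ^ k
             + 1 * (real N * ln (real N) ^ (4 ^ (k - 1) + k - 2)
                 * exp (- (c / 2) * sqrt (ln (R / real_of_int (max_abs k j) ^ (k - 1)))))"
    proof (intro exI[of _ "max N0 3"] allI impI)
      fix N R j
      assume N: "N \<ge> max N0 3" and h: "\<forall>i\<in>{1..k-1}. j i \<noteq> 0" "real_of_int (max_abs k j) \<le> C * R powr (1 / real k)"
         "real N powr \<epsilon> \<le> R" "R \<le> real N powr (1 / real k)"
      define E where "E = exp (- (c / 2) * sqrt (ln (R / real_of_int (max_abs k j) ^ (k - 1))))"
      have "exp 1 \<le> real N" using exp_le N by linarith
      then have "ln (real N) \<ge> 1" using N by (subst ln_ge_iff) auto
      then have "1 \<le> ln (real N) ^ (4 ^ (k - 1) + k - 2)" by (rule one_le_power)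
      then have "real N * 1 * E \<le> real N * ln (real N) ^ (4 ^ (k - 1) + k - 2) * E"
        unfolding E_def by (intro mult_right_mono mult_left_mono) auto
      moreover have "\<bar>mixed_corr k R R N j - real N * W k R j\<bar> \<le> R ^ k + real N * E"
        unfolding E_def by (rule N0) (use N h in auto)
      ultimately show "\<bar>mixed_corr k R R N j - real N * W k R j\<bar>
           \<le> 1 * R ^ k
             + 1 * (real N * ln (real N) ^ (4 ^ (k - 1) + k - 2)
                 * exp (- (c / 2) * sqrt (ln (R / real_of_int (max_abs k j) ^ (k - 1)))))"
        unfolding E_def[symmetric] by linarith
    qed
  next
    fix k :: nat and \<theta> A \<epsilon> C :: real
    assume h: "k \<ge> 2" "0 < \<theta>" "\<theta> \<le> 1" "distribution_level \<theta>" "\<epsilon> > 0" "C > 0"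
    show "\<exists>N0. \<forall>N\<ge>N0. \<forall>(R::real) (j::nat \<Rightarrow> int).
            (\<forall>i\<in>{1..k-1}. j i \<noteq> 0) \<longrightarrow>
            real_of_int (max_abs k j) \<le> C * R powr (1 / real k) \<longrightarrow>
            real N powr \<epsilon> \<le> R \<longrightarrow> R \<le> real N powr (\<theta> / (real k - 1) - \<epsilon>) \<longrightarrow>
            \<bar>mixed_corr k R (real N) N j - real N * W k R j\<bar>
              \<le> 1 * (real N / ln (real N) powr
                  (A / 2 - 4 powr (real k - 3 / 2) + 2 powr (real k - 1) - 1))"
      unfolding mult_1 by (rule mangoldt_asymptotics[OF h])
  qed (use c in auto)
qed

end
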